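(* Let $s\in S$ and $\mathrm{TOL}>0$. Then the $L^2$-adaptive knot removal algorithm described in the context, applied to $\mathrm{TOL}$, the control points $\mathbf{c}$ of $s$ and the knot vector $\Xi$, finishes after a finite number of iterations and returns a spline $\hat s\in\hat S$ (where $\hat S$ is the spline space associated with the returned knot vector $\hat\Xi$ and $\hat s$ is the spline in $\hat S$ with the returned control points) such that $$\|s-\hat s\|_{L^2}\le\|s-\hat s\|_\Xi<\mathrm{TOL}.$$
   Context: Splines. Fix a polynomial degree $p\in\mathbb{N}$ (positive integer), breakpoints $a=\zeta_1<\dots<\zeta_N=b$ and multiplicities $1\le m_j\le p+1$, $j=2,\dots,N-1$. $S$ is the space of piecewise polynomial functions of degree $\le p$ on these breakpoints having $p-m_j$ continuous derivatives at $\zeta_j$ (no continuity if $m_j=p+1$); $n:=\dim S=p+1+\sum_{j=2}^{N-1}m_j$. An associated $(p+1)$-basic knot vector is $\Xi=\{\xi_1,\dots,\xi_{n+p+1}\}$ with $\xi_1\le\dots\le\xi_{p+1}=\zeta_1$, followed by each interior breakpoint $\zeta_j$ repeated $m_j$ times in increasing order, followed by $\zeta_N=\xi_{n+1}\le\dots\le\xi_{n+p+1}$. $B_1,\dots,B_n$ is the B-spline basis of degree $p$ of $S$ associated with $\Xi$ (normalized to sum to one on $[a,b]$); the coefficients of a spline in it are its control points. The $\Xi$-norm of $s=\sum_{i=1}^n c_iB_i$ is $\|s\|_\Xi:=\big(\sum_{i=1}^n c_i^2\frac{\xi_{i+p+1}-\xi_i}{p+1}\big)^{1/2}$, and $L^2=L^2[a,b]$.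 Single knot removal. For an interior breakpoint index $j$ ($2\le j\le N-1$) let $i_0:=p+1+\sum_{r=2}^{j}m_r$ (the last index with $\xi_{i_0}=\zeta_j$) and $\ell:=m_j-1$. Let $\hat S_j\subset S$ be the spline space of degree $p$ associated with $\Xi\setminus\{\xi_{i_0}\}$, and $\mathbb{E}_{\Xi,j}(s):=\min_{g\in\hat S_j}\|g-s\|_\Xi$. For $r=1,\dots,p+2-\ell$ let $\alpha_r:=\frac{\xi_{i_0}-\xi_{i_0-p-2+r}}{\xi_{i_0-1+r}-\xi_{i_0-p-2+r}}$ and $e_r:=\big(\frac{\xi_{i_0-1+r}-\xi_{i_0-p-2+r}}{p+1}\big)^{1/2}$. $A_{\rm loc}\in\mathbb{R}^{(p+2-\ell)\times(p+1-\ell)}$ has entries $(A_{\rm loc})_{r,r}=\alpha_r$, $(A_{\rm loc})_{r+1,r}=1-\alpha_{r+1}$ for $r=1,\dots,p+1-\ell$, and zeros elsewhere; $E_{\rm loc}$ is the diagonal matrix with diagonal $(e_1,\dots,e_{p+2-\ell})$. Algorithm ($L^2$-adaptive knot removal). Input: $\mathrm{TOL}>0$, $\mathbf{c}$, $\Xi$. Let $k_{\max}:=\#\Xi-2(p+1)$ be the number of interior knots. Set $k=0$, $\mathbf{c}^{(0)}=\mathbf{c}$, $\Xi^{(0)}=\Xi$. For each $k$, $N^{(k)}$ is the number of breakpoints of $\Xi^{(k)}$, $s_k$ is the spline with control points $\mathbf{c}^{(k)}$ in the spline space of $\Xi^{(k)}$, $\varepsilon_j^{(k)}:=\mathbb{E}_{\Xi^{(k)},j}(s_k)$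 for $2\le j\le N^{(k)}-1$, and $j_*=j_*^{(k)}$ is an index minimizing $\varepsilon_j^{(k)}$ over $2\le j\le N^{(k)}-1$. While $k<k_{\max}$ and $\varepsilon_{j_*}^{(k)}<\mathrm{TOL}$ (current value of $\mathrm{TOL}$), do: 1. replace $\mathrm{TOL}$ by $\mathrm{TOL}-\varepsilon_{j_*}^{(k)}$; 2. let $i_*$ and $\ell_*$ be the values of $i_0$ and $\ell$ for the breakpoint $j_*$ of $\Xi^{(k)}$, and let $\mathbf{c}_{\rm loc}^{(k)}:=(c^{(k)}_{i_*-p-1},\dots,c^{(k)}_{i_*-\ell_*})^T$; 3. let $\mathbf{c}_{\rm loc}^{(k+1)}\in\mathbb{R}^{p+1-\ell_*}$ be the least squares solution of $E_{\rm loc}A_{\rm loc}\mathbf{c}_{\rm loc}^{(k+1)}=E_{\rm loc}\mathbf{c}_{\rm loc}^{(k)}$, with $A_{\rm loc},E_{\rm loc}$ built from $\Xi^{(k)}$ with $i_0=i_*$, $\ell=\ell_*$; 4. form $\mathbf{c}^{(k+1)}$ from $\mathbf{c}^{(k)}$ by replacing the block $\mathbf{c}_{\rm loc}^{(k)}$ by $\mathbf{c}_{\rm loc}^{(k+1)}$ (so $c_i^{(k+1)}=c_i^{(k)}$ for $i\le i_*-p-2$ and $c_i^{(k+1)}=c_{i+1}^{(k)}$ for $i\ge i_*-\ell_*$); 5. set $\Xi^{(k+1)}:=\Xi^{(k)}\setminus\{\xi^{(k)}_{i_*}\}$ and increase $k$ by one. Output: $\hat{\mathbf{c}}=\mathbf{c}^{(k)}$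 and $\hat\Xi=\Xi^{(k)}$ for the final $k$. In the statement, $\mathrm{TOL}$ denotes the input value. *)

theory Defs
  imports
    "HOL-Analysis.Analysis"
    "HOL-Computational_Algebra.Polynomial"
    "HOL-Library.While_Combinator"
    "Jordan_Normal_Form.Matrix"
begin

no_notation inner (infix "\<bullet>" 70)
no_notation vec_nth (infixl "$" 90)
hide_type (open) Finite_Cartesian_Product.vec
hide_const (open) Finite_Cartesian_Product.vec Finite_Cartesian_Product.mat

text \<open>
  Knot vectors are lists and control points are vectors of \<^theory>\<open>Jordan_Normal_Form.Matrix\<close>,
  both indexed from 0 internally.  All index arithmetic below is 1-based: \<open>knot \<Xi> i\<close> and
  \<open>entry v i\<close> are the \<open>i\<close>-th components for \<open>i \<ge> 1\<close>, and \<open>vector n f\<close>, \<open>matrix nr nc f\<close>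
  are built from the values of \<open>f\<close> at indices starting at 1.
\<close>

definition knot :: "real list \<Rightarrow> nat \<Rightarrow> real" where
  "knot \<Xi> i = \<Xi> ! (i - 1)"

definition entry :: "real vec \<Rightarrow> nat \<Rightarrow> real" where
  "entry v i = v $ (i - 1)"

definition vector :: "nat \<Rightarrow> (nat \<Rightarrow> real) \<Rightarrow> real vec" where
  "vector n f = Matrix.vec n (\<lambda>i. f (i + 1))"

definition matrix :: "nat \<Rightarrow> nat \<Rightarrow> (nat \<Rightarrow> nat \<Rightarrow> real) \<Rightarrow> real mat" where
  "matrix nr nc f = Matrix.mat nr nc (\<lambda>(r, q). f (r + 1) (q + 1))"

section \<open>Spline spaces\<close>

text \<open>\<open>f\<close> has \<open>k\<close> continuous derivatives at \<open>x\<close> (\<open>k = 0\<close> is continuity).\<close>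

definition cont_derivs_at :: "nat \<Rightarrow> (real \<Rightarrow> real) \<Rightarrow> real \<Rightarrow> bool" where
  "cont_derivs_at k f x \<longleftrightarrow>
     (\<forall>r<k. \<forall>\<^sub>F y in nhds x. (deriv ^^ r) f field_differentiable (at y)) \<and>
     (\<forall>r\<le>k. isCont ((deriv ^^ r) f) x)"

text \<open>
  Splines are functions on \<open>[\<zeta>\<^sub>1, \<zeta>\<^sub>N]\<close>, encoded as functions on the reals that vanish outside
  this interval.  At a breakpoint a spline takes the value of the piece to the right of it,
  except at \<open>\<zeta>\<^sub>N\<close>; this only matters where no continuity is required.
\<close>

definition spline_space :: "nat \<Rightarrow> nat \<Rightarrow> (nat \<Rightarrow> real) \<Rightarrow> (nat \<Rightarrow> nat) \<Rightarrow> (real \<Rightarrow> real) set" where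
  "spline_space p N \<zeta> m = {f.
     (\<forall>j\<in>{1..<N}. \<exists>P :: real poly. degree P \<le> p \<and>
        (\<forall>x \<in> (if j = N - 1 then {\<zeta> j..\<zeta> (j + 1)} else {\<zeta> j..<\<zeta> (j + 1)}). f x = poly P x)) \<and>
     (\<forall>j\<in>{2..N - 1}. m j \<le> p \<longrightarrow> cont_derivs_at (p - m j) f (\<zeta> j)) \<and>
     (\<forall>x. x \<notin> {\<zeta> 1..\<zeta> N} \<longrightarrow> f x = 0)}"

section \<open>Knot vectors\<close>

definition basic_knot_vector ::
    "nat \<Rightarrow> nat \<Rightarrow> (nat \<Rightarrow> real) \<Rightarrow> (nat \<Rightarrow> nat) \<Rightarrow> real list \<Rightarrow> bool" where
  "basic_knot_vector p N \<zeta> m \<Xi> \<longleftrightarrow>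
     (\<exists>L R. length L = p + 1 \<and> sorted L \<and> last L = \<zeta> 1 \<and>
            length R = p + 1 \<and> sorted R \<and> hd R = \<zeta> N \<and>
            \<Xi> = L @ concat (map (\<lambda>j. replicate (m j) (\<zeta> j)) [2..<N]) @ R)"

text \<open>The dimension \<open>n\<close>, where \<open>\<Xi>\<close> has \<open>n + p + 1\<close> knots.\<close>

definition dim_spl :: "nat \<Rightarrow> real list \<Rightarrow> nat" where
  "dim_spl p \<Xi> = length \<Xi> - (p + 1)"

text \<open>
  Breakpoints and multiplicities recovered from a knot vector: the breakpoints are the distinct
  knots in \<open>[\<xi>\<^bsub>p+1\<^esub>, \<xi>\<^bsub>n+1\<^esub>]\<close>.
\<close>

definition bp_list :: "nat \<Rightarrow> real list \<Rightarrow> real list" where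
  "bp_list p \<Xi> =
     sorted_list_of_set (set \<Xi> \<inter> {knot \<Xi> (p + 1)..knot \<Xi> (dim_spl p \<Xi> + 1)})"

definition num_bp :: "nat \<Rightarrow> real list \<Rightarrow> nat" where
  "num_bp p \<Xi> = length (bp_list p \<Xi>)"

definition bp :: "nat \<Rightarrow> real list \<Rightarrow> nat \<Rightarrow> real" where
  "bp p \<Xi> j = bp_list p \<Xi> ! (j - 1)"

definition bp_mult :: "nat \<Rightarrow> real list \<Rightarrow> nat \<Rightarrow> nat" where
  "bp_mult p \<Xi> j = count_list \<Xi> (bp p \<Xi> j)"

definition knot_space :: "nat \<Rightarrow> real list \<Rightarrow> (real \<Rightarrow> real) set" where
  "knot_space p \<Xi> = spline_space p (num_bp p \<Xi>) (bp p \<Xi>) (bp_mult p \<Xi>)"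

section \<open>B-splines, control points and norms\<close>

text \<open>
  Cox--de Boor recursion; a quotient with zero denominator is 0.  With \<open>b\<close> the right end of the
  basic interval, the functions of degree 0 are right-continuous on \<open>x < b\<close> and left-continuous
  at \<open>b\<close>, so that the B-splines also sum to one at \<open>b\<close>.
\<close>

fun cox_de_boor :: "real list \<Rightarrow> real \<Rightarrow> nat \<Rightarrow> nat \<Rightarrow> real \<Rightarrow> real" where
  "cox_de_boor \<Xi> b 0 i x =
     (if (if x < b then knot \<Xi> i \<le> x \<and> x < knot \<Xi> (i + 1)
          else knot \<Xi> i < x \<and> x \<le> knot \<Xi> (i + 1)) then 1 else 0)"
| "cox_de_boor \<Xi> b (Suc k) i x =
     (x - knot \<Xi> i) / (knot \<Xi> (i + Suc k) - knot \<Xi> i) * cox_de_boor \<Xi> b k i x +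
     (knot \<Xi> (i + Suc k + 1) - x) / (knot \<Xi> (i + Suc k + 1) - knot \<Xi> (i + 1))
       * cox_de_boor \<Xi> b k (i + 1) x"

definition bspline :: "nat \<Rightarrow> real list \<Rightarrow> nat \<Rightarrow> real \<Rightarrow> real" where
  "bspline p \<Xi> i x =
     (if x \<in> {knot \<Xi> (p + 1)..knot \<Xi> (dim_spl p \<Xi> + 1)}
      then cox_de_boor \<Xi> (knot \<Xi> (dim_spl p \<Xi> + 1)) p i x else 0)"

definition spline_of :: "nat \<Rightarrow> real list \<Rightarrow> real vec \<Rightarrow> real \<Rightarrow> real" where
  "spline_of p \<Xi> c = (\<lambda>x. \<Sum>i=1..dim_spl p \<Xi>. entry c i * bspline p \<Xi> i x)"

definition control_points :: "nat \<Rightarrow> real list \<Rightarrow> (real \<Rightarrow> real) \<Rightarrow> real vec" where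
  "control_points p \<Xi> f = (THE c. c \<in> carrier_vec (dim_spl p \<Xi>) \<and> f = spline_of p \<Xi> c)"

definition xi_norm :: "nat \<Rightarrow> real list \<Rightarrow> (real \<Rightarrow> real) \<Rightarrow> real" where
  "xi_norm p \<Xi> f = sqrt (\<Sum>i=1..dim_spl p \<Xi>.
     (entry (control_points p \<Xi> f) i)\<^sup>2 * ((knot \<Xi> (i + p + 1) - knot \<Xi> i) / (real p + 1)))"

definition l2_norm :: "real \<Rightarrow> real \<Rightarrow> (real \<Rightarrow> real) \<Rightarrow> real" where
  "l2_norm a b f = sqrt (LBINT x:{a..b}. (f x)\<^sup>2)"

section \<open>Single knot removal\<close>

definition last_idx :: "nat \<Rightarrow> real list \<Rightarrow> nat \<Rightarrow> nat" where
  "last_idx p \<Xi> j = p + 1 + (\<Sum>r=2..j. bp_mult p \<Xi> r)"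

definition remove_knot :: "nat \<Rightarrow> real list \<Rightarrow> real list" where
  "remove_knot i \<Xi> = take (i - 1) \<Xi> @ drop i \<Xi>"

text \<open>The minimal distance of \<open>s\<close>, in the norm of \<open>\<Xi>\<close>, to the space with one occurrence of the
  \<open>j\<close>-th breakpoint removed; \<open>LEAST\<close> on the reals is the minimum of a set.\<close>

definition removal_error :: "nat \<Rightarrow> real list \<Rightarrow> nat \<Rightarrow> (real \<Rightarrow> real) \<Rightarrow> real" where
  "removal_error p \<Xi> j s =
     (LEAST e. \<exists>g \<in> knot_space p (remove_knot (last_idx p \<Xi> j) \<Xi>).
        e = xi_norm p \<Xi> (\<lambda>x. g x - s x))"

definition alpha :: "nat \<Rightarrow> real list \<Rightarrow> nat \<Rightarrow> nat \<Rightarrow> real" where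
  "alpha p \<Xi> i0 r =
     (knot \<Xi> i0 - knot \<Xi> (i0 + r - (p + 2))) / (knot \<Xi> (i0 + r - 1) - knot \<Xi> (i0 + r - (p + 2)))"

definition A_loc :: "nat \<Rightarrow> real list \<Rightarrow> nat \<Rightarrow> nat \<Rightarrow> real mat" where
  "A_loc p \<Xi> i0 l = matrix (p + 2 - l) (p + 1 - l)
     (\<lambda>r q. if r = q then alpha p \<Xi> i0 r else if r = q + 1 then 1 - alpha p \<Xi> i0 r else 0)"

definition E_loc :: "nat \<Rightarrow> real list \<Rightarrow> nat \<Rightarrow> nat \<Rightarrow> real mat" where
  "E_loc p \<Xi> i0 l = matrix (p + 2 - l) (p + 2 - l)
     (\<lambda>r q. if r = q
            then sqrt ((knot \<Xi> (i0 + r - 1) - knot \<Xi> (i0 + r - (p + 2))) / (real p + 1)) else 0)"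

definition lsq_solution :: "real mat \<Rightarrow> real vec \<Rightarrow> real vec" where
  "lsq_solution M v = (THE x. x \<in> carrier_vec (dim_col M) \<and>
     (\<forall>y \<in> carrier_vec (dim_col M).
        (M *\<^sub>v x - v) \<bullet> (M *\<^sub>v x - v) \<le> (M *\<^sub>v y - v) \<bullet> (M *\<^sub>v y - v)))"

text \<open>The control points \<open>c\<^sub>i\<close>, \<open>i = i0-p-1, \<dots>, i0-l\<close>.\<close>

definition local_block :: "nat \<Rightarrow> nat \<Rightarrow> nat \<Rightarrow> real vec \<Rightarrow> real vec" where
  "local_block p i0 l c = vector (p + 2 - l) (\<lambda>r. entry c (i0 + r - (p + 2)))"

definition replace_block :: "nat \<Rightarrow> nat \<Rightarrow> nat \<Rightarrow> real vec \<Rightarrow> real vec \<Rightarrow> real vec" where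
  "replace_block p i0 l c d = vector (dim_vec c - 1)
     (\<lambda>i. if i \<le> i0 - (p + 2) then entry c i
          else if i < i0 - l then entry d (i - (i0 - (p + 2)))
          else entry c (i + 1))"

section \<open>The algorithm\<close>

text \<open>
  A state consists of the current tolerance, the iteration counter, the control points and the
  knot vector.  The argument \<open>pick\<close> chooses the minimizing breakpoint index; as it sees the
  counter and the whole spline, every resolution of ties is covered by some \<open>pick\<close>.
\<close>

type_synonym state = "real \<times> nat \<times> real vec \<times> real list"

definition min_error_choice :: "nat \<Rightarrow> (nat \<Rightarrow> real vec \<Rightarrow> real list \<Rightarrow> nat) \<Rightarrow> bool" where
  "min_error_choice p pick \<longleftrightarrow>
     (\<forall>k c \<Xi>. {2..num_bp p \<Xi> - 1} \<noteq> {} \<longrightarrow>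
        is_arg_min (\<lambda>j. removal_error p \<Xi> j (spline_of p \<Xi> c))
          (\<lambda>j. j \<in> {2..num_bp p \<Xi> - 1}) (pick k c \<Xi>))"

lemma min_error_choice_exists: "\<exists>pick. min_error_choice p pick"
  unfolding min_error_choice_def
proof (intro exI allI impI)
  fix k :: nat and c \<Xi>
  assume ne: "{2..num_bp p \<Xi> - 1} \<noteq> {}"
  show "is_arg_min (\<lambda>j. removal_error p \<Xi> j (spline_of p \<Xi> c))
          (\<lambda>j. j \<in> {2..num_bp p \<Xi> - 1})
          ((\<lambda>k c \<Xi>. SOME j. is_arg_min (\<lambda>j. removal_error p \<Xi> j (spline_of p \<Xi> c))
             (\<lambda>j. j \<in> {2..num_bp p \<Xi> - 1}) j) k c \<Xi>)"
    by (rule someI_ex, rule ex_is_arg_min_if_finite[OF _ ne]) simp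
qed

fun removal_continues ::
    "nat \<Rightarrow> (nat \<Rightarrow> real vec \<Rightarrow> real list \<Rightarrow> nat) \<Rightarrow> nat \<Rightarrow> state \<Rightarrow> bool" where
  "removal_continues p pick kmax (tol, k, c, \<Xi>) \<longleftrightarrow>
     k < kmax \<and> removal_error p \<Xi> (pick k c \<Xi>) (spline_of p \<Xi> c) < tol"

fun removal_step :: "nat \<Rightarrow> (nat \<Rightarrow> real vec \<Rightarrow> real list \<Rightarrow> nat) \<Rightarrow> state \<Rightarrow> state" where
  "removal_step p pick (tol, k, c, \<Xi>) =
     (let j = pick k c \<Xi>;
          i0 = last_idx p \<Xi> j;
          l = bp_mult p \<Xi> j - 1;
          d = lsq_solution (E_loc p \<Xi> i0 l * A_loc p \<Xi> i0 l)
                           (E_loc p \<Xi> i0 l *\<^sub>v local_block p i0 l c)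
      in (tol - removal_error p \<Xi> j (spline_of p \<Xi> c), k + 1,
          replace_block p i0 l c d, remove_knot i0 \<Xi>))"

text \<open>\<open>None\<close> stands for non-termination.\<close>

definition knot_removal ::
    "nat \<Rightarrow> (nat \<Rightarrow> real vec \<Rightarrow> real list \<Rightarrow> nat) \<Rightarrow> real \<Rightarrow> real vec \<Rightarrow> real list
       \<Rightarrow> (real vec \<times> real list) option" where
  "knot_removal p pick tol c \<Xi> =
     map_option (\<lambda>(tol', k, c', \<Xi>'). (c', \<Xi>'))
       (while_option (removal_continues p pick (length \<Xi> - 2 * (p + 1))) (removal_step p pick)
          (tol, 0, c, \<Xi>))"

end

(*
On a knot interval every B-spline is a polynomial, and a combination of B-splines determines its
coefficients there (differentiate, and use the partition of unity).  Comparing the polynomials on the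
two sides of an m-fold knot, the spline is C^(p-m) there iff the coefficients of the B-splines alive on
both sides agree; this gives both halves of the Curry-Schoenberg theorem.  By Boehm's insertion formula
removing a knot replaces control points c by d with c ~ A d, where A is bidiagonal and the identity
away from the block of the algorithm, so the local least squares solution realizes the minimal
distance.  The rows of A are convex combinations, hence the norm of a spline in the coarse space
dominates its norm with respect to the finer knot vector, and the errors of the successive removals
add up by the triangle inequality.  Finally the L2 norm is dominated since B-splines are nonnegative,
sum to one and B_i integrates to at most (xi_(i+p+1) - xi_i)/(p+1).
*)
theory Submission
  imports Defs "Jordan_Normal_Form.Determinant"
begin

hide_const (open) Module.smult

section \<open>Polynomial pieces of B-splines\<close>

text \<open>Repeated knots produce quotients with zero denominator throughout, and as functions the
  B-splines depend on a convention at breakpoints. One polynomial per nonempty knot interval removes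
  the second difficulty: both neighbouring pieces can be evaluated at the knot itself, and
  smoothness becomes divisibility of their difference by a power of \<open>[:-\<tau>, 1:]\<close>.
  The first is met by dividing each B-spline by the length of its support (\<open>npiece\<close>),
  with result 0 for length 0. Control points and least squares solutions are defined by
  \<open>THE\<close>, the removal error by \<open>LEAST\<close>; so linear independence, injectivity
  and attainment of the minimum must be known before anything can be computed with them. Convex rows
  alone do not give the comparison of the norms: the weighted column sums must also reproduce the
  weights of the coarse knots (\<open>weight_remove_knot\<close>). The final bound is strict because
  an error is subtracted only if it is smaller than the remaining tolerance, so a positive rest is
  always kept.\<close>

text \<open>The B-spline \<open>B\<^bsub>i,k\<^esub>\<close> of the knots \<open>t\<close> coincides with \<open>piece t \<mu> k i\<close> on the knot interval
  from \<open>t \<mu>\<close> to \<open>t (\<mu> + 1)\<close>; as a polynomial it can also be evaluated beyond that interval.\<close>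

fun piece :: "(nat \<Rightarrow> real) \<Rightarrow> nat \<Rightarrow> nat \<Rightarrow> nat \<Rightarrow> real poly" where
  "piece t \<mu> 0 i = (if i = \<mu> then 1 else 0)"
| "piece t \<mu> (Suc k) i =
     smult (1 / (t (i + k + 1) - t i)) ([:- t i, 1:] * piece t \<mu> k i) +
     smult (1 / (t (i + k + 2) - t (i + 1))) ([:t (i + k + 2), -1:] * piece t \<mu> k (i + 1))"

text \<open>The normalization in which the recursion has linear factors without denominators and
  derivatives are plain differences. Division by zero makes it 0 on an empty support.\<close>

definition npiece :: "(nat \<Rightarrow> real) \<Rightarrow> nat \<Rightarrow> nat \<Rightarrow> nat \<Rightarrow> real poly" where
  "npiece t \<mu> k i = smult (1 / (t (i + k + 1) - t i)) (piece t \<mu> k i)"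

definition piece_sum :: "(nat \<Rightarrow> real) \<Rightarrow> nat \<Rightarrow> nat \<Rightarrow> (nat \<Rightarrow> real) \<Rightarrow> real poly" where
  "piece_sum t \<mu> k c = (\<Sum>i\<le>\<mu>. smult (c i) (piece t \<mu> k i))"

lemma piece_Suc:
  "piece t \<mu> (Suc k) i =
     [:- t i, 1:] * npiece t \<mu> k i + [:t (i + k + 2), -1:] * npiece t \<mu> k (i + 1)"
  by (simp add: npiece_def mult_smult_right)

lemma poly_piece_Suc:
  "poly (piece t \<mu> (Suc k) i) x =
     (x - t i) * poly (npiece t \<mu> k i) x + (t (i + k + 2) - x) * poly (npiece t \<mu> k (i + 1)) x"
  by (simp only: piece_Suc poly_add poly_mult) (simp add: algebra_simps)

declare piece.simps(2) [simp del]

lemma poly_npiece: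
  "poly (npiece t \<mu> k i) x = poly (piece t \<mu> k i) x / (t (i + k + 1) - t i)"
  by (simp add: npiece_def)

lemma piece_eq_0: "\<mu> < i \<or> i + k < \<mu> \<Longrightarrow> piece t \<mu> k i = 0"
  by (induction k arbitrary: i) (auto simp: piece_Suc npiece_def)

lemma npiece_eq_0: "\<mu> < i \<or> i + k < \<mu> \<Longrightarrow> npiece t \<mu> k i = 0"
  by (auto simp: npiece_def piece_eq_0)

lemma npiece_degenerate: "t (i + k + 1) = t i \<Longrightarrow> npiece t \<mu> k i = 0"
  by (simp add: npiece_def)

lemma degree_piece: "degree (piece t \<mu> k i) \<le> k"
proof (induction k arbitrary: i)
  case (Suc k)
  have "degree ([:x, y:] * npiece t \<mu> k j) \<le> Suc k" for x y j
  proof -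
    have "degree ([:x, y:] * npiece t \<mu> k j) \<le> degree [:x, y:] + degree (npiece t \<mu> k j)"
      by (rule degree_mult_le)
    also have "\<dots> \<le> 1 + k"
      using Suc[of j] degree_smult_le[of _ "piece t \<mu> k j"] unfolding npiece_def
      by (intro add_mono) (auto intro: order_trans)
    finally show ?thesis by simp
  qed
  note * = this
  show ?case unfolding piece_Suc by (rule degree_add_le; rule *)
qed simp

lemma degree_piece_sum: "degree (piece_sum t \<mu> k c) \<le> k"
  unfolding piece_sum_def
  by (intro degree_sum_le) (auto intro: order_trans[OF degree_smult_le] degree_piece)

lemma poly_piece_sum: "poly (piece_sum t \<mu> k c) x = (\<Sum>i\<le>\<mu>. c i * poly (piece t \<mu> k i) x)"
  by (simp add: piece_sum_def poly_sum)

text \<open>Locality: only \<open>k + 1\<close> coefficients matter on one interval. This allows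
  coefficient sequences found on neighbouring intervals to be glued.\<close>

lemma piece_sum_cong:
  "(\<And>i. i \<le> \<mu> \<Longrightarrow> \<mu> \<le> i + k \<Longrightarrow> c i = c' i) \<Longrightarrow> piece_sum t \<mu> k c = piece_sum t \<mu> k c'"
  unfolding piece_sum_def by (rule sum.cong) (metis atMost_iff not_le piece_eq_0 smult_0_right)+

lemma piece_sum_add: "piece_sum t \<mu> k (\<lambda>i. c i + c' i) = piece_sum t \<mu> k c + piece_sum t \<mu> k c'"
  by (simp add: piece_sum_def smult_add_left sum.distrib)

lemma piece_sum_const: "piece_sum t \<mu> k (\<lambda>_. a) = smult a (piece_sum t \<mu> k (\<lambda>_. 1))"
  by (simp add: poly_eq_poly_eq_iff[symmetric] fun_eq_iff poly_piece_sum sum_distrib_left)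

lemma pderiv_sum: "pderiv (sum f S) = (\<Sum>i\<in>S. pderiv (f i))"
  by (induction S rule: infinite_finite_induct) (simp_all add: pderiv_add)

lemma pderiv_linear: "pderiv [:a, b:] = [:b:]"
  by (simp add: pderiv_pCons)

text \<open>Reindexes the half of the recursion that refers to \<open>i + 1\<close>. In its uses
  \<open>f 0\<close> vanishes because the degree is below \<open>\<mu>\<close>, and
  \<open>f (Suc n)\<close> because that piece starts to the right of the interval.\<close>

lemma sum_shift:
  fixes f :: "nat \<Rightarrow> 'a::comm_monoid_add"
  assumes "f 0 = 0" "f (Suc n) = 0"
  shows "(\<Sum>i\<le>n. f (i + 1)) = (\<Sum>i\<le>n. f i)"
  using assms sum.atMost_Suc_shift[of f n] by simp

locale knot_seq =
  fixes t :: "nat \<Rightarrow> real"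
  assumes mono: "mono t"
begin

lemma le: "i \<le> j \<Longrightarrow> t i \<le> t j"
  using mono by (rule monoD)

lemma active_less: "t \<mu> < t (\<mu> + 1) \<Longrightarrow> i \<le> \<mu> \<Longrightarrow> \<mu> \<le> i + k \<Longrightarrow> t i < t (i + k + 1)"
  using le[of i \<mu>] le[of "\<mu> + 1" "i + k + 1"] by linarith

text \<open>Multiplying back is legitimate: over a nonempty interval an active B-spline has positive
  support length, and an inactive one is 0 on both sides.\<close>

lemma piece_eq_npiece:
  assumes "t \<mu> < t (\<mu> + 1)"
  shows "poly (piece t \<mu> k i) x = (t (i + k + 1) - t i) * poly (npiece t \<mu> k i) x"
  using active_less[OF assms, of i k] piece_eq_0[of \<mu> i k t]
  by (cases "i \<le> \<mu> \<and> \<mu> \<le> i + k") (auto simp: poly_npiece not_le)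

lemma pderiv_piece:
  "pderiv (piece t \<mu> (Suc k) i) = smult (real (Suc k)) (npiece t \<mu> k i - npiece t \<mu> k (i + 1))"
proof (induction k arbitrary: i)
  case 0
  have "pderiv (npiece t \<mu> 0 j) = 0" for j by (simp add: npiece_def pderiv_smult)
  thus ?case by (simp add: piece_Suc pderiv_mult pderiv_add pderiv_linear del: mult_pCons_left)
next
  case (Suc k)
  define u where "u j = poly (npiece t \<mu> k j)" for j
  define v where "v j = poly (npiece t \<mu> (Suc k) j)" for j
  have v: "v j x = ((x - t j) * u j x + (t (j + k + 2) - x) * u (j + 1) x) / (t (j + k + 2) - t j)" for j x
    unfolding u_def v_def using poly_piece_Suc[of t \<mu> k j x] by (simp add: poly_npiece)
  have d: "poly (pderiv (npiece t \<mu> (Suc k) j)) x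
      = real (Suc k) * (u j x - u (j + 1) x) / (t (j + k + 2) - t j)" for j x
    unfolding npiece_def[of _ _ "Suc k"] pderiv_smult Suc u_def by (simp del: of_nat_Suc)
  have u0: "t (j + k + 1) = t j \<Longrightarrow> u j x = 0" for j x
    unfolding u_def using npiece_degenerate[of t j k \<mu>] by simp
  \<comment> \<open>What the product rule leaves besides \<open>v i x - v (i + 1) x\<close>, up to
    the factor \<open>Suc k\<close>. The halves yield \<open>v i x\<close> and
    \<open>- v (i + 1) x\<close> up to multiples of \<open>u (i + 1) x\<close> that cancel; if a
    denominator is 0 one of them is missing, but then \<open>u (i + 1) x\<close> is itself 0 (facts
    \<open>c\<close> and \<open>d\<close>).\<close>
  have key: "(x - t i) * ((u i x - u (i + 1) x) / (t (i + k + 2) - t i))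
      + (t (i + k + 3) - x) * ((u (i + 1) x - u (i + 2) x) / (t (i + k + 3) - t (i + 1)))
      = v i x - v (i + 1) x" for x
  proof -
    have a: "(x - t i) * ((u i x - u (i + 1) x) / (t (i + k + 2) - t i)) - v i x
        = (if t (i + k + 2) = t i then 0 else - u (i + 1) x)"
      by (simp add: v divide_simps) (simp add: algebra_simps)
    have b: "(t (i + k + 3) - x) * ((u (i + 1) x - u (i + 2) x) / (t (i + k + 3) - t (i + 1))) + v (i + 1) x
        = (if t (i + k + 3) = t (i + 1) then 0 else u (i + 1) x)"
      by (simp add: v divide_simps eval_nat_numeral) (simp add: algebra_simps)
    have c: "t (i + k + 2) = t i \<Longrightarrow> u (i + 1) x = 0"
      using u0[of "i + 1" x] le[of i "i + 1"] le[of "i + 1" "i + k + 2"] by simp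
    have d: "t (i + k + 3) = t (i + 1) \<Longrightarrow> u (i + 1) x = 0"
      using u0[of "i + 1" x] le[of "i + 1" "i + k + 2"] le[of "i + k + 2" "i + k + 3"] by simp
    show ?thesis using a b c d by (auto split: if_splits)
  qed
  have "poly (pderiv (piece t \<mu> (Suc (Suc k)) i)) x
      = poly (smult (real (Suc (Suc k))) (npiece t \<mu> (Suc k) i - npiece t \<mu> (Suc k) (i + 1))) x" for x
  proof -
    have "poly (pderiv (piece t \<mu> (Suc (Suc k)) i)) x
       = v i x - v (i + 1) x + ((x - t i) * poly (pderiv (npiece t \<mu> (Suc k) i)) x
         + (t (i + k + 3) - x) * poly (pderiv (npiece t \<mu> (Suc k) (i + 1))) x)"
      unfolding piece_Suc[of t \<mu> "Suc k"] v_def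
      by (simp add: pderiv_mult pderiv_add pderiv_linear eval_nat_numeral del: mult_pCons_left)
    also have "\<dots> = v i x - v (i + 1) x + real (Suc k) * (v i x - v (i + 1) x)"
      unfolding key[symmetric] d by (simp add: eval_nat_numeral) (simp add: algebra_simps)
    finally show ?thesis by (simp add: v_def algebra_simps)
  qed
  thus ?case by (simp add: poly_eq_poly_eq_iff[symmetric] fun_eq_iff del: of_nat_Suc)
qed

text \<open>After the index shift the two factors of \<open>npiece t \<mu> k i\<close> add up to the
  support length, \<open>(x - t i) + (t (i + k + 1) - x)\<close>, so the sum for degree
  \<open>k + 1\<close> equals the one for degree \<open>k\<close>.\<close>

lemma piece_sum_one:
  assumes "t \<mu> < t (\<mu> + 1)" "k \<le> \<mu>"
  shows "piece_sum t \<mu> k (\<lambda>_. 1) = 1"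
  using assms(2)
proof (induction k)
  case 0
  show ?case by (simp add: piece_sum_def)
next
  case (Suc k)
  have "poly (piece_sum t \<mu> (Suc k) (\<lambda>_. 1)) x = poly (piece_sum t \<mu> k (\<lambda>_. 1)) x" for x
  proof -
    let ?u = "\<lambda>i. poly (npiece t \<mu> k i) x"
    have "poly (piece_sum t \<mu> (Suc k) (\<lambda>_. 1)) x
      = (\<Sum>i\<le>\<mu>. (x - t i) * ?u i) + (\<Sum>i\<le>\<mu>. (t (i + 1 + k + 1) - x) * ?u (i + 1))"
      by (simp add: poly_piece_sum poly_piece_Suc sum.distrib)
    also have "(\<Sum>i\<le>\<mu>. (t (i + 1 + k + 1) - x) * ?u (i + 1)) = (\<Sum>i\<le>\<mu>. (t (i + k + 1) - x) * ?u i)"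
      by (rule sum_shift[of "\<lambda>i. (t (i + k + 1) - x) * ?u i"]) (use Suc.prems in \<open>auto simp: npiece_eq_0\<close>)
    also have "(\<Sum>i\<le>\<mu>. (x - t i) * ?u i) + \<dots> = (\<Sum>i\<le>\<mu>. poly (piece t \<mu> k i) x)"
      unfolding sum.distrib[symmetric]
      by (rule sum.cong) (simp_all add: piece_eq_npiece[OF assms(1)] algebra_simps)
    finally show ?thesis by (simp add: poly_piece_sum)
  qed
  hence "piece_sum t \<mu> (Suc k) (\<lambda>_. 1) = piece_sum t \<mu> k (\<lambda>_. 1)"
    by (simp add: poly_eq_poly_eq_iff[symmetric] fun_eq_iff)
  thus ?case using Suc by simp
qed

text \<open>Summation by parts. The truncated \<open>i - 1\<close> at \<open>i = 0\<close> does no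
  harm, since the piece of index 0 is zero for \<open>k < \<mu>\<close>.\<close>

lemma pderiv_piece_sum:
  assumes "k < \<mu>"
  shows "pderiv (piece_sum t \<mu> (Suc k) c)
    = piece_sum t \<mu> k (\<lambda>i. real (Suc k) * (c i - c (i - 1)) / (t (i + k + 1) - t i))"
proof -
  have "poly (pderiv (piece_sum t \<mu> (Suc k) c)) x
    = poly (piece_sum t \<mu> k (\<lambda>i. real (Suc k) * (c i - c (i - 1)) / (t (i + k + 1) - t i))) x" for x
  proof -
    let ?u = "\<lambda>i. poly (npiece t \<mu> k i) x"
    have "pderiv (piece_sum t \<mu> (Suc k) c) = (\<Sum>i\<le>\<mu>. smult (c i) (pderiv (piece t \<mu> (Suc k) i)))"
      unfolding piece_sum_def by (simp add: pderiv_sum pderiv_smult)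
    hence "poly (pderiv (piece_sum t \<mu> (Suc k) c)) x
      = real (Suc k) * ((\<Sum>i\<le>\<mu>. c i * ?u i) - (\<Sum>i\<le>\<mu>. c (i + 1 - 1) * ?u (i + 1)))"
      unfolding pderiv_piece
      by (simp add: poly_sum sum_distrib_left sum_subtractf[symmetric] algebra_simps)
    also have "(\<Sum>i\<le>\<mu>. c (i + 1 - 1) * ?u (i + 1)) = (\<Sum>i\<le>\<mu>. c (i - 1) * ?u i)"
      by (rule sum_shift[of "\<lambda>i. c (i - 1) * ?u i"]) (use assms in \<open>auto simp: npiece_eq_0\<close>)
    finally show ?thesis
      by (simp add: poly_piece_sum poly_npiece sum_distrib_left sum_subtractf[symmetric]
          algebra_simps diff_divide_distrib add_divide_distrib)
  qed
  thus ?thesis by (simp add: poly_eq_poly_eq_iff[symmetric] fun_eq_iff)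
qed

lemma steps_zero_const:
  fixes c :: "nat \<Rightarrow> real"
  assumes "\<And>i. a < i \<Longrightarrow> i \<le> b \<Longrightarrow> c i = c (i - 1)" "a \<le> i" "i \<le> b"
  shows "c i = c b"
  using assms(3,2)
proof (induction i rule: inc_induct)
  case (step j)
  thus ?case using assms(1)[of "Suc j"] by simp
qed simp

lemma piece_sum_eq_0_imp:
  assumes "t \<mu> < t (\<mu> + 1)" "k \<le> \<mu>" "piece_sum t \<mu> k c = 0" "i \<le> \<mu>" "\<mu> \<le> i + k"
  shows "c i = 0"
  using assms(2-)
proof (induction k arbitrary: c i)
  case 0
  have "poly (piece_sum t \<mu> 0 c) 0 = c \<mu>"
  proof -
    have "poly (piece_sum t \<mu> 0 c) 0 = (\<Sum>i\<le>\<mu>. if i = \<mu> then c i else 0)"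
      unfolding poly_piece_sum by (rule sum.cong) auto
    thus ?thesis by simp
  qed
  with 0 show ?case by (simp add: le_antisym)
next
  case (Suc k)
  have "c j = c (j - 1)" if "j \<le> \<mu>" "\<mu> - Suc k < j" for j
  proof -
    have "real (Suc k) * (c j - c (j - 1)) / (t (j + k + 1) - t j) = 0"
      using Suc.prems pderiv_piece_sum[of k \<mu> c] that
      by (intro Suc.IH[of "\<lambda>i. real (Suc k) * (c i - c (i - 1)) / (t (i + k + 1) - t i)"]) auto
    moreover have "t j < t (j + k + 1)" 
      by (rule active_less[OF assms(1)]) (use that in linarith)+
    ultimately show ?thesis by (simp del: of_nat_Suc)
  qed
  hence const: "c j = c \<mu>" if "j \<le> \<mu>" "\<mu> \<le> j + Suc k" for j
    using steps_zero_const[of "\<mu> - Suc k" \<mu> c j] that by auto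
  have "piece_sum t \<mu> (Suc k) c = piece_sum t \<mu> (Suc k) (\<lambda>_. c \<mu>)"
    by (rule piece_sum_cong) (rule const)
  also have "\<dots> = smult (c \<mu>) 1"
    by (subst piece_sum_const) (simp only: piece_sum_one[OF assms(1) Suc.prems(1)])
  finally have "c \<mu> = 0" using Suc.prems(2) by simp
  thus ?case using const[of i] Suc.prems by linarith
qed

lemma ex_piece_sum:
  assumes "t \<mu> < t (\<mu> + 1)" "k \<le> \<mu>" "degree P \<le> k"
  shows "\<exists>c. P = piece_sum t \<mu> k c"
  using assms(2-)
proof (induction k arbitrary: P)
  case 0
  then obtain a where "P = [:a:]" by (metis degree_eq_zeroE le_zero_eq)
  hence "P = piece_sum t \<mu> 0 (\<lambda>_. a)"
    using piece_sum_const[of t \<mu> 0 a] piece_sum_one[OF assms(1), of 0] by (simp add: one_pCons)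
  thus ?case by blast
next
  case (Suc k)
  obtain e where e: "pderiv P = piece_sum t \<mu> k e"
  proof -
    have "degree (pderiv P) \<le> k" using Suc.prems by (simp add: degree_pderiv)
    thus ?thesis using Suc.IH[of "pderiv P"] Suc.prems that by auto
  qed
  \<comment> \<open>Partial sums invert the divided differences of \<open>pderiv_piece_sum\<close>.
    The remaining constant of integration is then added to all coefficients at once, by the
    partition of unity.\<close>
  define c where "c i = (\<Sum>j\<le>i. e j * (t (j + k + 1) - t j) / real (Suc k))" for i
  have diff: "real (Suc k) * (c i - c (i - 1)) / (t (i + k + 1) - t i) = e i"
    if "i \<le> \<mu>" "\<mu> \<le> i + k" for i
  proof -
    have "c i - c (i - 1) = e i * (t (i + k + 1) - t i) / real (Suc k)"
      using that Suc.prems by (cases i) (simp_all add: c_def)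
    thus ?thesis using active_less[OF assms(1) that] by (simp del: of_nat_Suc)
  qed
  have "pderiv (P - piece_sum t \<mu> (Suc k) c) = 0"
  proof -
    have "pderiv (piece_sum t \<mu> (Suc k) c) = piece_sum t \<mu> k e"
      using Suc.prems by (subst pderiv_piece_sum) (simp, rule piece_sum_cong, rule diff)
    thus ?thesis by (simp add: pderiv_diff e)
  qed
  then obtain r where "P - piece_sum t \<mu> (Suc k) c = [:r:]" using pderiv_iszero by blast
  also have "[:r:] = piece_sum t \<mu> (Suc k) (\<lambda>_. r)"
    using piece_sum_const[of t \<mu> "Suc k" r] piece_sum_one[OF assms(1), of "Suc k"] Suc.prems
    by (simp add: one_pCons)
  finally have "P = piece_sum t \<mu> (Suc k) (\<lambda>i. c i + r)" by (simp add: piece_sum_add algebra_simps)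
  thus ?case by blast
qed

text \<open>Whenever a linear factor of the recursion would be negative on the interval, the piece
  it multiplies is 0.\<close>

lemma poly_piece_nonneg:
  assumes "t \<mu> \<le> x" "x \<le> t (\<mu> + 1)"
  shows "0 \<le> poly (piece t \<mu> k i) x"
proof (induction k arbitrary: i)
  case (Suc k)
  have u: "0 \<le> poly (npiece t \<mu> k j) x" for j
    using Suc[of j] le[of j "j + k + 1"] by (simp add: poly_npiece)
  have "0 \<le> (x - t i) * poly (npiece t \<mu> k i) x"
    using u[of i] le[of i \<mu>] assms by (cases "i \<le> \<mu>") (auto simp: npiece_eq_0)
  moreover have "0 \<le> (t (i + k + 2) - x) * poly (npiece t \<mu> k (i + 1)) x"
    using u[of "i + 1"] le[of "\<mu> + 1" "i + k + 2"] assms by (cases "\<mu> \<le> i + 1 + k") (auto simp: npiece_eq_0)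
  ultimately show ?case by (simp add: poly_piece_Suc)
qed simp

end

section \<open>Multiple knots and knot insertion\<close>

text \<open>Differentiation lowers the order of a zero by exactly one. This carries smoothness
  conditions through inductions on the degree.\<close>

lemma power_dvd_iff_pderiv:
  fixes D :: "real poly"
  shows "[:-a, 1:] ^ Suc e dvd D \<longleftrightarrow> poly D a = 0 \<and> [:-a, 1:] ^ e dvd pderiv D"
proof (cases "D = 0 \<or> poly D a \<noteq> 0")
  case True
  have "poly D a = 0" if "[:-a, 1:] ^ Suc e dvd D"
    using dvd_mult_left[of "[:-a, 1:]" _ D] that unfolding power_Suc poly_eq_0_iff_dvd by blast
  thus ?thesis using True by (auto simp del: power_Suc)
next
  case False
  hence D: "D \<noteq> 0" "poly D a = 0" by auto
  show ?thesis
  proof (cases "pderiv D = 0")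
    case True
    then obtain h where "D = [:h:]" using pderiv_iszero by blast
    thus ?thesis using D by simp
  next
    case False
    have "[:-a, 1:] ^ Suc e dvd D \<longleftrightarrow> Suc e \<le> order a D" using D by (simp only: order_divides) simp
    also have "\<dots> \<longleftrightarrow> e \<le> order a (pderiv D)" unfolding order_pderiv[OF D] by simp
    also have "\<dots> \<longleftrightarrow> [:-a, 1:] ^ e dvd pderiv D" using False by (simp only: order_divides) simp
    finally show ?thesis using D by blast
  qed
qed

lemma power_dvd_iff_higher_pderiv:
  fixes D :: "real poly"
  shows "[:-a, 1:] ^ e dvd D \<longleftrightarrow> (\<forall>r<e. poly ((pderiv ^^ r) D) a = 0)"
proof (induction e arbitrary: D)
  case (Suc e)
  show ?case
    unfolding power_dvd_iff_pderiv Suc.IH All_less_Suc2 funpow_Suc_right by simp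
qed simp

text \<open>\<open>\<mu>\<close> and \<open>\<mu>'\<close> index the two nonempty knot intervals
  that meet at \<open>\<tau>\<close>, so \<open>\<mu>' - \<mu>\<close> is the multiplicity of the
  knot.\<close>

locale multiple_knot = knot_seq +
  fixes \<mu> \<mu>' :: nat and \<tau> :: real
  assumes less: "\<mu> < \<mu>'"
    and left: "t \<mu> < t (\<mu> + 1)" and right: "t \<mu>' < t (\<mu>' + 1)"
    and eq: "\<And>i. \<mu> < i \<Longrightarrow> i \<le> \<mu>' \<Longrightarrow> t i = \<tau>"
begin

text \<open>While the degree does not exceed the multiplicity, exactly one B-spline is nonzero at
  the knot, with value 1: seen from the left the one of index \<open>\<mu>\<close>, seen from the
  right (\<open>poly_piece_right\<close>) the one of index \<open>\<mu>' - k\<close>.\<close>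

lemma poly_piece_left:
  "\<mu> + k \<le> \<mu>' \<Longrightarrow> poly (piece t \<mu> k i) \<tau> = (if i = \<mu> then 1 else 0)"
proof (induction k arbitrary: i)
  case (Suc k)
  have "\<tau> \<noteq> t \<mu>" "t (\<mu> + k + 1) = \<tau>" using eq[of "\<mu> + 1"] eq[of "\<mu> + k + 1"] left less Suc.prems by auto
  thus ?case using Suc by (auto simp: poly_piece_Suc poly_npiece)
qed simp

lemma poly_piece_right:
  "\<mu> + k \<le> \<mu>' \<Longrightarrow> poly (piece t \<mu>' k i) \<tau> = (if i + k = \<mu>' then 1 else 0)"
proof (induction k arbitrary: i)
  case (Suc k)
  have "t i = \<tau>" if "i + k = \<mu>'" using eq[of i] that Suc.prems by auto
  moreover have "t (i + 1) = \<tau>" "t (i + k + 2) \<noteq> \<tau>" if "i + 1 + k = \<mu>'"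
  proof -
    show "t (i + 1) = \<tau>" using eq[of "i + 1"] that Suc.prems by linarith
    have "i + k + 2 = \<mu>' + 1" using that by simp
    thus "t (i + k + 2) \<noteq> \<tau>" using eq[of \<mu>'] right less by (metis le_refl less_irrefl)
  qed
  moreover have "\<mu> + k \<le> \<mu>'" using Suc.prems by simp
  note IH = Suc.IH[OF this]
  ultimately show ?case
    by (cases "i + k = \<mu>'"; cases "i + 1 + k = \<mu>'") (simp_all add: poly_piece_Suc poly_npiece IH)
qed simp

text \<open>Continuity once the degree reaches the multiplicity. The induction effectively starts
  where both are equal: there the indices \<open>\<mu>\<close> and \<open>\<mu>' - k\<close> of the
  two interpolating B-splines coincide. The recursion evaluated at \<open>\<tau>\<close> preserves
  equality.\<close>

lemma poly_piece_eq:
  "\<mu>' \<le> \<mu> + k \<Longrightarrow> poly (piece t \<mu> k i) \<tau> = poly (piece t \<mu>' k i) \<tau>"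
proof (induction k arbitrary: i)
  case (Suc k)
  show ?case
  proof (cases "\<mu>' \<le> \<mu> + k")
    case True
    thus ?thesis by (simp add: poly_piece_Suc poly_npiece Suc.IH[OF True])
  next
    case False
    hence *: "\<mu>' = \<mu> + Suc k" using Suc.prems by simp
    have "i = \<mu> \<longleftrightarrow> i + Suc k = \<mu>'" unfolding * by simp
    thus ?thesis using poly_piece_left[of "Suc k" i] poly_piece_right[of "Suc k" i] * by (simp only: le_refl)
  qed
qed (use less in simp)

text \<open>The B-splines alive on both sides of the knot have common values at \<open>\<tau>\<close> summing to one.  By
  induction through the derivative the differences of the two coefficient sequences are constant on
  the overlap, and continuity at \<open>\<tau>\<close> then makes the constant vanish.\<close>

lemma power_dvd_diff_iff:
  assumes "\<mu>' \<le> \<mu> + k + 1" "k \<le> \<mu>"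
  shows "[:-\<tau>, 1:] ^ (\<mu> + k + 1 - \<mu>') dvd piece_sum t \<mu>' k c' - piece_sum t \<mu> k c
    \<longleftrightarrow> (\<forall>i. \<mu>' \<le> i + k \<and> i \<le> \<mu> \<longrightarrow> c i = c' i)"
  using assms
proof (induction k arbitrary: c c')
  case 0
  hence *: "\<mu>' = \<mu> + 1" using less by simp
  show ?case unfolding * by simp
next
  case (Suc k)
  show ?case
  proof (cases "\<mu>' = \<mu> + Suc k + 1")
    \<comment> \<open>The multiplicity exceeds the degree: the exponent is 0 and no index is alive
      on both sides.\<close>
    case True
    show ?thesis unfolding True by simp
  next
    case False
    define D where "D = piece_sum t \<mu>' (Suc k) c' - piece_sum t \<mu> (Suc k) c"
    define e where "e c i = real (Suc k) * (c i - c (i - 1)) / (t (i + k + 1) - t i)"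
      for c :: "nat \<Rightarrow> real" and i
    have k: "k < \<mu>" "k < \<mu>'" "\<mu>' \<le> \<mu> + k + 1" using Suc.prems False less by auto
    have e_eq: "e c i = e c' i \<longleftrightarrow> c i - c (i - 1) = c' i - c' (i - 1)" if "\<mu>' \<le> i + k" "i \<le> \<mu>" for i
    proof -
      have "t i < t (i + k + 1)" by (rule active_less[OF left that(2)]) (use that less in linarith)
      thus ?thesis by (simp add: e_def del: of_nat_Suc)
    qed
    have "pderiv D = piece_sum t \<mu>' k (e c') - piece_sum t \<mu> k (e c)"
      by (simp add: D_def pderiv_diff pderiv_piece_sum k e_def[abs_def])
    hence dvd: "[:-\<tau>, 1:] ^ (\<mu> + k + 1 - \<mu>') dvd pderiv D
        \<longleftrightarrow> (\<forall>i. \<mu>' \<le> i + k \<and> i \<le> \<mu> \<longrightarrow> e c i = e c' i)"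
      using Suc.IH[of "e c'" "e c"] k by simp
    \<comment> \<open>Left pieces outside the overlap vanish at \<open>\<tau>\<close>, because they
      agree there with right pieces, which are the zero polynomial. Hence only the overlap enters
      \<open>poly D \<tau>\<close>.\<close>
    have zero: "poly (piece t \<mu> (Suc k) i) \<tau> = 0" if "i + Suc k < \<mu>'" for i
      using poly_piece_eq[of "Suc k" i] k that by (simp add: piece_eq_0)
    have val: "poly D \<tau> = (\<Sum>i\<le>\<mu>. (c' i - c i) * poly (piece t \<mu> (Suc k) i) \<tau>)"
    proof -
      have "(\<Sum>i\<le>\<mu>'. c' i * poly (piece t \<mu>' (Suc k) i) \<tau>) = (\<Sum>i\<le>\<mu>'. c' i * poly (piece t \<mu> (Suc k) i) \<tau>)"
        using poly_piece_eq[of "Suc k"] k by simp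
      also have "\<dots> = (\<Sum>i\<le>\<mu>. c' i * poly (piece t \<mu> (Suc k) i) \<tau>)"
        by (rule sum.mono_neutral_right) (use less in \<open>auto simp: piece_eq_0\<close>)
      finally show ?thesis
        by (simp add: D_def poly_piece_sum sum_subtractf[symmetric] algebra_simps)
    qed
    have sum1: "(\<Sum>i\<le>\<mu>. poly (piece t \<mu> (Suc k) i) \<tau>) = 1"
      using piece_sum_one[OF left, of "Suc k"] poly_piece_sum[of t \<mu> "Suc k" "\<lambda>_. 1" \<tau>] k by simp
    have "\<mu> + Suc k + 1 - \<mu>' = Suc (\<mu> + k + 1 - \<mu>')" using k by simp
    hence "[:-\<tau>, 1:] ^ (\<mu> + Suc k + 1 - \<mu>') dvd D \<longleftrightarrow>
        poly D \<tau> = 0 \<and> (\<forall>i. \<mu>' \<le> i + k \<and> i \<le> \<mu> \<longrightarrow> e c i = e c' i)"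
      by (simp only: power_dvd_iff_pderiv dvd)
    also have "\<dots> \<longleftrightarrow> (\<forall>i. \<mu>' \<le> i + Suc k \<and> i \<le> \<mu> \<longrightarrow> c i = c' i)"
    proof
      assume *: "\<forall>i. \<mu>' \<le> i + Suc k \<and> i \<le> \<mu> \<longrightarrow> c i = c' i"
      have "poly D \<tau> = 0" unfolding val
      proof (rule sum.neutral, rule ballI)
        fix i assume "i \<in> {..\<mu>}"
        thus "(c' i - c i) * poly (piece t \<mu> (Suc k) i) \<tau> = 0"
          using * zero[of i] by (cases "\<mu>' \<le> i + Suc k") auto
      qed
      moreover have "e c i = e c' i" if "\<mu>' \<le> i + k" "i \<le> \<mu>" for i
      proof -
        have "\<mu>' \<le> i - 1 + Suc k \<and> i - 1 \<le> \<mu>" using that by linarith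
        hence "c (i - 1) = c' (i - 1)" using * by blast
        moreover have "\<mu>' \<le> i + Suc k \<and> i \<le> \<mu>" using that by linarith
        hence "c i = c' i" using * by blast
        ultimately show ?thesis by (simp add: e_def)
      qed
      ultimately show "poly D \<tau> = 0 \<and> (\<forall>i. \<mu>' \<le> i + k \<and> i \<le> \<mu> \<longrightarrow> e c i = e c' i)" by blast
    next
      assume *: "poly D \<tau> = 0 \<and> (\<forall>i. \<mu>' \<le> i + k \<and> i \<le> \<mu> \<longrightarrow> e c i = e c' i)"
      have const: "c' i - c i = c' \<mu> - c \<mu>" if "\<mu>' \<le> i + Suc k" "i \<le> \<mu>" for i
      proof (rule steps_zero_const[of "\<mu>' - Suc k" \<mu> "\<lambda>i. c' i - c i"])
        fix j assume "\<mu>' - Suc k < j" "j \<le> \<mu>"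
        hence "\<mu>' \<le> j + k" "j \<le> \<mu>" by linarith+
        hence "c j - c (j - 1) = c' j - c' (j - 1)" using * e_eq[of j] by blast
        thus "c' j - c j = c' (j - 1) - c (j - 1)" by linarith
      qed (use that in auto)
      have "poly D \<tau> = (\<Sum>i\<le>\<mu>. (c' \<mu> - c \<mu>) * poly (piece t \<mu> (Suc k) i) \<tau>)"
        unfolding val
      proof (rule sum.cong)
        fix i assume "i \<in> {..\<mu>}"
        thus "(c' i - c i) * poly (piece t \<mu> (Suc k) i) \<tau> = (c' \<mu> - c \<mu>) * poly (piece t \<mu> (Suc k) i) \<tau>"
          using const[of i] zero[of i] by (cases "\<mu>' \<le> i + Suc k") auto
      qed simp
      also have "\<dots> = c' \<mu> - c \<mu>" by (simp only: sum_distrib_left[symmetric] sum1 mult_1_right)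
      finally have "c' \<mu> - c \<mu> = 0" using * by simp
      thus "\<forall>i. \<mu>' \<le> i + Suc k \<and> i \<le> \<mu> \<longrightarrow> c i = c' i" using const by (metis eq_iff_diff_eq_0)
    qed
    finally show ?thesis unfolding D_def .
  qed
qed

end

section \<open>Boehm's knot insertion, read backwards as deletion\<close>

definition delete_knot :: "nat \<Rightarrow> (nat \<Rightarrow> real) \<Rightarrow> nat \<Rightarrow> real" where
  "delete_knot q t i = (if i < q then t i else t (i + 1))"

text \<open>Boehm's weights, with \<open>q\<close> the position of the extra knot in the finer
  sequence. The extreme cases are decided by position and not by the quotient, so that they stay
  right for coinciding knots.\<close>

definition insertion_weight :: "nat \<Rightarrow> (nat \<Rightarrow> real) \<Rightarrow> nat \<Rightarrow> nat \<Rightarrow> real" where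
  "insertion_weight k t q i =
     (if i + k < q then 1 else if q \<le> i then 0 else (t q - t i) / (t (i + k + 1) - t i))"

text \<open>Turns control points over the coarser knots into those of the same spline over the finer
  ones.\<close>

definition insertion :: "nat \<Rightarrow> (nat \<Rightarrow> real) \<Rightarrow> nat \<Rightarrow> (nat \<Rightarrow> real) \<Rightarrow> nat \<Rightarrow> real" where
  "insertion k t q d i =
     insertion_weight k t q i * d i + (1 - insertion_weight k t q i) * d (i - 1)"

context knot_seq
begin

text \<open>Deleting \<open>t q\<close> renumbers the interval \<open>\<mu>\<close> as
  \<open>\<mu>'\<close>. The three cases go through one induction because the recursion leads from
  each to its neighbours. The last one is the insertion formula, written with \<open>npiece\<close>
  so that no further denominator appears.\<close>

lemma piece_delete_knot_cases:
  fixes q :: nat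
  assumes "t \<mu> < t (\<mu> + 1)" "0 < q"
  defines "t' \<equiv> delete_knot q t" and "\<mu>' \<equiv> (if \<mu> < q then \<mu> else \<mu> - 1)"
  shows "i + k + 1 < q \<Longrightarrow> piece t' \<mu>' k i = piece t \<mu> k i"
    and "q \<le> i \<Longrightarrow> piece t' \<mu>' k i = piece t \<mu> k (i + 1)"
    and "i < q \<Longrightarrow> q \<le> i + k + 1 \<Longrightarrow> poly (piece t' \<mu>' k i) x
      = (t q - t i) * poly (npiece t \<mu> k i) x + (t (i + k + 2) - t q) * poly (npiece t \<mu> k (i + 1)) x"
proof (induction k arbitrary: i)
  case 0
  { case 1 thus ?case using assms by auto next
    case 2 thus ?case using assms by auto next
    case 3
    hence q: "q = Suc i" by simp
    show ?case using assms q by (auto simp: poly_npiece) }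
next
  case (Suc k)
  have t': "j < q \<Longrightarrow> t' j = t j" "q \<le> j \<Longrightarrow> t' j = t (j + 1)" for j
    by (simp_all add: t'_def delete_knot_def)
  have lo: "npiece t' \<mu>' k i = npiece t \<mu> k i" if "i + k + 1 < q" for i
    using Suc(1)[OF that] that by (simp add: npiece_def t')
  have hi: "npiece t' \<mu>' k i = npiece t \<mu> k (i + 1)" if "q \<le> i" for i
    using Suc(2)[OF that] that by (simp add: npiece_def t')
  \<comment> \<open>Extends the third formula to the border cases \<open>i = q\<close> and
    \<open>q = i + k + 2\<close>, where one of the two factors is 0, so that both terms of the
    recursion can be rewritten uniformly.\<close>
  have mid: "poly (npiece t' \<mu>' k i) x = ((t q - t i) * poly (npiece t \<mu> k i) x
      + (t (i + k + 2) - t q) * poly (npiece t \<mu> k (i + 1)) x) / (t (i + k + 2) - t i)"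
    if iq: "i \<le> q" "q \<le> i + k + 2" for i
  proof -
    consider "i = q" | "q = i + k + 2" | "i < q" "q \<le> i + k + 1"
      using iq by linarith
    thus ?thesis
    proof cases
      case 1
      thus ?thesis using hi[of i] npiece_degenerate[of t "i + 1" k \<mu>] le[of i "i + 1"] le[of "i + 1" "i + k + 2"]
        by (auto simp: numeral_2_eq_2)
    next
      case 2
      thus ?thesis using lo[of i] npiece_degenerate[of t i k \<mu>] le[of i "i + k + 1"] le[of "i + k + 1" "i + k + 2"]
        by (auto simp: numeral_2_eq_2)
    next
      case 3
      thus ?thesis using Suc(3)[OF 3]
        by (simp add: poly_npiece[of t'] t')
    qed
  qed
  { case 1
    thus ?case using lo[of i] lo[of "i + 1"] by (simp add: piece_Suc t')
  next
    case 2
    thus ?case using hi[of i] hi[of "i + 1"] by (simp add: piece_Suc t')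
  next
    case 3
    define u where "u j = poly (npiece t \<mu> k j) x" for j
    let ?T = "t (i + k + 2)" and ?U = "t (i + k + 3)" and ?w = "t (i + 1)" and ?z = "t q"
    have k3: "t (i + 1 + k + 2) = ?U" "t (i + Suc k + 2) = ?U" "t (i + k + 2 + 1) = ?U"
      "t (i + 1 + k + 1) = ?T" "t (i + Suc k + 1) = ?T" by (simp_all add: eval_nat_numeral)
    have ends: "t' i = t i" "t' (i + k + 2) = ?U"
      using 3 by (auto simp: t' eval_nat_numeral)
    have deg: "?T = t i \<Longrightarrow> u (i + 1) = 0" "?U = ?w \<Longrightarrow> u (i + 1) = 0"
      using npiece_degenerate[of t "i + 1" k \<mu>] le[of i "i + 1"] le[of "i + 1" "i + k + 2"]
        le[of "i + k + 2" "i + k + 3"] by (auto simp: u_def)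
    \<comment> \<open>Exchanging \<open>x\<close> with the deleted knot changes each half of the
      recursion by a multiple of the middle term \<open>u (i + 1)\<close>: by
      \<open>(x - z) * r\<close> here and by \<open>(z - x) * p\<close> in \<open>ne'\<close>. The
      two changes cancel, and \<open>deg\<close> covers zero denominators.\<close>
    have ne: "(x - a) * (((z - a) * p + (b - z) * r) / (b - a)) - (z - a) * (((x - a) * p + (b - x) * r) / (b - a))
        = (x - z) * r" if "b \<noteq> a" for a b z p r :: real
      using that by (simp add: divide_simps) (simp add: algebra_simps)
    have ne': "(b - x) * (((z - a) * p + (b - z) * r) / (b - a)) - (b - z) * (((x - a) * p + (b - x) * r) / (b - a))
        = (z - x) * p" if "b \<noteq> a" for a b z p r :: real
      using that by (simp add: divide_simps) (simp add: algebra_simps)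
    have "poly (piece t' \<mu>' (Suc k) i) x
      = (x - t i) * (((?z - t i) * u i + (?T - ?z) * u (i + 1)) / (?T - t i))
        + (?U - x) * (((?z - ?w) * u (i + 1) + (?U - ?z) * u (i + 2)) / (?U - ?w))"
      unfolding poly_piece_Suc ends using mid[of i] mid[of "i + 1"] 3
      by (simp add: u_def eval_nat_numeral)
    also have "\<dots> = (?z - t i) * (((x - t i) * u i + (?T - x) * u (i + 1)) / (?T - t i))
        + (?U - ?z) * (((x - ?w) * u (i + 1) + (?U - x) * u (i + 2)) / (?U - ?w))"
      using ne[of ?T "t i" ?z "u i" "u (i + 1)"] ne'[of ?U ?w ?z "u (i + 1)" "u (i + 2)"] deg
      by (cases "?T = t i \<or> ?U = ?w") (auto simp: algebra_simps)
    also have "\<dots> = (t q - t i) * poly (npiece t \<mu> (Suc k) i) x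
        + (t (i + Suc k + 2) - t q) * poly (npiece t \<mu> (Suc k) (i + 1)) x"
      by (simp add: poly_npiece[of t \<mu> "Suc k"] poly_piece_Suc u_def eval_nat_numeral)
    finally show ?case .
  }
qed

lemma piece_delete_knot:
  assumes "t \<mu> < t (\<mu> + 1)" "0 < q"
  shows "poly (piece (delete_knot q t) (if \<mu> < q then \<mu> else \<mu> - 1) k i) x
    = insertion_weight k t q i * poly (piece t \<mu> k i) x
      + (1 - insertion_weight k t q (i + 1)) * poly (piece t \<mu> k (i + 1)) x"
proof -
  consider "i + k + 1 < q" | "q \<le> i" | "i < q" "q \<le> i + k + 1" by linarith
  thus ?thesis
  proof cases
    case 3
    have "(t q - t i) * poly (npiece t \<mu> k i) x = insertion_weight k t q i * poly (piece t \<mu> k i) x"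
      using 3 by (auto simp: piece_eq_npiece[OF assms(1)] insertion_weight_def npiece_degenerate
          order.antisym not_less intro: arg_cong[of _ _ t])
    moreover have "(t (i + k + 2) - t q) * poly (npiece t \<mu> k (i + 1)) x
        = (1 - insertion_weight k t q (i + 1)) * poly (piece t \<mu> k (i + 1)) x"
    proof (cases "q = i + 1 \<or> t (i + k + 2) = t (i + 1)")
      case True
      thus ?thesis using 3 npiece_degenerate[of t "i + 1" k \<mu>]
        by (auto simp: piece_eq_npiece[OF assms(1)] insertion_weight_def)
    next
      case False
      thus ?thesis using 3 by (auto simp: piece_eq_npiece[OF assms(1)] insertion_weight_def divide_simps)
    qed
    ultimately show ?thesis using piece_delete_knot_cases(3)[OF assms 3, of x] by simp
  qed (simp_all add: piece_delete_knot_cases[OF assms] insertion_weight_def)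
qed

text \<open>Collecting the coefficients of each fine B-spline transposes the relation between the
  B-splines into the rule for control points.\<close>

lemma piece_sum_delete_knot:
  assumes "t \<mu> < t (\<mu> + 1)" "0 < q" "k < \<mu>"
  shows "piece_sum (delete_knot q t) (if \<mu> < q then \<mu> else \<mu> - 1) k d
    = piece_sum t \<mu> k (insertion k t q d)"
proof -
  let ?\<mu>' = "if \<mu> < q then \<mu> else \<mu> - 1"
  let ?a = "insertion_weight k t q"
  have "poly (piece_sum (delete_knot q t) ?\<mu>' k d) x = poly (piece_sum t \<mu> k (insertion k t q d)) x" for x
  proof -
    let ?p = "\<lambda>i. poly (piece t \<mu> k i) x"
    have "poly (piece_sum (delete_knot q t) ?\<mu>' k d) x
      = (\<Sum>i\<le>\<mu>. d i * poly (piece (delete_knot q t) ?\<mu>' k i) x)"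
      unfolding poly_piece_sum by (rule sum.mono_neutral_left) (auto simp: piece_eq_0)
    also have "\<dots> = (\<Sum>i\<le>\<mu>. d i * ?a i * ?p i)
        + (\<Sum>i\<le>\<mu>. d (i + 1 - 1) * (1 - ?a (i + 1)) * ?p (i + 1))"
      by (simp add: piece_delete_knot[OF assms(1,2)] sum.distrib[symmetric] algebra_simps)
    also have "(\<Sum>i\<le>\<mu>. d (i + 1 - 1) * (1 - ?a (i + 1)) * ?p (i + 1))
        = (\<Sum>i\<le>\<mu>. d (i - 1) * (1 - ?a i) * ?p i)"
      by (rule sum_shift[of "\<lambda>i. d (i - 1) * (1 - ?a i) * ?p i"]) (use assms(3) in \<open>auto simp: piece_eq_0\<close>)
    finally show ?thesis
      by (simp add: poly_piece_sum insertion_def sum.distrib[symmetric] algebra_simps)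
  qed
  thus ?thesis by (simp add: poly_eq_poly_eq_iff[symmetric] fun_eq_iff)
qed

end

section \<open>Derivatives of piecewise polynomials\<close>

lemma deriv_poly_on_open:
  assumes "open S" "\<And>y. y \<in> S \<Longrightarrow> f y = poly P y" "y \<in> S"
  shows "(deriv ^^ r) f y = poly ((pderiv ^^ r) P) y"
  using assms(3)
proof (induction r arbitrary: y)
  case (Suc r)
  have "((deriv ^^ r) f has_field_derivative poly (pderiv ((pderiv ^^ r) P)) y) (at y)"
    by (rule has_field_derivative_transform_within_open[OF poly_DERIV assms(1) Suc.prems])
       (simp add: Suc.IH)
  thus ?case by (simp add: DERIV_imp_deriv)
qed (simp add: assms(2))

lemma higher_pderiv_diff: "(pderiv ^^ r) (P - Q) = (pderiv ^^ r) P - (pderiv ^^ r) (Q :: real poly)"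
  by (induction r) (simp_all add: pderiv_diff)

text \<open>The one-sided limits of all derivatives at \<open>x\<close> are values of derivatives of
  \<open>P\<close> and \<open>Q\<close>; so smoothness of order \<open>k\<close> says that
  \<open>Q - P\<close> vanishes at \<open>x\<close> to order \<open>k + 1\<close>. The value at
  \<open>x\<close> itself belongs to the right piece.\<close>

lemma cont_derivs_at_piecewise_poly:
  assumes ab: "a < x" "x < b"
    and P: "\<And>y. a < y \<Longrightarrow> y < x \<Longrightarrow> f y = poly P y"
    and Q: "\<And>y. x \<le> y \<Longrightarrow> y < b \<Longrightarrow> f y = poly Q y"
  shows "cont_derivs_at k f x \<longleftrightarrow> [:-x, 1:] ^ Suc k dvd Q - P"
proof -
  let ?f = "\<lambda>r. (deriv ^^ r) f"
  let ?P = "\<lambda>r. poly ((pderiv ^^ r) P)" and ?Q = "\<lambda>r. poly ((pderiv ^^ r) Q)"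
  have left: "?f r y = ?P r y" if "a < y" "y < x" for r y
    by (rule deriv_poly_on_open[of "{a<..<x}"]) (use P that in auto)
  have right: "?f r y = ?Q r y" if "x < y" "y < b" for r y
    by (rule deriv_poly_on_open[of "{x<..<b}"]) (use Q that in auto)
  have ev_left: "\<forall>\<^sub>F y in at_left x. a < y \<and> y < x"
    using ab(1) by (auto simp: eventually_at_left)
  have ev_right: "\<forall>\<^sub>F y in at_right x. x < y \<and> y < b"
    using ab(2) by (auto simp: eventually_at_right)
  have lim_left: "(?f r \<longlongrightarrow> ?P r x) (at_left x)" for r
  proof (rule Lim_transform_eventually)
    show "(?P r \<longlongrightarrow> ?P r x) (at_left x)"
      using poly_isCont[of x "(pderiv ^^ r) P"] unfolding isCont_def filterlim_at_split by blast
    show "\<forall>\<^sub>F y in at_left x. ?P r y = ?f r y" using ev_left by eventually_elim (simp add: left)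
  qed
  have lim_right: "(?f r \<longlongrightarrow> ?Q r x) (at_right x)" for r
  proof (rule Lim_transform_eventually)
    show "(?Q r \<longlongrightarrow> ?Q r x) (at_right x)"
      using poly_isCont[of x "(pderiv ^^ r) Q"] unfolding isCont_def filterlim_at_split by blast
    show "\<forall>\<^sub>F y in at_right x. ?Q r y = ?f r y" using ev_right by eventually_elim (simp add: right)
  qed
  have "cont_derivs_at k f x \<longleftrightarrow> (\<forall>r<Suc k. ?Q r x - ?P r x = 0)"
  proof
    assume c: "cont_derivs_at k f x"
    show "\<forall>r<Suc k. ?Q r x - ?P r x = 0"
    proof (intro allI impI)
      fix r assume "r < Suc k"
      hence "(?f r \<longlongrightarrow> ?f r x) (at x)" using c unfolding cont_derivs_at_def isCont_def by simp
      hence "(?f r \<longlongrightarrow> ?f r x) (at_left x)" "(?f r \<longlongrightarrow> ?f r x) (at_right x)"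
        unfolding filterlim_at_split by blast+
      hence "?P r x = ?f r x" "?Q r x = ?f r x"
        using tendsto_unique[OF _ lim_left] tendsto_unique[OF _ lim_right]
        by (metis trivial_limit_at_left_real trivial_limit_at_right_real)+
      thus "?Q r x - ?P r x = 0" by simp
    qed
  next
    assume *: "\<forall>r<Suc k. ?Q r x - ?P r x = 0"
    hence PQ: "?P r x = ?Q r x" if "r \<le> k" for r using that by (metis eq_iff_diff_eq_0 le_imp_less_Suc)
    \<comment> \<open>\<open>deriv\<close> carries no information where a function is not
      differentiable, so the derivative at \<open>x\<close> has to be obtained from the two
      one-sided difference quotients. These involve \<open>?f r x\<close>, which \<open>val\<close>
      supplies by induction on the order.\<close>
    have der: "(?f r has_field_derivative ?Q (Suc r) x) (at x)" if r: "r < k" and val: "?f r x = ?Q r x" for r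
    proof -
      have dP: "((\<lambda>y. (?P r y - ?P r x) / (y - x)) \<longlongrightarrow> ?P (Suc r) x) (at_left x)"
        using poly_DERIV[of "(pderiv ^^ r) P" x] unfolding has_field_derivative_iff filterlim_at_split by simp
      have dQ: "((\<lambda>y. (?Q r y - ?Q r x) / (y - x)) \<longlongrightarrow> ?Q (Suc r) x) (at_right x)"
        using poly_DERIV[of "(pderiv ^^ r) Q" x] unfolding has_field_derivative_iff filterlim_at_split by simp
      have eqs: "?P (Suc r) x = ?Q (Suc r) x" "?P r x = ?Q r x" using PQ[of "Suc r"] PQ[of r] r by simp_all
      show ?thesis unfolding has_field_derivative_iff filterlim_at_split
      proof
        show "((\<lambda>y. (?f r y - ?f r x) / (y - x)) \<longlongrightarrow> ?Q (Suc r) x) (at_left x)"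
        proof (rule Lim_transform_eventually[OF dP[unfolded eqs(1)]])
          show "\<forall>\<^sub>F y in at_left x. (?P r y - ?P r x) / (y - x) = (?f r y - ?f r x) / (y - x)"
            using ev_left by eventually_elim (simp add: left val eqs(2))
        qed
        show "((\<lambda>y. (?f r y - ?f r x) / (y - x)) \<longlongrightarrow> ?Q (Suc r) x) (at_right x)"
        proof (rule Lim_transform_eventually[OF dQ])
          show "\<forall>\<^sub>F y in at_right x. (?Q r y - ?Q r x) / (y - x) = (?f r y - ?f r x) / (y - x)"
            using ev_right by eventually_elim (simp add: right val)
        qed
      qed
    qed
    have val: "?f r x = ?Q r x" if "r \<le> k" for r
      using that
    proof (induction r)
      case 0
      show ?case using Q[of x] ab by simp
    next
      case (Suc r)
      hence "(?f r has_field_derivative ?Q (Suc r) x) (at x)" by (intro der) simp_all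
      thus ?case by (simp add: DERIV_imp_deriv)
    qed
    show "cont_derivs_at k f x" unfolding cont_derivs_at_def
    proof (intro conjI allI impI)
      fix r assume r: "r < k"
      have "?f r field_differentiable (at y)" if y: "y \<in> {a<..<b}" for y
      proof -
        consider "y < x" | "y = x" | "x < y" by linarith
        thus ?thesis
        proof cases
          case 1
          have "(?f r has_field_derivative poly (pderiv ((pderiv ^^ r) P)) y) (at y)"
            by (rule has_field_derivative_transform_within_open[OF poly_DERIV, of "{a<..<x}"])
               (use 1 y left in auto)
          thus ?thesis unfolding field_differentiable_def by blast
        next
          case 2
          have "r \<le> k" using r by simp
          thus ?thesis using der[OF r val] 2 unfolding field_differentiable_def by blast
        next
          case 3
          have "(?f r has_field_derivative poly (pderiv ((pderiv ^^ r) Q)) y) (at y)"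
            by (rule has_field_derivative_transform_within_open[OF poly_DERIV, of "{x<..<b}"])
               (use 3 y right in auto)
          thus ?thesis unfolding field_differentiable_def by blast
        qed
      qed
      moreover have "\<forall>\<^sub>F y in nhds x. y \<in> {a<..<b}"
        by (rule eventually_nhds_in_open) (use ab in auto)
      ultimately show "\<forall>\<^sub>F y in nhds x. ?f r field_differentiable (at y)"
        by (rule eventually_mono[rotated])
    next
      fix r assume r: "r \<le> k"
      show "isCont (?f r) x" unfolding isCont_def filterlim_at_split
        using lim_left[of r] lim_right[of r] by (simp add: val[OF r] PQ[OF r])
    qed
  qed
  also have "\<dots> \<longleftrightarrow> [:-x, 1:] ^ Suc k dvd Q - P"
    unfolding power_dvd_iff_higher_pderiv by (simp add: higher_pderiv_diff)
  finally show ?thesis .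
qed

section \<open>Least squares\<close>

lemma scalar_prod_self:
  fixes v :: "real vec"
  shows "v \<bullet> v = (\<Sum>i<dim_vec v. (v $ i)\<^sup>2)"
  by (simp add: scalar_prod_def power2_eq_square lessThan_atLeast0)

lemma scalar_prod_self_nonneg: "0 \<le> v \<bullet> (v :: real vec)"
  by (simp add: scalar_prod_self sum_nonneg)

lemma scalar_prod_self_eq_0:
  fixes v :: "real vec"
  assumes "v \<bullet> v \<le> 0" "v \<in> carrier_vec n"
  shows "v = 0\<^sub>v n"
proof -
  have "(\<Sum>i<dim_vec v. (v $ i)\<^sup>2) = 0" using assms(1) scalar_prod_self_nonneg[of v]
    by (simp add: scalar_prod_self)
  hence "v $ i = 0" if "i < dim_vec v" for i using that by (simp add: sum_nonneg_eq_0_iff)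
  thus ?thesis using assms(2) by (intro eq_vecI) auto
qed

text \<open>The normal equations: injectivity makes the Gram matrix nonsingular, and orthogonality
  of the residual gives the Pythagorean identity \<open>pyth\<close>. That identity yields
  minimality as well as the uniqueness demanded by \<open>THE\<close>.\<close>

lemma least_squares:
  fixes M :: "real mat"
  assumes M: "M \<in> carrier_mat nr nc" and v: "v \<in> carrier_vec nr"
    and inj: "\<And>x. x \<in> carrier_vec nc \<Longrightarrow> M *\<^sub>v x = 0\<^sub>v nr \<Longrightarrow> x = 0\<^sub>v nc"
  shows "lsq_solution M v \<in> carrier_vec nc"
    and "y \<in> carrier_vec nc \<Longrightarrow> (M *\<^sub>v lsq_solution M v - v) \<bullet> (M *\<^sub>v lsq_solution M v - v)
      \<le> (M *\<^sub>v y - v) \<bullet> (M *\<^sub>v y - v)"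
proof -
  define T where "T = transpose_mat M"
  have T: "T \<in> carrier_mat nc nr" using M by (simp add: T_def)
  define G where "G = T * M"
  have G: "G \<in> carrier_mat nc nc" using T M by (simp add: G_def)
  have adj: "(T *\<^sub>v y) \<bullet> x = y \<bullet> (M *\<^sub>v x)" if "x \<in> carrier_vec nc" "y \<in> carrier_vec nr" for x y
    unfolding T_def by (rule transpose_vec_mult_scalar[OF M that])
  have "det G \<noteq> 0"
  proof
    assume "det G = 0"
    then obtain x where x: "x \<in> carrier_vec nc" "x \<noteq> 0\<^sub>v nc" "G *\<^sub>v x = 0\<^sub>v nc"
      using det_0_iff_vec_prod_zero_field[OF G] by blast
    have Mx: "M *\<^sub>v x \<in> carrier_vec nr" using M x by simp
    have "(M *\<^sub>v x) \<bullet> (M *\<^sub>v x) = (T *\<^sub>v (M *\<^sub>v x)) \<bullet> x" using adj[OF x(1) Mx] by simp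
    also have "T *\<^sub>v (M *\<^sub>v x) = G *\<^sub>v x" unfolding G_def using T M x by simp
    finally have "(M *\<^sub>v x) \<bullet> (M *\<^sub>v x) \<le> 0" using x by simp
    hence "M *\<^sub>v x = 0\<^sub>v nr" by (rule scalar_prod_self_eq_0) (rule Mx)
    thus False using inj x by blast
  qed
  from det_non_zero_imp_unit[OF G this, of "()"] obtain B
    where B: "B \<in> carrier_mat nc nc" "G * B = 1\<^sub>m nc"
    unfolding Units_def by (auto simp: ring_mat_def)
  define x0 where "x0 = B *\<^sub>v (T *\<^sub>v v)"
  have x0: "x0 \<in> carrier_vec nc" using B T v by (simp add: x0_def)
  have Mx0: "M *\<^sub>v x0 \<in> carrier_vec nr" using M x0 by simp
  have "T *\<^sub>v (M *\<^sub>v x0) = (G * B) *\<^sub>v (T *\<^sub>v v)"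
  proof -
    have "(G * B) *\<^sub>v (T *\<^sub>v v) = G *\<^sub>v x0"
      unfolding x0_def by (rule assoc_mult_mat_vec[OF G B(1)]) (use T v in simp)
    also have "\<dots> = T *\<^sub>v (M *\<^sub>v x0)" unfolding G_def by (rule assoc_mult_mat_vec[OF T M x0])
    finally show ?thesis ..
  qed
  also have "\<dots> = T *\<^sub>v v" using B T v by simp
  finally have normal: "T *\<^sub>v (M *\<^sub>v x0 - v) = 0\<^sub>v nc"
    using T Mx0 v by (simp add: mult_minus_distrib_mat_vec)
  have pyth: "(M *\<^sub>v y - v) \<bullet> (M *\<^sub>v y - v)
      = (M *\<^sub>v x0 - v) \<bullet> (M *\<^sub>v x0 - v) + (M *\<^sub>v (y - x0)) \<bullet> (M *\<^sub>v (y - x0))"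
    if y: "y \<in> carrier_vec nc" for y
  proof -
    define r where "r = M *\<^sub>v x0 - v"
    define w where "w = M *\<^sub>v (y - x0)"
    have r: "r \<in> carrier_vec nr" and w: "w \<in> carrier_vec nr"
      using Mx0 v M y x0 by (auto simp: r_def w_def)
    have "M *\<^sub>v y - v = r + w"
      unfolding r_def w_def using M y x0 v Mx0 by (subst mult_minus_distrib_mat_vec[OF M y x0]) (auto intro!: eq_vecI)
    moreover have "r \<bullet> w = 0"
      unfolding w_def using adj[of "y - x0" r] normal r y x0 by (simp add: r_def[symmetric])
    moreover have "w \<bullet> r = r \<bullet> w" by (rule comm_scalar_prod[OF w r])
    ultimately show ?thesis unfolding r_def[symmetric] w_def[symmetric]
      using r w by (simp add: add_scalar_prod_distrib[of _ nr] scalar_prod_add_distrib[of _ nr])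
  qed
  have min: "(M *\<^sub>v x0 - v) \<bullet> (M *\<^sub>v x0 - v) \<le> (M *\<^sub>v y - v) \<bullet> (M *\<^sub>v y - v)"
    if "y \<in> carrier_vec nc" for y
    using pyth[OF that] scalar_prod_self_nonneg[of "M *\<^sub>v (y - x0)"] by simp
  have dim: "dim_col M = nc" using M by simp
  have "lsq_solution M v = x0"
    unfolding lsq_solution_def dim
  proof (rule the_equality)
    show "x0 \<in> carrier_vec nc \<and> (\<forall>y\<in>carrier_vec nc.
        (M *\<^sub>v x0 - v) \<bullet> (M *\<^sub>v x0 - v) \<le> (M *\<^sub>v y - v) \<bullet> (M *\<^sub>v y - v))"
      using x0 min by blast
  next
    fix x assume x: "x \<in> carrier_vec nc \<and> (\<forall>y\<in>carrier_vec nc.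
        (M *\<^sub>v x - v) \<bullet> (M *\<^sub>v x - v) \<le> (M *\<^sub>v y - v) \<bullet> (M *\<^sub>v y - v))"
    hence "(M *\<^sub>v x - v) \<bullet> (M *\<^sub>v x - v) \<le> (M *\<^sub>v x0 - v) \<bullet> (M *\<^sub>v x0 - v)" using x0 by blast
    hence "(M *\<^sub>v (x - x0)) \<bullet> (M *\<^sub>v (x - x0)) \<le> 0" using pyth[of x] x by simp
    hence "M *\<^sub>v (x - x0) = 0\<^sub>v nr" by (rule scalar_prod_self_eq_0) (use M x x0 in auto)
    hence "x - x0 = 0\<^sub>v nc" using inj[of "x - x0"] x x0 by simp
    hence "x $ i = x0 $ i" if "i < nc" for i
      using that x x0 by (auto dest!: arg_cong[of _ _ "\<lambda>v. v $ i"])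
    thus "x = x0" using x x0 by (intro eq_vecI) auto
  qed
  thus "lsq_solution M v \<in> carrier_vec nc"
    and "y \<in> carrier_vec nc \<Longrightarrow> (M *\<^sub>v lsq_solution M v - v) \<bullet> (M *\<^sub>v lsq_solution M v - v)
      \<le> (M *\<^sub>v y - v) \<bullet> (M *\<^sub>v y - v)"
    using x0 min by simp_all
qed

section \<open>Spline spaces of knot vectors\<close>

text \<open>Repeating the last knot forever gives a monotone sequence on all of \<open>nat\<close>, so that B-splines
  of degree \<open>p + 1\<close>, which occur in the antiderivatives, make sense up to the right end.\<close>

definition knot_ext :: "real list \<Rightarrow> nat \<Rightarrow> real" where
  "knot_ext \<Xi> i = knot \<Xi> (min i (length \<Xi>))"

lemma sorted_nth_le_iff:
  fixes xs :: "'a::linorder list"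
  assumes "sorted xs" "i < length xs"
  shows "xs ! i \<le> y \<longleftrightarrow> i < length (filter (\<lambda>x. x \<le> y) xs)"
  using assms
proof (induction xs arbitrary: i)
  case (Cons x xs)
  show ?case
  proof (cases "x \<le> y")
    case True
    thus ?thesis using Cons by (cases i) auto
  next
    case False
    hence "\<forall>z\<in>set (x # xs). \<not> z \<le> y" using Cons.prems by auto
    moreover from this have "filter (\<lambda>x. x \<le> y) (x # xs) = []" by (simp only: filter_empty_conv)
    ultimately show ?thesis using Cons.prems nth_mem[of i "x # xs"] by auto
  qed
qed simp

text \<open>With nothing strictly between \<open>y\<close> and \<open>z\<close>, passing to
  \<open>z\<close> adds exactly its occurrences. For consecutive breakpoints this turns sums of
  multiplicities into positions.\<close>

lemma length_filter_le_step:
  fixes y z :: "'a::linorder"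
  assumes "y < z" "\<And>x. x \<in> set xs \<Longrightarrow> y < x \<Longrightarrow> z \<le> x"
  shows "length (filter (\<lambda>x. x \<le> z) xs) = length (filter (\<lambda>x. x \<le> y) xs) + count_list xs z"
  using assms(2)
proof (induction xs)
  case (Cons x xs)
  have IH: "length (filter (\<lambda>x. x \<le> z) xs) = length (filter (\<lambda>x. x \<le> y) xs) + count_list xs z"
    using Cons by simp
  have "x \<le> y \<or> z < x \<or> x = z" using Cons.prems[of x] by force
  thus ?case using assms(1) IH by auto
qed simp

text \<open>The basic knot vectors described without breakpoints and multiplicities, a form which is
  easily seen to be preserved by the removal of an interior knot.\<close>

locale basic_knots =
  fixes p :: nat and \<Xi> :: "real list"
  assumes sorted_knots: "sorted \<Xi>"
    and length_ge: "2 * (p + 1) \<le> length \<Xi>"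
    and support: "\<And>i. 1 \<le> i \<Longrightarrow> i \<le> dim_spl p \<Xi> \<Longrightarrow> knot \<Xi> i < knot \<Xi> (i + p + 1)"
    and left_end: "knot \<Xi> (p + 1) < knot \<Xi> (p + 2)"
    and right_end: "knot \<Xi> (dim_spl p \<Xi>) < knot \<Xi> (dim_spl p \<Xi> + 1)"
begin

abbreviation "t \<equiv> knot_ext \<Xi>"
abbreviation "n \<equiv> dim_spl p \<Xi>"
abbreviation "a \<equiv> t (p + 1)"
abbreviation "b \<equiv> t (n + 1)"
abbreviation "nb \<equiv> num_bp p \<Xi>"
abbreviation "z \<equiv> bp p \<Xi>"
abbreviation "last_of \<equiv> last_idx p \<Xi>"

lemma length_eq: "length \<Xi> = n + p + 1"
  using length_ge by (simp add: dim_spl_def)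

lemma n_ge: "p + 1 \<le> n"
  using length_ge by (simp add: dim_spl_def)

lemma t_knot: "i \<le> n + p + 1 \<Longrightarrow> t i = knot \<Xi> i"
  by (simp add: knot_ext_def length_eq)

lemma t_mono: "mono t"
proof (rule monoI)
  fix i j :: nat assume "i \<le> j"
  thus "t i \<le> t j" unfolding knot_ext_def knot_def
    by (intro sorted_nth_mono[OF sorted_knots]) (use length_eq in auto)
qed

end

sublocale basic_knots \<subseteq> knot_seq "knot_ext \<Xi>"
  by unfold_locales (rule t_mono)

context basic_knots
begin

lemma t_support: "1 \<le> i \<Longrightarrow> i \<le> n \<Longrightarrow> t i < t (i + p + 1)"
  using support[of i] by (simp add: t_knot)

lemma t_left_end: "t (p + 1) < t (p + 2)"
  using left_end n_ge by (simp add: t_knot)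

lemma t_right_end: "t n < t (n + 1)"
  using right_end by (simp add: t_knot)

lemma set_knots: "set \<Xi> = t ` {1..n + p + 1}"
proof -
  have "set \<Xi> = (\<lambda>i. \<Xi> ! i) ` {..<n + p + 1}"
    unfolding length_eq[symmetric] by (auto simp: set_conv_nth)
  also have "\<dots> = (\<lambda>i. \<Xi> ! (i - 1)) ` (Suc ` {..<n + p + 1})" by (simp add: image_image)
  also have "Suc ` {..<n + p + 1} = {1..n + p + 1}" by (simp add: lessThan_atLeast0 image_Suc_atLeastLessThan atLeastLessThanSuc_atLeastAtMost)
  also have "(\<lambda>i. \<Xi> ! (i - 1)) ` {1..n + p + 1} = t ` {1..n + p + 1}"
    by (rule image_cong) (auto simp: t_knot knot_def)
  finally show ?thesis .
qed

section \<open>Breakpoints and the positions of their last copies\<close>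

definition breakpoints :: "real set" where
  "breakpoints = set \<Xi> \<inter> {a..b}"

lemma finite_breakpoints: "finite breakpoints"
  by (simp add: breakpoints_def)

lemma bp_list_eq: "bp_list p \<Xi> = sorted_list_of_set breakpoints"
  by (simp add: bp_list_def breakpoints_def t_knot)

lemma nb_eq: "nb = card breakpoints"
  by (simp add: num_bp_def bp_list_eq)

lemma a_less_b: "a < b"
  using t_left_end le[of "p + 2" "n + 1"] n_ge by simp

lemma bp_less:
  assumes "1 \<le> i" "i < j" "j \<le> nb"
  shows "z i < z j"
  using sorted_wrt_nth_less[OF strict_sorted_list_of_set[of breakpoints], of "i - 1" "j - 1"] assms
  by (simp add: bp_def bp_list_eq nb_eq)

lemma bp_le: "1 \<le> i \<Longrightarrow> i \<le> j \<Longrightarrow> j \<le> nb \<Longrightarrow> z i \<le> z j"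
  using bp_less[of i j] by (cases "i = j") auto

lemma bp_in: "1 \<le> j \<Longrightarrow> j \<le> nb \<Longrightarrow> z j \<in> breakpoints"
  using nth_mem[of "j - 1" "sorted_list_of_set breakpoints"] finite_breakpoints
  by (simp add: bp_def bp_list_eq nb_eq)

lemma ex_bp: "x \<in> breakpoints \<Longrightarrow> \<exists>j. 1 \<le> j \<and> j \<le> nb \<and> x = z j"
proof -
  assume "x \<in> breakpoints"
  then obtain i where i: "i < nb" "sorted_list_of_set breakpoints ! i = x"
    using finite_breakpoints by (metis in_set_conv_nth length_sorted_list_of_set nb_eq set_sorted_list_of_set)
  thus ?thesis by (intro exI[of _ "i + 1"]) (simp add: bp_def bp_list_eq)
qed

lemma t_breakpoint: "i \<le> n + p + 1 \<Longrightarrow> 1 \<le> i \<Longrightarrow> a \<le> t i \<Longrightarrow> t i \<le> b \<Longrightarrow> t i \<in> breakpoints"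
  by (auto simp: breakpoints_def set_knots)

lemma ab_breakpoints: "a \<in> breakpoints" "b \<in> breakpoints"
  using a_less_b n_ge t_breakpoint[of "p + 1"] t_breakpoint[of "n + 1"] by simp_all

lemma nb_ge: "2 \<le> nb"
proof -
  have "card {a, b} \<le> nb" unfolding nb_eq
    using ab_breakpoints finite_breakpoints by (intro card_mono) auto
  thus ?thesis using a_less_b by simp
qed

lemma bp_bounds: "1 \<le> j \<Longrightarrow> j \<le> nb \<Longrightarrow> a \<le> z j \<and> z j \<le> b"
  using bp_in[of j] by (simp add: breakpoints_def)

lemma bp_first: "z 1 = a"
proof -
  obtain j where "1 \<le> j" "j \<le> nb" "a = z j" using ex_bp[OF ab_breakpoints(1)] by blast
  thus ?thesis using bp_le[of 1 j] bp_bounds[of 1] nb_ge by simp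
qed

lemma bp_last: "z nb = b"
proof -
  obtain j where "1 \<le> j" "j \<le> nb" "b = z j" using ex_bp[OF ab_breakpoints(2)] by blast
  thus ?thesis using bp_le[of j nb] bp_bounds[of nb] nb_ge by simp
qed

lemma no_knot_between:
  assumes j: "1 \<le> j" "j < nb" and x: "x \<in> set \<Xi>" "z j < x"
  shows "z (j + 1) \<le> x"
proof (cases "x \<le> b")
  case True
  hence "x \<in> breakpoints" using x bp_bounds[of j] j by (simp add: breakpoints_def)
  then obtain k where k: "1 \<le> k" "k \<le> nb" "x = z k" using ex_bp by blast
  have "j < k" using bp_le[of k j] k j x by (metis less_imp_le_nat not_le)
  thus ?thesis using bp_le[of "j + 1" k] k j by simp
next
  case False
  thus ?thesis using bp_bounds[of "j + 1"] j by simp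
qed

lemma t_le_iff:
  assumes "1 \<le> i" "i \<le> n + p + 1"
  shows "t i \<le> y \<longleftrightarrow> i \<le> length (filter (\<lambda>x. x \<le> y) \<Xi>)"
  using sorted_nth_le_iff[OF sorted_knots, of "i - 1" y] assms length_eq
  by (auto simp: t_knot knot_def)

text \<open>Exactly \<open>p + 1\<close> knots are at most \<open>a\<close>, by the strict step that
  follows, and each further breakpoint adds its multiplicity. As a count, the position can be
  compared with any index (\<open>le_last_of_iff\<close>).\<close>

lemma last_of_eq: "1 \<le> j \<Longrightarrow> j \<le> nb \<Longrightarrow> j < nb \<Longrightarrow> last_of j = length (filter (\<lambda>x. x \<le> z j) \<Xi>)"
proof (induction j rule: nat_induct_at_least)
  case base
  have "p + 1 \<le> length (filter (\<lambda>x. x \<le> a) \<Xi>)" using t_le_iff[of "p + 1" a] n_ge by simp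
  moreover have "\<not> p + 2 \<le> length (filter (\<lambda>x. x \<le> a) \<Xi>)"
    using t_le_iff[of "p + 2" a] t_left_end n_ge by simp
  ultimately show ?case unfolding last_idx_def bp_first by simp
next
  case (Suc j)
  have "length (filter (\<lambda>x. x \<le> z (Suc j)) \<Xi>) = length (filter (\<lambda>x. x \<le> z j) \<Xi>) + bp_mult p \<Xi> (Suc j)"
    unfolding bp_mult_def using no_knot_between[of j] Suc by (intro length_filter_le_step bp_less) auto
  moreover have "last_of (Suc j) = last_of j + bp_mult p \<Xi> (Suc j)"
    using Suc by (simp add: last_idx_def)
  ultimately show ?case using Suc by simp
qed

lemma le_last_of_iff:
  assumes "1 \<le> j" "j < nb" "1 \<le> i" "i \<le> n + p + 1"
  shows "i \<le> last_of j \<longleftrightarrow> t i \<le> z j"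
  using last_of_eq[of j] t_le_iff[of i "z j"] assms by simp

lemma last_of_bounds:
  assumes "1 \<le> j" "j < nb"
  shows "p + 1 \<le> last_of j" "last_of j \<le> n"
proof -
  show "p + 1 \<le> last_of j" by (simp add: last_idx_def)
  have "z j < b" using bp_less[of j nb] bp_last assms by simp
  thus "last_of j \<le> n" using le_last_of_iff[OF assms, of "n + 1"] by simp
qed

lemma t_last_of:
  assumes "1 \<le> j" "j < nb"
  shows "t (last_of j) = z j" "t (last_of j + 1) = z (j + 1)"
proof -
  note bd = last_of_bounds[OF assms]
  have zs: "z j \<in> set \<Xi>" "z (j + 1) \<in> set \<Xi>" using bp_in[of j] bp_in[of "j + 1"] assms by (auto simp: breakpoints_def)
  obtain i where i: "1 \<le> i" "i \<le> n + p + 1" "z j = t i" using zs(1) unfolding set_knots by auto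
  hence "i \<le> last_of j" using le_last_of_iff[OF assms, of i] by simp
  hence "z j \<le> t (last_of j)" using i le by simp
  moreover have "t (last_of j) \<le> z j" using le_last_of_iff[OF assms, of "last_of j"] bd by simp
  ultimately show "t (last_of j) = z j" by simp
  obtain i where i: "1 \<le> i" "i \<le> n + p + 1" "z (j + 1) = t i" using zs(2) unfolding set_knots by auto
  have "\<not> i \<le> last_of j" using le_last_of_iff[OF assms, of i] i bp_less[of j "j + 1"] assms by simp
  hence "t (last_of j + 1) \<le> z (j + 1)" using i le[of "last_of j + 1" i] by simp
  moreover have "z j < t (last_of j + 1)" using le_last_of_iff[OF assms, of "last_of j + 1"] bd by simp
  hence "z (j + 1) \<le> t (last_of j + 1)"
    using no_knot_between[OF assms] bd set_knots by simp
  ultimately show "t (last_of j + 1) = z (j + 1)" by simp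
qed

lemma last_of_Suc: "1 \<le> j \<Longrightarrow> last_of (j + 1) = last_of j + bp_mult p \<Xi> (j + 1)"
  by (simp add: last_idx_def)

lemma t_interior:
  assumes j: "1 \<le> j" "j + 1 < nb" and i: "last_of j < i" "i \<le> last_of (j + 1)"
  shows "t i = z (j + 1)"
proof -
  have bd: "1 \<le> i" "i \<le> n + p + 1" using i last_of_bounds[of "j + 1"] j by auto
  hence "t i \<le> z (j + 1)" "z j < t i"
    using le_last_of_iff[of "j + 1" i] le_last_of_iff[of j i] i j by simp_all
  thus ?thesis using no_knot_between[of j "t i"] bd j by (simp add: set_knots)
qed

lemma last_of_less:
  assumes "1 \<le> j" "j + 1 < nb"
  shows "last_of j < last_of (j + 1)"
proof -
  have "t (last_of j) < t (last_of (j + 1))"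
    using t_last_of[of j] t_last_of[of "j + 1"] bp_less[of j "j + 1"] assms by simp
  thus ?thesis using le[of "last_of (j + 1)" "last_of j"] by linarith
qed

lemma bp_mult_bounds:
  assumes "1 \<le> j" "j + 1 < nb"
  shows "1 \<le> bp_mult p \<Xi> (j + 1)" "bp_mult p \<Xi> (j + 1) \<le> p + 1"
proof -
  show "1 \<le> bp_mult p \<Xi> (j + 1)" using last_of_less[OF assms] last_of_Suc[of j] assms by simp
  show "bp_mult p \<Xi> (j + 1) \<le> p + 1"
  proof (rule ccontr)
    assume "\<not> ?thesis"
    hence l: "last_of j + p + 2 \<le> last_of (j + 1)" using last_of_Suc[of j] assms by simp
    \<comment> \<open>\<open>p + 2\<close> equal consecutive knots would form an empty
      support.\<close>
    have "t (last_of j + 1) = t (last_of j + 1 + p + 1)"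
      using t_interior[OF assms, of "last_of j + 1"] t_interior[OF assms, of "last_of j + 1 + p + 1"] l by simp
    thus False using t_support[of "last_of j + 1"] l last_of_bounds[of "j + 1"] assms by simp
  qed
qed

lemma last_of_last: "last_of (nb - 1) = n"
proof -
  have j: "1 \<le> nb - 1" "nb - 1 < nb" "nb - 1 + 1 = nb" using nb_ge by auto
  have "\<not> z (nb - 1) < t n"
    using no_knot_between[OF j(1,2), of "t n"] n_ge t_right_end bp_last j by (auto simp: set_knots)
  hence "n \<le> last_of (nb - 1)" using le_last_of_iff[OF j(1,2), of n] n_ge by simp
  thus ?thesis using last_of_bounds[OF j(1,2)] by simp
qed

lemma last_of_eq_n_iff:
  assumes "1 \<le> j" "j < nb"
  shows "last_of j = n \<longleftrightarrow> j = nb - 1"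
proof
  assume *: "last_of j = n"
  show "j = nb - 1"
  proof (rule ccontr)
    assume "j \<noteq> nb - 1"
    hence "j + 1 < nb" using assms by simp
    thus False using last_of_less[of j] last_of_bounds[of "j + 1"] * assms by simp
  qed
qed (use last_of_last in blast)

text \<open>The convention of \<open>cox_de_boor\<close> and \<open>spline_space\<close> at
  breakpoints: only the last interval contains its right end.\<close>

definition in_piece :: "nat \<Rightarrow> real \<Rightarrow> bool" where
  "in_piece \<mu> x \<longleftrightarrow> p + 1 \<le> \<mu> \<and> \<mu> \<le> n \<and> t \<mu> < t (\<mu> + 1) \<and> t \<mu> \<le> x \<and> (x < t (\<mu> + 1) \<or> x = t (\<mu> + 1) \<and> \<mu> = n)"

lemma in_piece_last_of:
  assumes "1 \<le> j" "j < nb"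
  shows "in_piece (last_of j) x \<longleftrightarrow> x \<in> (if j = nb - 1 then {z j..z (j + 1)} else {z j..<z (j + 1)})"
  unfolding in_piece_def last_of_eq_n_iff[OF assms] t_last_of[OF assms]
  using last_of_bounds[OF assms] bp_less[of j "j + 1"] assms by auto

lemma in_piece_imp_last_of:
  assumes "in_piece \<mu> x"
  shows "\<exists>j. 1 \<le> j \<and> j < nb \<and> \<mu> = last_of j"
proof -
  have \<mu>: "p + 1 \<le> \<mu>" "\<mu> \<le> n" "t \<mu> < t (\<mu> + 1)" using assms by (auto simp: in_piece_def)
  have "t \<mu> \<in> breakpoints" using le[of "p + 1" \<mu>] le[of \<mu> "n + 1"] \<mu> by (intro t_breakpoint) auto
  then obtain j where j: "1 \<le> j" "j \<le> nb" "t \<mu> = z j" using ex_bp by blast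
  have "z j < b" using le[of "\<mu> + 1" "n + 1"] \<mu> j by simp
  hence j': "j < nb" using j bp_last by (metis le_neq_implies_less less_irrefl)
  have "\<mu> \<le> last_of j" using le_last_of_iff[OF j(1) j', of \<mu>] j \<mu> by simp
  moreover have "\<not> \<mu> + 1 \<le> last_of j" using le_last_of_iff[OF j(1) j', of "\<mu> + 1"] j \<mu> by simp
  ultimately show ?thesis using j j' by (intro exI[of _ j]) simp
qed

lemma ex_in_piece:
  assumes "a \<le> x" "x \<le> b"
  shows "\<exists>\<mu>. in_piece \<mu> x"
proof (cases "t n \<le> x")
  case True
  thus ?thesis using assms t_right_end n_ge by (intro exI[of _ n]) (auto simp: in_piece_def)
next
  case False
  define \<mu> where "\<mu> = (GREATEST i. t i \<le> x \<and> i \<le> n)"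
  have \<mu>: "t \<mu> \<le> x \<and> \<mu> \<le> n"
    unfolding \<mu>_def by (rule GreatestI_nat[of _ "p + 1" n]) (use assms n_ge in auto)
  have "p + 1 \<le> \<mu>" unfolding \<mu>_def by (rule Greatest_le_nat[of _ _ n]) (use assms n_ge in auto)
  moreover have "\<mu> \<noteq> n" using \<mu> False by auto
  moreover have "\<not> t (\<mu> + 1) \<le> x"
  proof
    assume "t (\<mu> + 1) \<le> x"
    hence "\<mu> + 1 \<le> \<mu>" using \<mu> \<open>\<mu> \<noteq> n\<close> unfolding \<mu>_def[symmetric]
      by (subst (2) \<mu>_def, intro Greatest_le_nat[of _ _ n]) auto
    thus False by simp
  qed
  ultimately show ?thesis using \<mu> by (intro exI[of _ \<mu>]) (auto simp: in_piece_def)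
qed

lemma in_piece_bounds: "in_piece \<mu> x \<Longrightarrow> a \<le> x \<and> x \<le> b"
  using le[of "p + 1" \<mu>] le[of "\<mu> + 1" "n + 1"] by (auto simp: in_piece_def)

text \<open>The bound on \<open>i + k\<close> keeps every knot of the recursion inside the list,
  where \<open>knot\<close> and \<open>t\<close> agree.\<close>

lemma cox_de_boor_piece:
  assumes "in_piece \<mu> x" "i + k \<le> n + p"
  shows "cox_de_boor \<Xi> b k i x = poly (piece t \<mu> k i) x"
  using assms(2)
proof (induction k arbitrary: i)
  case 0
  have \<mu>: "t \<mu> \<le> x" "t \<mu> < t (\<mu> + 1)" "x < t (\<mu> + 1) \<or> x = t (\<mu> + 1) \<and> \<mu> = n" "\<mu> \<le> n"
    using assms(1) by (auto simp: in_piece_def)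
  have xb: "x < b \<longleftrightarrow> x < t (\<mu> + 1)"
    using \<mu> le[of "\<mu> + 1" "n + 1"] by auto
  have k: "knot \<Xi> i = t i" "knot \<Xi> (i + 1) = t (i + 1)" using 0 by (simp_all add: t_knot)
  consider "i < \<mu>" | "i = \<mu>" | "\<mu> < i" by linarith
  thus ?case
  proof cases
    case 1
    hence "t (i + 1) \<le> t \<mu>" by (intro le) simp
    thus ?thesis using 1 \<mu> unfolding cox_de_boor.simps k xb by auto
  next
    case 2
    thus ?thesis using \<mu> unfolding cox_de_boor.simps k xb by auto
  next
    case 3
    hence "t (\<mu> + 1) \<le> t i" by (intro le) simp
    thus ?thesis using 3 \<mu> unfolding cox_de_boor.simps k xb by auto
  qed
next
  case (Suc k)
  thus ?case by (simp add: poly_piece_Suc poly_npiece t_knot)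
qed

section \<open>Splines as sums over coefficient sequences, and linear independence\<close>

definition spl :: "(nat \<Rightarrow> real) \<Rightarrow> real \<Rightarrow> real" where
  "spl c x = (\<Sum>i=1..n. c i * bspline p \<Xi> i x)"

lemma spline_of_eq_spl: "spline_of p \<Xi> c = spl (entry c)"
  by (simp add: spline_of_def spl_def fun_eq_iff)

lemma bspline_piece: "in_piece \<mu> x \<Longrightarrow> i \<le> n \<Longrightarrow> bspline p \<Xi> i x = poly (piece t \<mu> p i) x"
  using cox_de_boor_piece[of \<mu> x i p] in_piece_bounds[of \<mu> x] n_ge by (simp add: bspline_def t_knot)

lemma bspline_outside: "\<not> (a \<le> x \<and> x \<le> b) \<Longrightarrow> bspline p \<Xi> i x = 0"
  using n_ge by (auto simp: bspline_def t_knot)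

lemma spl_outside: "\<not> (a \<le> x \<and> x \<le> b) \<Longrightarrow> spl c x = 0"
  unfolding spl_def by (rule sum.neutral) (use bspline_outside in simp)

lemma spl_piece:
  assumes "in_piece \<mu> x"
  shows "spl c x = poly (piece_sum t \<mu> p c) x"
proof -
  have \<mu>: "p + 1 \<le> \<mu>" "\<mu> \<le> n" using assms by (auto simp: in_piece_def)
  have "spl c x = (\<Sum>i=1..n. c i * poly (piece t \<mu> p i) x)"
    unfolding spl_def by (rule sum.cong) (simp_all add: bspline_piece[OF assms])
  \<comment> \<open>Index 0 contributes nothing because \<open>p < \<mu>\<close>; indices above
    \<open>\<mu>\<close> start to the right of the interval.\<close>
  also have "\<dots> = (\<Sum>i\<le>\<mu>. c i * poly (piece t \<mu> p i) x)"
    using \<mu> by (intro sum.mono_neutral_cong) (auto simp: piece_eq_0 Suc_le_eq)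
  finally show ?thesis by (simp add: poly_piece_sum)
qed

lemma spl_diff: "spl c x - spl d x = spl (\<lambda>i. c i - d i) x"
  by (simp add: spl_def sum_subtractf[symmetric] algebra_simps)

lemma ex_strict_step:
  assumes "t lo < t (hi + 1)" "lo \<le> hi"
  shows "\<exists>\<mu>. lo \<le> \<mu> \<and> \<mu> \<le> hi \<and> t \<mu> < t (\<mu> + 1)"
proof (rule ccontr)
  assume *: "\<not> ?thesis"
  have "j \<le> hi + 1 \<Longrightarrow> t j \<le> t lo" if "lo \<le> j" for j
    using that
  proof (induction j rule: dec_induct)
    case (step j)
    hence "\<not> t j < t (j + 1)" using * by auto
    thus ?case using step by simp
  qed simp
  from this[of "hi + 1"] show False using assms by simp
qed

lemma poly_eq_0_on_interval:
  assumes "x < y" "\<And>w. x < w \<Longrightarrow> w < y \<Longrightarrow> poly P w = (0::real)"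
  shows "P = 0"
proof (rule ccontr)
  assume "P \<noteq> 0"
  hence "finite {w. poly P w = 0}" by (rule poly_roots_finite)
  moreover have "{x<..<y} \<subseteq> {w. poly P w = 0}" using assms(2) by auto
  ultimately show False using infinite_Ioo[OF assms(1)] finite_subset by blast
qed

lemma spl_eq_0_imp:
  assumes "\<And>x. spl c x = 0" "1 \<le> i" "i \<le> n"
  shows "c i = 0"
proof -
  \<comment> \<open>The support of the \<open>i\<close>-th B-spline clipped to the basic interval.
    By \<open>left_end\<close>, \<open>right_end\<close> and \<open>support\<close> it still
    contains a nonempty knot interval, on which the coefficient can be read off.\<close>
  define lo where "lo = max i (p + 1)"
  define hi where "hi = min (i + p) n"
  have lohi: "lo \<le> hi" using assms n_ge by (auto simp: lo_def hi_def)
  have "t lo < t (hi + 1)"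
  proof (cases "i \<le> p + 1")
    case True
    hence "lo = p + 1" by (simp add: lo_def)
    moreover have "t (p + 2) \<le> t (hi + 1)" using assms n_ge by (intro le) (auto simp: hi_def)
    ultimately show ?thesis using t_left_end by simp
  next
    case False
    hence lo: "lo = i" by (simp add: lo_def)
    show ?thesis
    proof (cases "i + p \<le> n")
      case True
      thus ?thesis using lo t_support[OF assms(2,3)] by (simp add: hi_def)
    next
      case False
      thus ?thesis using lo le[OF assms(3)] t_right_end by (simp add: hi_def)
    qed
  qed
  then obtain \<mu> where \<mu>: "lo \<le> \<mu>" "\<mu> \<le> hi" "t \<mu> < t (\<mu> + 1)" using ex_strict_step lohi by blast
  hence bd: "p + 1 \<le> \<mu>" "\<mu> \<le> n" "i \<le> \<mu>" "\<mu> \<le> i + p" by (auto simp: lo_def hi_def)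
  have "piece_sum t \<mu> p c = 0"
  proof (rule poly_eq_0_on_interval[OF \<mu>(3)])
    fix w assume "t \<mu> < w" "w < t (\<mu> + 1)"
    hence "in_piece \<mu> w" using bd \<mu> by (simp add: in_piece_def)
    thus "poly (piece_sum t \<mu> p c) w = 0" using spl_piece[of \<mu> w c] assms(1) by simp
  qed
  thus ?thesis using piece_sum_eq_0_imp[OF \<mu>(3), of p c i] bd by simp
qed

lemma spl_eq_imp: "spl c = spl d \<Longrightarrow> 1 \<le> i \<Longrightarrow> i \<le> n \<Longrightarrow> c i = d i"
  using spl_eq_0_imp[of "\<lambda>i. c i - d i" i] by (simp add: spl_diff[symmetric])

lemma spl_cong: "(\<And>i. 1 \<le> i \<Longrightarrow> i \<le> n \<Longrightarrow> c i = d i) \<Longrightarrow> spl c = spl d"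
  unfolding spl_def by (intro ext sum.cong) auto

text \<open>The form in which both halves of the Curry-Schoenberg theorem use the space: polynomials
  chosen simultaneously for all intervals, smoothness as divisibility. The exponent is
  \<open>p + 1\<close> minus the multiplicity, hence 0 exactly where no continuity is
  required.\<close>

lemma knot_space_iff_pieces:
  "f \<in> knot_space p \<Xi> \<longleftrightarrow> (\<forall>x. \<not> (a \<le> x \<and> x \<le> b) \<longrightarrow> f x = 0) \<and>
    (\<exists>P. (\<forall>j. 1 \<le> j \<and> j < nb \<longrightarrow> degree (P j) \<le> p \<and> (\<forall>x. in_piece (last_of j) x \<longrightarrow> f x = poly (P j) x)) \<and>
         (\<forall>j. 1 \<le> j \<and> j + 1 < nb \<longrightarrow>
            [:- z (j + 1), 1:] ^ (last_of j + p + 1 - last_of (j + 1)) dvd P (j + 1) - P j))"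
  (is "?L \<longleftrightarrow> ?out \<and> (\<exists>P. ?pieces P \<and> ?smooth P)")
proof -
  have smooth: "(bp_mult p \<Xi> (j + 1) \<le> p \<longrightarrow> cont_derivs_at (p - bp_mult p \<Xi> (j + 1)) f (z (j + 1)))
      \<longleftrightarrow> [:- z (j + 1), 1:] ^ (last_of j + p + 1 - last_of (j + 1)) dvd P (j + 1) - P j"
    if P: "?pieces P" and j: "1 \<le> j" "j + 1 < nb" for P j
  proof -
    have e: "last_of j + p + 1 - last_of (j + 1) = p + 1 - bp_mult p \<Xi> (j + 1)"
      using last_of_Suc[of j] j by simp
    show ?thesis
    proof (cases "bp_mult p \<Xi> (j + 1) \<le> p")
      case True
      hence "cont_derivs_at (p - bp_mult p \<Xi> (j + 1)) f (z (j + 1))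
          \<longleftrightarrow> [:- z (j + 1), 1:] ^ Suc (p - bp_mult p \<Xi> (j + 1)) dvd P (j + 1) - P j"
      proof (intro cont_derivs_at_piecewise_poly)
        show "z j < z (j + 1)" "z (j + 1) < z (j + 2)" using bp_less[of j "j + 1"] bp_less[of "j + 1" "j + 2"] j by auto
        fix y
        show "f y = poly (P j) y" if "z j < y" "y < z (j + 1)"
        proof -
          have "in_piece (last_of j) y" using in_piece_last_of[of j y] that j by simp
          thus ?thesis using P j by auto
        qed
        show "f y = poly (P (j + 1)) y" if "z (j + 1) \<le> y" "y < z (j + 2)"
        proof -
          have "in_piece (last_of (j + 1)) y" using in_piece_last_of[of "j + 1" y] that j by auto
          thus ?thesis using P j by auto
        qed
      qed
      moreover have "p + 1 - bp_mult p \<Xi> (j + 1) = Suc (p - bp_mult p \<Xi> (j + 1))" using True by simp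
      ultimately show ?thesis using True unfolding e by argo
    next
      case False
      hence "p + 1 - bp_mult p \<Xi> (j + 1) = 0" by simp
      thus ?thesis using False unfolding e by simp
    qed
  qed
  have idx1: "{1..<nb} = {j. 1 \<le> j \<and> j < nb}" by auto
  have idx2: "(\<forall>j\<in>{2..nb - 1}. Q j) \<longleftrightarrow> (\<forall>j. 1 \<le> j \<and> j + 1 < nb \<longrightarrow> Q (j + 1))" for Q
  proof
    assume *: "\<forall>j. 1 \<le> j \<and> j + 1 < nb \<longrightarrow> Q (j + 1)"
    show "\<forall>j\<in>{2..nb - 1}. Q j"
    proof
      fix j assume "j \<in> {2..nb - 1}"
      hence "1 \<le> j - 1 \<and> j - 1 + 1 < nb" "j - 1 + 1 = j" by auto
      thus "Q j" using * by metis
    qed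
  qed auto
  have pieces: "(\<forall>j\<in>{1..<nb}. \<exists>P :: real poly. degree P \<le> p \<and>
        (\<forall>x \<in> (if j = nb - 1 then {z j..z (j + 1)} else {z j..<z (j + 1)}). f x = poly P x))
      \<longleftrightarrow> (\<exists>P. ?pieces P)"
  proof -
    have "(\<forall>x \<in> (if j = nb - 1 then {z j..z (j + 1)} else {z j..<z (j + 1)}). f x = poly P x)
      \<longleftrightarrow> (\<forall>x. in_piece (last_of j) x \<longrightarrow> f x = poly P x)" if "1 \<le> j \<and> j < nb" for j P
      using in_piece_last_of[of j] that by blast
    hence "(\<forall>j\<in>{1..<nb}. \<exists>P :: real poly. degree P \<le> p \<and>
        (\<forall>x \<in> (if j = nb - 1 then {z j..z (j + 1)} else {z j..<z (j + 1)}). f x = poly P x))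
      \<longleftrightarrow> (\<forall>j. \<exists>P. 1 \<le> j \<and> j < nb \<longrightarrow> degree P \<le> p \<and> (\<forall>x. in_piece (last_of j) x \<longrightarrow> f x = poly P x))"
      unfolding idx1 by auto
    also have "\<dots> \<longleftrightarrow> (\<exists>P. ?pieces P)" by (rule choice_iff)
    finally show ?thesis .
  qed
  have out: "(\<forall>x. x \<notin> {z 1..z nb} \<longrightarrow> f x = 0) \<longleftrightarrow> ?out" unfolding bp_first bp_last by auto
  show ?thesis
    unfolding knot_space_def spline_space_def mem_Collect_eq pieces idx2 out
    using smooth by blast
qed

lemma multiple_knot_last_of:
  assumes "1 \<le> j" "j + 1 < nb"
  shows "multiple_knot t (last_of j) (last_of (j + 1)) (z (j + 1))"
  using last_of_less[OF assms] t_last_of[of j] t_last_of[of "j + 1"] bp_less[of j "j + 1"] bp_less[of "j + 1" "j + 2"]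
    t_interior[OF assms] assms
  by unfold_locales auto

lemma spl_in_knot_space: "spl c \<in> knot_space p \<Xi>"
proof -
  have "[:- z (j + 1), 1:] ^ (last_of j + p + 1 - last_of (j + 1)) dvd
      piece_sum t (last_of (j + 1)) p c - piece_sum t (last_of j) p c" if j: "1 \<le> j" "j + 1 < nb" for j
  proof -
    interpret multiple_knot t "last_of j" "last_of (j + 1)" "z (j + 1)" by (rule multiple_knot_last_of[OF j])
    show ?thesis
      using power_dvd_diff_iff[of p c c] bp_mult_bounds[OF j] last_of_Suc[of j] last_of_bounds[of j] j by auto
  qed
  thus ?thesis unfolding knot_space_iff_pieces
    by (intro conjI exI[of _ "\<lambda>j. piece_sum t (last_of j) p c"])
       (auto simp: spl_outside spl_piece degree_piece_sum)
qed

text \<open>Coefficients are glued from left to right: each interval has its own by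
  \<open>ex_piece_sum\<close>, and smoothness makes old and new ones agree on the overlap. So
  \<open>d\<close> may switch from \<open>c\<close> to \<open>c'\<close> after
  \<open>last_of J\<close> without changing any piece.\<close>

lemma knot_space_imp_spl:
  assumes "f \<in> knot_space p \<Xi>"
  shows "\<exists>c. f = spl c"
proof -
  obtain P where out: "\<And>x. \<not> (a \<le> x \<and> x \<le> b) \<Longrightarrow> f x = 0"
    and deg: "\<And>j. 1 \<le> j \<Longrightarrow> j < nb \<Longrightarrow> degree (P j) \<le> p"
    and P: "\<And>j x. 1 \<le> j \<Longrightarrow> j < nb \<Longrightarrow> in_piece (last_of j) x \<Longrightarrow> f x = poly (P j) x"
    and smooth: "\<And>j. 1 \<le> j \<Longrightarrow> j + 1 < nb \<Longrightarrow>
        [:- z (j + 1), 1:] ^ (last_of j + p + 1 - last_of (j + 1)) dvd P (j + 1) - P j"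
    using assms unfolding knot_space_iff_pieces by blast
  have step: "t (last_of j) < t (last_of j + 1)" "p \<le> last_of j" if "1 \<le> j" "j < nb" for j
    using t_last_of[OF that] bp_less[of j "j + 1"] last_of_bounds[OF that] that by simp_all
  have "\<exists>c. \<forall>j. 1 \<le> j \<and> j \<le> J \<longrightarrow> P j = piece_sum t (last_of j) p c" if "1 \<le> J" "J < nb" for J
    using that
  proof (induction J rule: nat_induct_at_least)
    case base
    then obtain c where "P 1 = piece_sum t (last_of 1) p c"
      using ex_piece_sum[OF step deg, of 1] by auto
    thus ?case by (metis le_antisym)
  next
    case (Suc J)
    then obtain c where c: "\<And>j. 1 \<le> j \<Longrightarrow> j \<le> J \<Longrightarrow> P j = piece_sum t (last_of j) p c" by auto
    obtain c' where c': "P (J + 1) = piece_sum t (last_of (J + 1)) p c'"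
      using ex_piece_sum[OF step deg, of "J + 1"] Suc.prems by auto
    have J: "1 \<le> J" "J + 1 < nb" using Suc by auto
    interpret multiple_knot t "last_of J" "last_of (J + 1)" "z (J + 1)" by (rule multiple_knot_last_of[OF J])
    have overlap: "\<forall>i. last_of (J + 1) \<le> i + p \<and> i \<le> last_of J \<longrightarrow> c i = c' i"
      using power_dvd_diff_iff[of p c' c] smooth[OF J] c[of J] c' bp_mult_bounds[OF J] last_of_Suc[of J] step[of J] J
      by simp
    define d where "d i = (if i \<le> last_of J then c i else c' i)" for i
    have mono: "last_of j \<le> last_of J" if "j \<le> J" for j
      unfolding last_idx_def using that by (intro add_left_mono sum_mono2) auto
    have "P j = piece_sum t (last_of j) p d" if "1 \<le> j" "j \<le> J + 1" for j
    proof (cases "j = J + 1")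
      case True
      show ?thesis unfolding True c' by (rule piece_sum_cong) (use overlap in \<open>auto simp: d_def\<close>)
    next
      case False
      hence "j \<le> J" using that by simp
      hence "P j = piece_sum t (last_of j) p c" using c that by simp
      also have "\<dots> = piece_sum t (last_of j) p d"
        by (rule piece_sum_cong) (use mono[OF \<open>j \<le> J\<close>] in \<open>auto simp: d_def\<close>)
      finally show ?thesis .
    qed
    thus ?case by auto
  qed
  note ex = this
  have nb: "1 \<le> nb - 1" "nb - 1 < nb" using nb_ge by auto
  obtain c where "\<forall>j. 1 \<le> j \<and> j \<le> nb - 1 \<longrightarrow> P j = piece_sum t (last_of j) p c"
    using ex[OF nb] by (rule exE)
  hence c: "P j = piece_sum t (last_of j) p c" if "1 \<le> j" "j < nb" for j using that by simp
  have "f x = spl c x" for x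
  proof (cases "a \<le> x \<and> x \<le> b")
    case True
    then obtain \<mu> where \<mu>: "in_piece \<mu> x" using ex_in_piece by blast
    then obtain j where "1 \<le> j" "j < nb" "\<mu> = last_of j" using in_piece_imp_last_of by blast
    thus ?thesis using P[of j x] c[of j] spl_piece[OF \<mu>] \<mu> by simp
  qed (simp add: out spl_outside)
  thus ?thesis by blast
qed

text \<open>Linear independence provides the uniqueness behind \<open>THE\<close>; from here on
  norms are sums over coefficients.\<close>

lemma control_points_spl: "control_points p \<Xi> (spl c) = vector n c"
  unfolding control_points_def spline_of_eq_spl
proof (rule the_equality)
  have "spl c = spl (entry (vector n c))"
    by (rule spl_cong) (auto simp: entry_def vector_def)
  thus "vector n c \<in> carrier_vec n \<and> spl c = spl (entry (vector n c))" by (simp add: vector_def)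
next
  fix v assume v: "v \<in> carrier_vec n \<and> spl c = spl (entry v)"
  show "v = vector n c"
  proof (rule eq_vecI)
    fix i assume i: "i < dim_vec (vector n c)"
    hence "c (i + 1) = entry v (i + 1)" using spl_eq_imp[of c "entry v" "i + 1"] v by (simp add: vector_def)
    thus "v $ i = vector n c $ i" using i by (simp add: vector_def entry_def)
  qed (use v in \<open>simp add: vector_def\<close>)
qed

text \<open>The integral of the \<open>i\<close>-th B-spline over its whole support.\<close>

definition weight :: "nat \<Rightarrow> real" where
  "weight i = (t (i + p + 1) - t i) / (real p + 1)"

lemma weight_pos: "1 \<le> i \<Longrightarrow> i \<le> n \<Longrightarrow> 0 < weight i"
  using t_support[of i] by (simp add: weight_def)

lemma xi_norm_spl: "xi_norm p \<Xi> (spl c) = sqrt (\<Sum>i=1..n. (c i)\<^sup>2 * weight i)"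
  unfolding xi_norm_def control_points_spl
  by (intro arg_cong[of _ _ sqrt] sum.cong) (auto simp: vector_def entry_def weight_def t_knot)

end

section \<open>Norms and knot removal\<close>

context basic_knots
begin

text \<open>Since the derivative of \<open>B\<^bsub>l,p+1\<^esub>\<close> is a difference of consecutive normalized B-splines of degree
  \<open>p\<close>, these sums telescope to an antiderivative of \<open>B\<^bsub>i,p\<^esub>\<close>; it is continuous and stays between 0
  and a constant.\<close>

definition tail_sum :: "nat \<Rightarrow> nat \<Rightarrow> real poly" where
  "tail_sum i \<mu> = (\<Sum>l=i..\<mu>. piece t \<mu> (Suc p) l)"

lemma pderiv_tail_sum:
  assumes "t \<mu> < t (\<mu> + 1)"
  shows "pderiv (smult (weight i) (tail_sum i \<mu>)) = piece t \<mu> p i"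
proof -
  have tele: "(\<Sum>l=i..\<mu>. npiece t \<mu> p l - npiece t \<mu> p (Suc l)) = npiece t \<mu> p i"
  proof (cases "i \<le> \<mu>")
    case True
    have "(\<Sum>l=i..\<mu>. npiece t \<mu> p l - npiece t \<mu> p (Suc l)) = npiece t \<mu> p i - npiece t \<mu> p (Suc \<mu>)"
      using sum_Suc_diff[of i \<mu> "\<lambda>l. - npiece t \<mu> p l"] True by simp
    thus ?thesis by (simp add: npiece_eq_0)
  qed (simp add: npiece_eq_0)
  have "pderiv (tail_sum i \<mu>) = smult (real (Suc p)) (\<Sum>l=i..\<mu>. npiece t \<mu> p l - npiece t \<mu> p (Suc l))"
    by (simp add: tail_sum_def pderiv_sum pderiv_piece poly_eq_poly_eq_iff[symmetric] fun_eq_iff poly_sum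
        sum_distrib_left del: of_nat_Suc)
  hence "pderiv (smult (weight i) (tail_sum i \<mu>)) = smult (t (i + p + 1) - t i) (npiece t \<mu> p i)"
    unfolding pderiv_smult tele by (simp add: weight_def add.commute)
  thus ?thesis
    by (simp add: poly_eq_poly_eq_iff[symmetric] fun_eq_iff piece_eq_npiece[OF assms])
qed

text \<open>A partial sum of a nonnegative partition of unity. The degree is \<open>p + 1\<close>
  here, which \<open>piece_sum_one\<close> admits because \<open>p + 1 \<le> \<mu>\<close>.\<close>

lemma tail_sum_bounds:
  assumes "t \<mu> < t (\<mu> + 1)" "p + 1 \<le> \<mu>" "t \<mu> \<le> x" "x \<le> t (\<mu> + 1)"
  shows "0 \<le> poly (tail_sum i \<mu>) x" "poly (tail_sum i \<mu>) x \<le> 1"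
proof -
  show "0 \<le> poly (tail_sum i \<mu>) x"
    unfolding tail_sum_def poly_sum by (intro sum_nonneg poly_piece_nonneg assms)
  have "poly (tail_sum i \<mu>) x \<le> (\<Sum>l\<le>\<mu>. poly (piece t \<mu> (Suc p) l) x)"
    unfolding tail_sum_def poly_sum by (intro sum_mono2 poly_piece_nonneg assms) auto
  also have "\<dots> = poly (piece_sum t \<mu> (Suc p) (\<lambda>_. 1)) x" by (simp add: poly_piece_sum)
  also have "\<dots> = 1" using piece_sum_one[OF assms(1), of "Suc p"] assms(2) by simp
  finally show "poly (tail_sum i \<mu>) x \<le> 1" .
qed

text \<open>Multiplicities are at most \<open>p + 1\<close>, the degree of the summands, so
  \<open>poly_piece_eq\<close> applies.\<close>

lemma tail_sum_continuous:
  assumes "1 \<le> j" "j + 1 < nb"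
  shows "poly (tail_sum i (last_of j)) (z (j + 1)) = poly (tail_sum i (last_of (j + 1))) (z (j + 1))"
proof -
  interpret multiple_knot t "last_of j" "last_of (j + 1)" "z (j + 1)" by (rule multiple_knot_last_of[OF assms])
  have k: "last_of (j + 1) \<le> last_of j + Suc p" using bp_mult_bounds[OF assms] last_of_Suc[of j] assms by simp
  show ?thesis
    unfolding tail_sum_def poly_sum poly_piece_eq[OF k, symmetric]
    by (rule sum.mono_neutral_left) (use less in \<open>auto simp: piece_eq_0\<close>)
qed

section \<open>Integrals of B-splines and the bound on the L2 norm\<close>

lemma bspline_has_integral:
  assumes i: "i \<le> n" and "1 \<le> J" "J < nb"
  shows "(bspline p \<Xi> i has_integral
      weight i * (poly (tail_sum i (last_of J)) (z (J + 1)) - poly (tail_sum i (last_of 1)) (z 1))) {z 1..z (J + 1)}"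
proof -
  have piece: "(bspline p \<Xi> i has_integral
      weight i * (poly (tail_sum i (last_of j)) (z (j + 1)) - poly (tail_sum i (last_of j)) (z j))) {z j..z (j + 1)}"
    if j: "1 \<le> j" "j < nb" for j
  proof -
    let ?\<mu> = "last_of j" and ?F = "smult (weight i) (tail_sum i (last_of j))"
    have lt: "z j < z (j + 1)" using bp_less[of j "j + 1"] j by simp
    have "((\<lambda>x. poly (pderiv ?F) x) has_integral poly ?F (z (j + 1)) - poly ?F (z j)) {z j..z (j + 1)}"
    proof (rule fundamental_theorem_of_calculus)
      show "(poly ?F has_vector_derivative poly (pderiv ?F) x) (at x within {z j..z (j + 1)})" for x
        by (rule has_vector_derivative_at_within, rule has_real_derivative_iff_has_vector_derivative[THEN iffD1],
            rule poly_DERIV)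
    qed (use lt in simp)
    moreover have "pderiv ?F = piece t ?\<mu> p i"
      by (rule pderiv_tail_sum) (use t_last_of[OF j] lt in simp)
    ultimately have *: "((\<lambda>x. poly (piece t ?\<mu> p i) x) has_integral
        weight i * (poly (tail_sum i ?\<mu>) (z (j + 1)) - poly (tail_sum i ?\<mu>) (z j))) {z j..z (j + 1)}"
      by (simp add: algebra_simps)
    show ?thesis
    \<comment> \<open>At the right end \<open>bspline\<close> may already follow the next piece; a
      single point does not affect the integral.\<close>
    proof (rule has_integral_spike_finite[OF _ _ *, of "{z (j + 1)}"])
      fix x assume "x \<in> {z j..z (j + 1)} - {z (j + 1)}"
      hence "in_piece ?\<mu> x" using in_piece_last_of[OF j, of x] by auto
      thus "bspline p \<Xi> i x = poly (piece t ?\<mu> p i) x" by (rule bspline_piece) (rule i)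
    qed simp
  qed
  show ?thesis using assms(2,3)
  proof (induction J rule: nat_induct_at_least)
    case base
    thus ?case using piece[of 1] by simp
  next
    case (Suc J)
    have "(bspline p \<Xi> i has_integral
        weight i * (poly (tail_sum i (last_of J)) (z (J + 1)) - poly (tail_sum i (last_of 1)) (z 1)) +
        weight i * (poly (tail_sum i (last_of (J + 1))) (z (J + 1 + 1)) - poly (tail_sum i (last_of (J + 1))) (z (J + 1))))
        {z 1..z (J + 1 + 1)}"
    proof (rule has_integral_combine[of _ "z (J + 1)"])
      show "z 1 \<le> z (J + 1)" "z (J + 1) \<le> z (J + 1 + 1)"
        using bp_le[of 1 "J + 1"] bp_le[of "J + 1" "J + 1 + 1"] Suc by auto
    qed (use Suc piece[of "J + 1"] in auto)
    thus ?case using tail_sum_continuous[of J i] Suc by (simp add: algebra_simps)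
  qed
qed

lemma bspline_nonneg: "i \<le> n \<Longrightarrow> 0 \<le> bspline p \<Xi> i x"
proof (cases "a \<le> x \<and> x \<le> b")
  case True
  assume i: "i \<le> n"
  obtain \<mu> where \<mu>: "in_piece \<mu> x" using ex_in_piece True by blast
  show ?thesis unfolding bspline_piece[OF \<mu> i]
    by (rule poly_piece_nonneg) (use \<mu> in \<open>auto simp: in_piece_def\<close>)
qed (simp add: bspline_outside)

lemma borel_measurable_cox_de_boor [measurable]: "cox_de_boor \<Xi> c k i \<in> borel_measurable borel"
proof (induction k arbitrary: i)
  case 0
  show ?case unfolding cox_de_boor.simps by measurable
next
  case (Suc k)
  have [measurable]: "cox_de_boor \<Xi> c k i \<in> borel_measurable borel" "cox_de_boor \<Xi> c k (i + 1) \<in> borel_measurable borel"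
    by (rule Suc)+
  show ?case unfolding cox_de_boor.simps by measurable
qed

lemma borel_measurable_bspline [measurable]: "bspline p \<Xi> i \<in> borel_measurable borel"
  unfolding bspline_def by measurable

text \<open>The antiderivative grows by at most \<open>weight i\<close>, being
  \<open>weight i\<close> times a tail sum between 0 and 1. It is only an inequality since the
  support may reach beyond the interval.\<close>

lemma bspline_integral:
  assumes i: "1 \<le> i" "i \<le> n"
  shows "set_integrable lborel {a..b} (bspline p \<Xi> i)" "(LBINT x:{a..b}. bspline p \<Xi> i x) \<le> weight i"
proof -
  have nb: "1 \<le> nb - 1" "nb - 1 < nb" "nb - 1 + 1 = nb" using nb_ge by auto
  note int = bspline_has_integral[OF i(2) nb(1,2), unfolded nb(3) bp_first bp_last]
  have "bspline p \<Xi> i absolutely_integrable_on {a..b}"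
    using int bspline_nonneg[OF i(2)] by (intro nonnegative_absolutely_integrable_1) (auto simp: integrable_on_def)
  thus int': "set_integrable lborel {a..b} (bspline p \<Xi> i)"
    unfolding set_integrable_def by (subst (asm) integrable_completion) auto
  have "(LBINT x:{a..b}. bspline p \<Xi> i x) = integral {a..b} (bspline p \<Xi> i)"
    by (rule set_borel_integral_eq_integral(2)[OF int'])
  also have "\<dots> = weight i * (poly (tail_sum i (last_of (nb - 1))) b - poly (tail_sum i (last_of 1)) a)"
    using int by (rule integral_unique)
  also have "\<dots> \<le> weight i * 1"
  proof (rule mult_left_mono)
    have "0 \<le> poly (tail_sum i (last_of 1)) a"
      using t_last_of[of 1] last_of_bounds[of 1] nb_ge bp_first bp_less[of 1 2]
      by (intro tail_sum_bounds) (auto simp: numeral_2_eq_2)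
    moreover have "poly (tail_sum i (last_of (nb - 1))) b \<le> 1"
      using t_right_end n_ge unfolding last_of_last by (intro tail_sum_bounds) auto
    ultimately show "poly (tail_sum i (last_of (nb - 1))) b - poly (tail_sum i (last_of 1)) a \<le> 1" by linarith
  qed (use weight_pos[OF i] in simp)
  finally show "(LBINT x:{a..b}. bspline p \<Xi> i x) \<le> weight i" by simp
qed

lemma bspline_partition_of_unity:
  assumes "a \<le> x" "x \<le> b"
  shows "(\<Sum>i=1..n. bspline p \<Xi> i x) = 1"
proof -
  obtain \<mu> where \<mu>: "in_piece \<mu> x" using ex_in_piece assms by blast
  have "piece_sum t \<mu> p (\<lambda>_. 1) = 1" using \<mu> by (intro piece_sum_one) (auto simp: in_piece_def)
  thus ?thesis using spl_piece[OF \<mu>, of "\<lambda>_. 1"] by (simp add: spl_def)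
qed

text \<open>Jensen's inequality: \<open>spl c x\<close> is the mean of the \<open>c i\<close> with
  weights \<open>bspline p \<Xi> i x\<close>, and the variance is nonnegative.\<close>

lemma spl_square_le:
  assumes "a \<le> x" "x \<le> b"
  shows "(spl c x)\<^sup>2 \<le> (\<Sum>i=1..n. (c i)\<^sup>2 * bspline p \<Xi> i x)"
proof -
  let ?s = "spl c x"
  have "0 \<le> (\<Sum>i=1..n. (c i - ?s)\<^sup>2 * bspline p \<Xi> i x)"
    by (intro sum_nonneg mult_nonneg_nonneg bspline_nonneg) auto
  also have "\<dots> = (\<Sum>i=1..n. (c i)\<^sup>2 * bspline p \<Xi> i x - 2 * ?s * (c i * bspline p \<Xi> i x) + ?s\<^sup>2 * bspline p \<Xi> i x)"
    by (rule sum.cong) (simp_all add: power2_eq_square algebra_simps)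
  also have "\<dots> = (\<Sum>i=1..n. (c i)\<^sup>2 * bspline p \<Xi> i x) - 2 * ?s * (\<Sum>i=1..n. c i * bspline p \<Xi> i x)
      + ?s\<^sup>2 * (\<Sum>i=1..n. bspline p \<Xi> i x)"
    by (simp add: sum.distrib sum_subtractf sum_distrib_left)
  also have "\<dots> = (\<Sum>i=1..n. (c i)\<^sup>2 * bspline p \<Xi> i x) - ?s\<^sup>2"
    unfolding bspline_partition_of_unity[OF assms] spl_def[symmetric] by (simp add: power2_eq_square)
  finally show ?thesis by simp
qed

lemma l2_norm_spl_le: "l2_norm a b (spl c) \<le> xi_norm p \<Xi> (spl c)"
  unfolding l2_norm_def xi_norm_spl
proof (rule real_sqrt_le_mono)
  let ?g = "\<lambda>x. \<Sum>i=1..n. (c i)\<^sup>2 * (indicator {a..b} x *\<^sub>R bspline p \<Xi> i x)"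
  have int: "integrable lborel (\<lambda>x. (c i)\<^sup>2 * (indicator {a..b} x *\<^sub>R bspline p \<Xi> i x))" if "i \<in> {1..n}" for i
    using bspline_integral(1)[of i] that unfolding set_integrable_def by (intro integrable_mult_right) auto
  have "(LBINT x:{a..b}. (spl c x)\<^sup>2) \<le> (\<integral>x. ?g x \<partial>lborel)"
    unfolding set_lebesgue_integral_def
  proof (rule integral_mono')
    show "integrable lborel ?g" by (rule Bochner_Integration.integrable_sum) (rule int)
    fix x
    show "indicat_real {a..b} x *\<^sub>R (spl c x)\<^sup>2 \<le> ?g x"
      using spl_square_le[of x c] by (cases "x \<in> {a..b}") auto
    show "0 \<le> ?g x" by (intro sum_nonneg mult_nonneg_nonneg scaleR_nonneg_nonneg bspline_nonneg) auto
  qed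
  also have "\<dots> = (\<Sum>i=1..n. (c i)\<^sup>2 * (LBINT x:{a..b}. bspline p \<Xi> i x))"
    unfolding set_lebesgue_integral_def by (subst Bochner_Integration.integral_sum) (use int in auto)
  also have "\<dots> \<le> (\<Sum>i=1..n. (c i)\<^sup>2 * weight i)"
    by (intro sum_mono mult_left_mono bspline_integral) auto
  finally show "(LBINT x:{a..b}. (spl c x)\<^sup>2) \<le> (\<Sum>i=1..n. (c i)\<^sup>2 * weight i)" .
qed

section \<open>Removal of a single interior knot\<close>

lemma length_remove_knot: "1 \<le> q \<Longrightarrow> q \<le> length \<Xi> \<Longrightarrow> length (remove_knot q \<Xi>) = length \<Xi> - 1"
  by (simp add: remove_knot_def)

text \<open>\<open>2 \<le> q\<close> protects index 0, which repeats the first knot, and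
  \<open>q < length \<Xi>\<close> protects the last knot, which is repeated forever.\<close>

lemma knot_ext_remove_knot:
  assumes "2 \<le> q" "q < length \<Xi>"
  shows "knot_ext (remove_knot q \<Xi>) = delete_knot q t"
proof
  fix i
  have len: "length (remove_knot q \<Xi>) = length \<Xi> - 1" using assms by (intro length_remove_knot) auto
  have k: "knot (remove_knot q \<Xi>) j = (if j < q then knot \<Xi> j else knot \<Xi> (j + 1))" if "j \<le> length \<Xi> - 1" for j
    using that assms unfolding knot_def remove_knot_def by (cases j) (auto simp: nth_append)
  show "knot_ext (remove_knot q \<Xi>) i = delete_knot q t i"
    unfolding delete_knot_def knot_ext_def len using k[of "min i (length \<Xi> - 1)"] assms
    by (auto simp: min_def not_le intro!: arg_cong[of _ _ "knot \<Xi>"])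
qed

end

locale interior_knot = basic_knots +
  fixes q :: nat
  assumes q: "p + 2 \<le> q" "q \<le> n"
begin

abbreviation "\<Xi>' \<equiv> remove_knot q \<Xi>"

lemma q_len: "2 \<le> q" "q < length \<Xi>" "0 < q"
  using q length_eq by auto

lemma dim_remove_knot: "dim_spl p \<Xi>' = n - 1"
  using length_remove_knot[of q] q_len by (simp add: dim_spl_def)

lemma t'_eq: "knot_ext \<Xi>' = delete_knot q t"
  by (rule knot_ext_remove_knot[OF q_len(1,2)])

lemma basic_knots_remove_knot: "basic_knots p \<Xi>'"
proof
  have k: "knot \<Xi>' i = delete_knot q t i" if "i \<le> n + p" for i
    unfolding t'_eq[symmetric] knot_ext_def using length_remove_knot[of q] q_len length_eq that by simp
  note n' = dim_remove_knot
  have t': "delete_knot q t i = t i" if "i < q" for i using that by (simp add: delete_knot_def)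
  have ge: "t i \<le> delete_knot q t i" "delete_knot q t i \<le> t (i + 1)" for i
    by (auto simp: delete_knot_def intro: le)
  have s: "sorted (take (q - 1) \<Xi> @ drop (q - 1) \<Xi>)" using sorted_knots by simp
  moreover have "drop q \<Xi> = drop 1 (drop (q - 1) \<Xi>)" using q_len by simp
  hence "set (drop q \<Xi>) \<subseteq> set (drop (q - 1) \<Xi>)" by (metis set_drop_subset)
  ultimately show "sorted \<Xi>'" unfolding remove_knot_def sorted_append using sorted_wrt_drop sorted_knots by blast
  show "2 * (p + 1) \<le> length \<Xi>'" using length_remove_knot[of q] q_len q length_eq by simp
  fix i assume i: "1 \<le> i" "i \<le> dim_spl p \<Xi>'"
  hence i': "i + 1 \<le> n" "i \<le> n" using n' n_ge by linarith+
  show "knot \<Xi>' i < knot \<Xi>' (i + p + 1)"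
  proof (cases "i < q")
    case True
    thus ?thesis using k[of i] k[of "i + p + 1"] t'[of i] ge(1)[of "i + p + 1"] t_support[of i] i i' by simp
  next
    case False
    thus ?thesis using k[of i] k[of "i + p + 1"] t_support[of "i + 1"] i i' by (simp add: delete_knot_def)
  qed
next
  have k: "knot \<Xi>' i = delete_knot q t i" if "i \<le> n + p" for i
    unfolding t'_eq[symmetric] knot_ext_def using length_remove_knot[of q] q_len length_eq that by simp
  show "knot \<Xi>' (p + 1) < knot \<Xi>' (p + 2)"
  proof -
    have "delete_knot q t (p + 1) = t (p + 1)" "t (p + 2) \<le> delete_knot q t (p + 2)"
      using q by (auto simp: delete_knot_def intro: le)
    thus ?thesis using k[of "p + 1"] k[of "p + 2"] q t_left_end by simp
  qed
  show "knot \<Xi>' (dim_spl p \<Xi>') < knot \<Xi>' (dim_spl p \<Xi>' + 1)"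
    unfolding dim_remove_knot
    using k[of "n - 1"] k[of n] q t_right_end le[of "n - 1" n] by (auto simp: delete_knot_def)
qed

end

sublocale interior_knot \<subseteq> R: basic_knots p "remove_knot q \<Xi>"
  by (rule basic_knots_remove_knot)

context interior_knot
begin

lemma same_ends: "R.a = a" "R.b = b"
  unfolding t'_eq dim_remove_knot using q by (auto simp: delete_knot_def)

lemma R_spl: "R.spl d = spl (insertion p t q d)"
proof
  fix x
  show "R.spl d x = spl (insertion p t q d) x"
  proof (cases "a \<le> x \<and> x \<le> b")
    case True
    then obtain \<mu> where \<mu>: "in_piece \<mu> x" using ex_in_piece by blast
    let ?\<mu>' = "if \<mu> < q then \<mu> else \<mu> - 1"
    \<comment> \<open>Positions from \<open>q\<close> on move down by one. In particular
      \<open>\<mu> = n\<close> becomes the last coarse interval, which again contains its right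
      end.\<close>
    have "R.in_piece ?\<mu>' x"
    proof (cases "\<mu> < q")
      case True
      thus ?thesis using \<mu> q le[of "\<mu> + 1" "\<mu> + 2"]
        unfolding R.in_piece_def in_piece_def t'_eq dim_remove_knot by (auto simp: delete_knot_def)
    next
      case False
      thus ?thesis using \<mu> q le[of "\<mu> - 1" \<mu>]
        unfolding R.in_piece_def in_piece_def t'_eq dim_remove_knot by (auto simp: delete_knot_def)
    qed
    hence "R.spl d x = poly (piece_sum (delete_knot q t) ?\<mu>' p d) x" by (simp only: R.spl_piece t'_eq)
    also have "\<dots> = spl (insertion p t q d) x"
      unfolding spl_piece[OF \<mu>] using \<mu> q_len by (subst piece_sum_delete_knot) (auto simp: in_piece_def)
    finally show ?thesis .
  qed (use same_ends in \<open>simp add: spl_outside R.spl_outside\<close>)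
qed

lemma knot_space_remove_knot: "knot_space p \<Xi>' \<subseteq> knot_space p \<Xi>"
  using R.knot_space_imp_spl R_spl spl_in_knot_space by fastforce

lemma insertion_weight_bounds: "0 \<le> insertion_weight p t q i" "insertion_weight p t q i \<le> 1"
proof -
  have "0 \<le> insertion_weight p t q i \<and> insertion_weight p t q i \<le> 1"
    using le[of i q] le[of q "i + p + 1"]
    by (auto simp: insertion_weight_def divide_le_eq_1 intro!: divide_nonneg_nonneg)
  thus "0 \<le> insertion_weight p t q i" "insertion_weight p t q i \<le> 1" by blast+
qed

text \<open>The deleted knot cuts the coarse support, from \<open>t i\<close> to
  \<open>t (i + p + 2)\<close>, into two parts; up to the factor \<open>p + 1\<close> these are the
  two summands. In other words, the transposed insertion matrix maps the fine weights to the coarse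
  ones.\<close>

lemma weight_remove_knot:
  assumes "1 \<le> i" "i < n"
  shows "R.weight i = insertion_weight p t q i * weight i + (1 - insertion_weight p t q (i + 1)) * weight (i + 1)"
proof -
  let ?\<alpha> = "insertion_weight p t q"
  have h: "t i < t (i + p + 1)" "t (i + 1) < t (i + p + 2)"
    using t_support[of i] t_support[of "i + 1"] assms by (simp_all add: eval_nat_numeral)
  consider "i + p + 1 < q" | "q \<le> i" | "i < q" "q \<le> i + p + 1" by linarith
  thus ?thesis
  proof cases
    case 3
    have "?\<alpha> i * weight i = (t q - t i) / (real p + 1)"
      using 3 h by (cases "q = i + p + 1") (auto simp: insertion_weight_def weight_def)
    moreover have "(1 - ?\<alpha> (i + 1)) * weight (i + 1) = (t (i + p + 2) - t q) / (real p + 1)"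
      using 3 h by (cases "q = i + 1") (auto simp: insertion_weight_def weight_def divide_simps)
    ultimately show ?thesis using 3
      by (simp add: R.weight_def t'_eq delete_knot_def diff_divide_distrib)
  qed (simp_all add: R.weight_def weight_def t'_eq delete_knot_def insertion_weight_def)
qed

text \<open>Convexity of the square in every row, then an exchange of summation: the weighted column
  sums are the coarse weights.\<close>

lemma xi_norm_mono:
  assumes "g \<in> knot_space p \<Xi>'"
  shows "xi_norm p \<Xi> g \<le> xi_norm p \<Xi>' g"
proof -
  obtain d where g: "g = R.spl d" using R.knot_space_imp_spl[OF assms] by blast
  let ?\<alpha> = "insertion_weight p t q"
  have sq: "(insertion p t q d i)\<^sup>2 \<le> ?\<alpha> i * (d i)\<^sup>2 + (1 - ?\<alpha> i) * (d (i - 1))\<^sup>2" for i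
  proof -
    have "0 \<le> ?\<alpha> i * (1 - ?\<alpha> i) * (d i - d (i - 1))\<^sup>2" using insertion_weight_bounds[of i] by simp
    thus ?thesis by (simp add: insertion_def power2_eq_square algebra_simps)
  qed
  \<comment> \<open>\<open>d n\<close> and \<open>d 0\<close>, which are not coefficients of the
    coarse spline, receive the factor 0.\<close>
  have ends: "?\<alpha> 1 = 1" "?\<alpha> n = 0" using q by (auto simp: insertion_weight_def)
  obtain n' where n': "n = Suc n'" using n_ge by (cases n) auto
  have "(\<Sum>i=1..n. (insertion p t q d i)\<^sup>2 * weight i)
      \<le> (\<Sum>i=1..n. (?\<alpha> i * (d i)\<^sup>2 + (1 - ?\<alpha> i) * (d (i - 1))\<^sup>2) * weight i)"
    using weight_pos by (intro sum_mono mult_right_mono sq) (auto simp: less_imp_le)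
  also have "\<dots> = (\<Sum>i=1..n. ?\<alpha> i * weight i * (d i)\<^sup>2) + (\<Sum>i=1..n. (1 - ?\<alpha> i) * weight i * (d (i - 1))\<^sup>2)"
    by (simp add: sum.distrib[symmetric] algebra_simps)
  also have "(\<Sum>i=1..n. ?\<alpha> i * weight i * (d i)\<^sup>2) = (\<Sum>i=1..n'. ?\<alpha> i * weight i * (d i)\<^sup>2)"
    using ends(2) unfolding n' by simp
  also have "(\<Sum>i=1..n. (1 - ?\<alpha> i) * weight i * (d (i - 1))\<^sup>2)
      = (\<Sum>i=1..n'. (1 - ?\<alpha> (i + 1)) * weight (i + 1) * (d i)\<^sup>2)"
  proof -
    have "(\<Sum>i=1..n. (1 - ?\<alpha> i) * weight i * (d (i - 1))\<^sup>2) = (\<Sum>i=Suc 1..Suc n'. (1 - ?\<alpha> i) * weight i * (d (i - 1))\<^sup>2)"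
      using sum.atLeast_Suc_atMost[of 1 n "\<lambda>i. (1 - ?\<alpha> i) * weight i * (d (i - 1))\<^sup>2"] ends(1) n_ge
      unfolding n' by simp
    also have "\<dots> = (\<Sum>i=1..n'. (1 - ?\<alpha> (i + 1)) * weight (i + 1) * (d i)\<^sup>2)"
      unfolding sum.shift_bounds_cl_Suc_ivl by simp
    finally show ?thesis .
  qed
  also have "(\<Sum>i=1..n'. ?\<alpha> i * weight i * (d i)\<^sup>2) + (\<Sum>i=1..n'. (1 - ?\<alpha> (i + 1)) * weight (i + 1) * (d i)\<^sup>2)
      = (\<Sum>i=1..n'. (d i)\<^sup>2 * R.weight i)"
    unfolding sum.distrib[symmetric]
    by (rule sum.cong) (simp_all add: weight_remove_knot n' algebra_simps)
  finally show ?thesis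
    unfolding g R.xi_norm_spl unfolding R_spl xi_norm_spl dim_remove_knot n' by simp
qed

end

section \<open>The local least squares problem\<close>

context basic_knots
begin

lemma spl_add: "spl c x + spl d x = spl (\<lambda>i. c i + d i) x"
  by (simp add: spl_def sum.distrib[symmetric] algebra_simps)

lemma xi_norm_spl_L2_set: "xi_norm p \<Xi> (spl c) = L2_set (\<lambda>i. c i * sqrt (weight i)) {1..n}"
  unfolding xi_norm_spl L2_set_def
  by (intro arg_cong[of _ _ sqrt] sum.cong) (auto simp: power_mult_distrib weight_pos less_imp_le)

lemma knot_space_diff:
  assumes "f \<in> knot_space p \<Xi>" "g \<in> knot_space p \<Xi>"
  shows "(\<lambda>x. f x - g x) \<in> knot_space p \<Xi>"
proof -
  obtain c d where "f = spl c" "g = spl d" using assms knot_space_imp_spl by blast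
  thus ?thesis by (simp add: spl_diff spl_in_knot_space)
qed

lemma xi_norm_triangle:
  assumes "f \<in> knot_space p \<Xi>" "g \<in> knot_space p \<Xi>"
  shows "xi_norm p \<Xi> (\<lambda>x. f x + g x) \<le> xi_norm p \<Xi> f + xi_norm p \<Xi> g"
proof -
  obtain c d where "f = spl c" "g = spl d" using assms knot_space_imp_spl by blast
  thus ?thesis
    using L2_set_triangle_ineq[of "\<lambda>i. c i * sqrt (weight i)" "\<lambda>i. d i * sqrt (weight i)" "{1..n}"]
    by (simp add: spl_add xi_norm_spl_L2_set algebra_simps)
qed

lemma xi_norm_commute:
  assumes "f \<in> knot_space p \<Xi>" "g \<in> knot_space p \<Xi>"
  shows "xi_norm p \<Xi> (\<lambda>x. f x - g x) = xi_norm p \<Xi> (\<lambda>x. g x - f x)"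
proof -
  obtain c d where "f = spl c" "g = spl d" using assms knot_space_imp_spl by blast
  thus ?thesis by (simp add: spl_diff xi_norm_spl power2_commute)
qed

lemma nb_ge_3:
  assumes "p + 1 < n"
  shows "3 \<le> nb"
proof -
  have *: "a < t (p + 2)" "t (p + 2) < b"
    using t_left_end t_right_end le[of "p + 2" n] assms by simp_all
  have "card {a, t (p + 2), b} \<le> nb" unfolding nb_eq
    using ab_breakpoints finite_breakpoints t_breakpoint[of "p + 2"] * assms by (intro card_mono) auto
  thus ?thesis using * by auto
qed

end

lemma vector_carrier: "vector k f \<in> carrier_vec k"
  by (simp add: vector_def)

lemma entry_vector: "1 \<le> i \<Longrightarrow> i \<le> k \<Longrightarrow> entry (vector k f) i = f i"
  unfolding entry_def vector_def by (cases i) auto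

section \<open>The block of the algorithm and its matrices\<close>

locale removal_at = basic_knots +
  fixes j :: nat
  assumes j: "2 \<le> j" "j < num_bp p \<Xi>"
begin

abbreviation "q \<equiv> last_of j"
abbreviation "l \<equiv> bp_mult p \<Xi> j - 1"

lemma q_bounds: "p + 2 \<le> q" "q \<le> n"
proof -
  have "1 \<le> j - 1" "j - 1 < nb" "j - 1 + 1 < nb" "j - 1 + 1 = j" using j by auto
  thus "p + 2 \<le> q" using last_of_less[of "j - 1"] last_of_bounds(1)[of "j - 1"] by simp
  show "q \<le> n" using last_of_bounds(2)[of j] j by simp
qed

end

sublocale removal_at \<subseteq> interior_knot p \<Xi> "last_idx p \<Xi> j"
  by unfold_locales (rule q_bounds)+

context removal_at
begin

text \<open>\<open>q - l\<close> is the first position of the breakpoint, hence beyond the first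
  \<open>p + 1\<close> knots.\<close>

lemma l_bounds: "l \<le> p" "l + p + 2 \<le> q"
proof -
  have j': "1 \<le> j - 1" "j - 1 + 1 < nb" "j - 1 + 1 = j" using j by auto
  show "l \<le> p" using bp_mult_bounds[OF j'(1,2)] j'(3) by simp
  show "l + p + 2 \<le> q" using bp_mult_bounds[OF j'(1,2)] last_of_Suc[OF j'(1)] last_of_bounds[of "j - 1"] j' by simp
qed

lemma t_block:
  assumes "q - l \<le> i" "i \<le> q"
  shows "t i = t q"
proof -
  have j': "1 \<le> j - 1" "j - 1 + 1 < nb" "j - 1 + 1 = j" using j by auto
  have "last_of (j - 1) < i" using assms bp_mult_bounds[OF j'(1,2)] last_of_Suc[OF j'(1)] j'(3) by simp
  thus ?thesis using t_interior[OF j'(1,2)] assms j' last_of_less[OF j'(1,2)] by simp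
qed

lemma t_before_block:
  assumes "i < q - l"
  shows "t i < t q"
proof -
  have j': "1 \<le> j - 1" "j - 1 < nb" "j - 1 + 1 < nb" "j - 1 + 1 = j" using j by auto
  have "i \<le> last_of (j - 1)" using assms bp_mult_bounds[OF j'(1,3)] last_of_Suc[OF j'(1)] j'(4) by simp
  hence "t i \<le> t (last_of (j - 1))" by (rule le)
  thus ?thesis using t_last_of[OF j'(1,2)] t_last_of[of j] bp_less[of "j - 1" j] j j' by simp
qed

text \<open>Among the copies of the knot the numerator \<open>t q - t i\<close> is 0. From
  \<open>q - l\<close> on insertion merely shifts the points, which is why the local block ends
  there.\<close>

lemma insertion_weight_after: "q - l \<le> i \<Longrightarrow> insertion_weight p t q i = 0"
  using t_block[of i] l_bounds q_bounds by (cases "q \<le> i") (auto simp: insertion_weight_def)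

lemma insertion_weight_pos:
  assumes "i < q - l"
  shows "0 < insertion_weight p t q i"
  using t_before_block[OF assms] le[of q "i + p + 1"] assms
  by (cases "i + p < q") (auto simp: insertion_weight_def)

text \<open>Row \<open>r\<close> of the local matrix, counted from 1, is row
  \<open>q + r - (p + 2)\<close> of the global insertion matrix. For \<open>r = 1\<close> the
  support ends at position \<open>q\<close> and the quotient is 1.\<close>

lemma alpha_eq:
  assumes "1 \<le> r" "r \<le> p + 2 - l"
  shows "alpha p \<Xi> q r = insertion_weight p t q (q + r - (p + 2))"
proof -
  define i where "i = q + r - (p + 2)"
  have i: "q + r - 1 = i + p + 1" "i \<le> q - l" "1 \<le> i" "q \<le> i + p + 1" "i \<le> n"
    using assms q_bounds l_bounds by (auto simp: i_def)
  have "alpha p \<Xi> q r = (t q - t i) / (t (i + p + 1) - t i)"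
    unfolding alpha_def i_def[symmetric] i(1) using i q_bounds by (simp add: t_knot)
  also have "\<dots> = insertion_weight p t q i"
  proof (cases "i + p < q")
    case True
    hence "t (i + p + 1) = t q" using i by (intro arg_cong[of _ _ t]) simp
    thus ?thesis using t_support[of i] i True by (simp add: insertion_weight_def)
  next
    case False
    thus ?thesis using t_block[of i] i by (auto simp: insertion_weight_def)
  qed
  finally show ?thesis unfolding i_def .
qed

abbreviation "A \<equiv> A_loc p \<Xi> q l"
abbreviation "E \<equiv> E_loc p \<Xi> q l"

lemma A_carrier: "A \<in> carrier_mat (p + 2 - l) (p + 1 - l)"
  by (simp add: A_loc_def matrix_def)

lemma E_carrier: "E \<in> carrier_mat (p + 2 - l) (p + 2 - l)"
  by (simp add: E_loc_def matrix_def)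

text \<open>Rows are counted from 0 here, hence the offset \<open>p + 1\<close> where
  \<open>alpha_eq\<close> has \<open>p + 2\<close>.\<close>

lemma E_mult_vec:
  assumes u: "u \<in> carrier_vec (p + 2 - l)" and r: "r < p + 2 - l"
  shows "(E *\<^sub>v u) $ r = sqrt (weight (q + r - (p + 1))) * u $ r"
proof -
  have e: "E $$ (r, r) = sqrt (weight (q + r - (p + 1)))"
  proof -
    have "q + r - (p + 1) + p + 1 = q + r" using q_bounds by simp
    thus ?thesis using r q_bounds l_bounds
      by (simp add: E_loc_def matrix_def weight_def t_knot)
  qed
  have "(E *\<^sub>v u) $ r = (\<Sum>k<p + 2 - l. E $$ (r, k) * u $ k)"
    using E_carrier u r by (auto simp: scalar_prod_def lessThan_atLeast0)
  also have "\<dots> = (\<Sum>k<p + 2 - l. if k = r then E $$ (r, r) * u $ r else 0)"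
    by (rule sum.cong) (use r in \<open>auto simp: E_loc_def matrix_def\<close>)
  also have "\<dots> = E $$ (r, r) * u $ r" using r by simp
  finally show ?thesis using e by simp
qed

definition block :: "(nat \<Rightarrow> real) \<Rightarrow> real vec" where
  "block d = vector (p + 1 - l) (\<lambda>r. d (q + r - (p + 2)))"

lemma block_carrier: "block d \<in> carrier_vec (p + 1 - l)"
  unfolding block_def by (rule vector_carrier)

lemma A_mult_block:
  assumes r: "r < p + 2 - l"
  shows "(A *\<^sub>v block d) $ r = insertion p t q d (q + r - (p + 1))"
proof -
  let ?y = "block d"
  define i where "i = q + r - (p + 1)"
  have i: "q + (r + 1) - (p + 2) = i" "q + r - (p + 2) = i - 1" "i \<le> q - l" "1 \<le> i"
    using r q_bounds l_bounds by (auto simp: i_def)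
  have y: "?y \<in> carrier_vec (p + 1 - l)" by (rule block_carrier)
  have \<alpha>: "alpha p \<Xi> q (r + 1) = insertion_weight p t q i" using alpha_eq[of "r + 1"] r i by simp
  have yk: "?y $ k = d (q + k - (p + 1))" if "k < p + 1 - l" for k
    using that by (simp add: block_def vector_def)
  have "(A *\<^sub>v ?y) $ r = (\<Sum>k<p + 1 - l. A $$ (r, k) * ?y $ k)"
    using A_carrier y r by (auto simp: scalar_prod_def lessThan_atLeast0)
  also have "\<dots> = (\<Sum>k<p + 1 - l. (if k = r then insertion_weight p t q i * d i else 0)
      + (if r = k + 1 then (1 - insertion_weight p t q i) * d (i - 1) else 0))"
  proof (rule sum.cong)
    fix k assume "k \<in> {..<p + 1 - l}"
    hence k: "k < p + 1 - l" by simp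
    show "A $$ (r, k) * ?y $ k = (if k = r then insertion_weight p t q i * d i else 0)
      + (if r = k + 1 then (1 - insertion_weight p t q i) * d (i - 1) else 0)"
    proof -
      have "A $$ (r, k) = (if r = k then insertion_weight p t q i else if r = k + 1 then 1 - insertion_weight p t q i else 0)"
        using r k \<alpha> by (auto simp: A_loc_def matrix_def)
      moreover have "k = r \<Longrightarrow> q + k - (p + 1) = i" "r = k + 1 \<Longrightarrow> q + k - (p + 1) = i - 1"
        by (auto simp: i_def)
      ultimately show ?thesis using yk[OF k] by auto
    qed
  qed simp
  also have "\<dots> = (if r < p + 1 - l then insertion_weight p t q i * d i else 0)
      + (if 1 \<le> r then (1 - insertion_weight p t q i) * d (i - 1) else 0)"
  proof -
    have "(\<Sum>k<p + 1 - l. if r = k + 1 then (1 - insertion_weight p t q i) * d (i - 1) else 0)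
      = (\<Sum>k<p + 1 - l. if k = r - 1 \<and> 1 \<le> r then (1 - insertion_weight p t q i) * d (i - 1) else 0)"
      by (rule sum.cong) auto
    also have "\<dots> = (if 1 \<le> r then (1 - insertion_weight p t q i) * d (i - 1) else 0)"
      using r l_bounds by (cases "1 \<le> r") auto
    finally show ?thesis by (simp add: sum.distrib)
  qed
  \<comment> \<open>The first row lacks \<open>d (i - 1)\<close> and the last row lacks
    \<open>d i\<close>; the weights 1 and 0 of these rows remove the same terms from
    \<open>insertion\<close>.\<close>
  also have "\<dots> = insertion p t q d i"
  proof -
    have "insertion_weight p t q i = 0" if "\<not> r < p + 1 - l"
      using insertion_weight_after[of i] that r l_bounds q_bounds by (auto simp: i_def)
    moreover have "insertion_weight p t q i = 1" if "\<not> 1 \<le> r"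
      using that q_bounds by (auto simp: i_def insertion_weight_def)
    ultimately show ?thesis by (auto simp: insertion_def)
  qed
  finally show ?thesis unfolding i_def .
qed

lemma sum_block_shift: "(\<Sum>r<p + 2 - l. f (q + r - (p + 1))) = (\<Sum>i=q - (p + 1)..q - l. f i)"
  by (rule sum.reindex_bij_witness[of _ "\<lambda>i. i + (p + 1) - q" "\<lambda>r. q + r - (p + 1)"])
     (use q_bounds l_bounds in auto)

lemma block_index:
  assumes "r < p + 2 - l"
  shows "1 \<le> q + r - (p + 1)" "q + r - (p + 1) \<le> n"
  using assms q_bounds l_bounds by linarith+

lemma block_residual:
  fixes c :: "real vec"
  shows "((E * A) *\<^sub>v block d - E *\<^sub>v local_block p q l c) \<bullet> ((E * A) *\<^sub>v block d - E *\<^sub>v local_block p q l c)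
    = (\<Sum>i=q - (p + 1)..q - l. (insertion p t q d i - entry c i)\<^sup>2 * weight i)"
proof -
  let ?y = "block d" and ?v = "local_block p q l c"
  have y: "?y \<in> carrier_vec (p + 1 - l)" by (rule block_carrier)
  have v: "?v \<in> carrier_vec (p + 2 - l)" unfolding local_block_def by (rule vector_carrier)
  have Ay: "A *\<^sub>v ?y \<in> carrier_vec (p + 2 - l)" using A_carrier y by simp
  have EA: "(E * A) *\<^sub>v ?y = E *\<^sub>v (A *\<^sub>v ?y)" by (rule assoc_mult_mat_vec[OF E_carrier A_carrier y])
  have dim: "dim_vec ((E * A) *\<^sub>v ?y - E *\<^sub>v ?v) = p + 2 - l" using E_carrier by simp
  have "((E * A) *\<^sub>v ?y - E *\<^sub>v ?v) $ r = sqrt (weight (q + r - (p + 1))) *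
      (insertion p t q d (q + r - (p + 1)) - entry c (q + r - (p + 1)))" if r: "r < p + 2 - l" for r
  proof -
    have "?v $ r = entry c (q + r - (p + 1))" using r by (simp add: local_block_def vector_def)
    moreover have "((E * A) *\<^sub>v ?y - E *\<^sub>v ?v) $ r = (E *\<^sub>v (A *\<^sub>v ?y)) $ r - (E *\<^sub>v ?v) $ r"
      unfolding EA using E_carrier r by (simp del: index_mult_mat_vec)
    ultimately show ?thesis
      by (simp only: E_mult_vec[OF Ay r] E_mult_vec[OF v r] A_mult_block[OF r] right_diff_distrib)
  qed
  moreover have "0 \<le> weight (q + r - (p + 1))" if r: "r < p + 2 - l" for r
    by (rule less_imp_le, rule weight_pos) (rule block_index[OF r])+
  ultimately have "((E * A) *\<^sub>v ?y - E *\<^sub>v ?v) \<bullet> ((E * A) *\<^sub>v ?y - E *\<^sub>v ?v)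
      = (\<Sum>r<p + 2 - l. (insertion p t q d (q + r - (p + 1)) - entry c (q + r - (p + 1)))\<^sup>2 * weight (q + r - (p + 1)))"
    unfolding scalar_prod_self dim by (intro sum.cong) (auto simp: power_mult_distrib)
  thus ?thesis unfolding sum_block_shift[of "\<lambda>i. (insertion p t q d i - entry c i)\<^sup>2 * weight i"] .
qed

text \<open>Every local vector is a window of some global sequence, so results about
  \<open>block d\<close> cover all of them.\<close>

lemma ex_block: "y \<in> carrier_vec (p + 1 - l) \<Longrightarrow> \<exists>d. y = block d"
  by (rule exI[of _ "\<lambda>i. entry y (i + (p + 2) - q)"])
     (use q_bounds in \<open>auto intro!: eq_vecI simp: block_def vector_def entry_def\<close>)

text \<open>Forward substitution in a bidiagonal matrix: the first row reads off its unknown with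
  weight 1, and the further diagonal weights are positive. The row scaling by \<open>E\<close> is
  positive as well.\<close>

lemma block_injective:
  assumes y: "y \<in> carrier_vec (p + 1 - l)" and 0: "(E * A) *\<^sub>v y = 0\<^sub>v (p + 2 - l)"
  shows "y = 0\<^sub>v (p + 1 - l)"
proof -
  obtain d where d: "y = block d" using ex_block[OF y] by blast
  have Ay: "A *\<^sub>v y \<in> carrier_vec (p + 2 - l)" using A_carrier y by simp
  have ins: "insertion p t q d (q + r - (p + 1)) = 0" if r: "r < p + 2 - l" for r
  proof -
    have "0 = ((E * A) *\<^sub>v y) $ r" unfolding 0 using r by simp
    also have "\<dots> = sqrt (weight (q + r - (p + 1))) * insertion p t q d (q + r - (p + 1))"
      unfolding assoc_mult_mat_vec[OF E_carrier A_carrier y] E_mult_vec[OF Ay r]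
      unfolding d A_mult_block[OF r] ..
    finally show ?thesis using weight_pos[OF block_index[OF r]] by simp
  qed
  have "d (q + r - (p + 1)) = 0" if "r < p + 1 - l" for r
    using that
  proof (induction r)
    case 0
    have "insertion_weight p t q (q - (p + 1)) = 1" using q_bounds by (simp add: insertion_weight_def)
    thus ?case using ins[of 0] 0 by (simp add: insertion_def)
  next
    case (Suc r)
    have "q + Suc r - (p + 1) < q - l" using Suc.prems q_bounds l_bounds by linarith
    hence "0 < insertion_weight p t q (q + Suc r - (p + 1))" by (rule insertion_weight_pos)
    moreover have "q + Suc r - (p + 1) - 1 = q + r - (p + 1)" using q_bounds by simp
    ultimately show ?case using ins[of "Suc r"] Suc by (simp add: insertion_def)
  qed
  thus ?thesis unfolding d by (auto intro!: eq_vecI simp: block_def vector_def)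
qed

definition new_points :: "real vec \<Rightarrow> real vec" where
  "new_points c = replace_block p q l c (lsq_solution (E * A) (E *\<^sub>v local_block p q l c))"

lemma new_points_carrier: "c \<in> carrier_vec n \<Longrightarrow> new_points c \<in> carrier_vec (n - 1)"
  by (simp add: new_points_def replace_block_def vector_def)

text \<open>Outside the block the new points leave no residual, so their global objective is the
  local one. Any competitor pays at least its own local part, which the least squares solution does
  not exceed.\<close>

lemma new_points_optimal:
  assumes c: "c \<in> carrier_vec n"
  shows "(\<Sum>i=1..n. (insertion p t q (entry (new_points c)) i - entry c i)\<^sup>2 * weight i)
    \<le> (\<Sum>i=1..n. (insertion p t q d i - entry c i)\<^sup>2 * weight i)"
proof -
  define y where "y = lsq_solution (E * A) (E *\<^sub>v local_block p q l c)"
  define D where "D = entry (new_points c)"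
  let ?f = "\<lambda>d i. (insertion p t q d i - entry c i)\<^sup>2 * weight i"
  let ?blk = "{q - (p + 1)..q - l}"
  have M: "E * A \<in> carrier_mat (p + 2 - l) (p + 1 - l)" using E_carrier A_carrier by simp
  have v: "E *\<^sub>v local_block p q l c \<in> carrier_vec (p + 2 - l)"
    by (rule mult_mat_vec_carrier[OF E_carrier]) (unfold local_block_def, rule vector_carrier)
  note lsq = least_squares[OF M v block_injective, folded y_def]
  have D_eq: "D i = (if i \<le> q - (p + 2) then entry c i
      else if i < q - l then entry y (i - (q - (p + 2))) else entry c (i + 1))" if "1 \<le> i" "i \<le> n - 1" for i
    using that c unfolding D_def new_points_def replace_block_def y_def by (subst entry_vector) auto
  have "block D = y"
  proof (rule eq_vecI)
    fix r assume "r < dim_vec y"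
    hence r: "r < p + 1 - l" using lsq(1) by simp
    have "block D $ r = D (q + r - (p + 1))" using r by (simp add: block_def vector_def)
    also have "\<dots> = entry y (r + 1)"
    proof -
      have "\<not> q + r - (p + 1) \<le> q - (p + 2)" "q + r - (p + 1) < q - l" "q + r - (p + 1) - (q - (p + 2)) = r + 1"
        "1 \<le> q + r - (p + 1)" "q + r - (p + 1) \<le> n - 1"
        using r q_bounds l_bounds by linarith+
      thus ?thesis by (simp add: D_eq)
    qed
    finally show "block D $ r = y $ r" by (simp add: entry_def)
  qed (use lsq(1) in \<open>simp add: block_def vector_def\<close>)
  have "(\<Sum>i=1..n. ?f D i) = (\<Sum>i\<in>?blk. ?f D i)"
  proof (rule sum.mono_neutral_right)
    show "\<forall>i\<in>{1..n} - ?blk. ?f D i = 0"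
    proof
      fix i assume i: "i \<in> {1..n} - ?blk"
      show "?f D i = 0"
      proof (cases "i < q - (p + 1)")
        case True
        hence "insertion_weight p t q i = 1" by (simp add: insertion_weight_def)
        moreover have "D i = entry c i" using D_eq[of i] True i q_bounds by auto
        ultimately show ?thesis by (simp add: insertion_def)
      next
        case False
        hence gt: "q - l < i" using i by auto
        hence "insertion_weight p t q i = 0" by (intro insertion_weight_after) simp
        \<comment> \<open>Behind the block weight 0 selects index \<open>i - 1\<close>, which undoes
          the shift of the indices made by \<open>replace_block\<close>.\<close>
        moreover have "D (i - 1) = entry c i"
        proof -
          have "\<not> i - 1 \<le> q - (p + 2)" "\<not> i - 1 < q - l" "1 \<le> i - 1" "i - 1 \<le> n - 1" "i - 1 + 1 = i"
            using gt i l_bounds q_bounds by auto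
          thus ?thesis by (simp add: D_eq)
        qed
        ultimately show ?thesis by (simp add: insertion_def)
      qed
    qed
  qed (use q_bounds l_bounds in auto)
  also have "\<dots> = ((E * A) *\<^sub>v y - E *\<^sub>v local_block p q l c) \<bullet> ((E * A) *\<^sub>v y - E *\<^sub>v local_block p q l c)"
    unfolding block_residual[symmetric] \<open>block D = y\<close> ..
  also have "\<dots> \<le> ((E * A) *\<^sub>v block d - E *\<^sub>v local_block p q l c) \<bullet> ((E * A) *\<^sub>v block d - E *\<^sub>v local_block p q l c)"
    by (rule lsq(2); (assumption | rule block_carrier))
  also have "\<dots> = (\<Sum>i\<in>?blk. ?f d i)" by (rule block_residual)
  also have "\<dots> \<le> (\<Sum>i=1..n. ?f d i)"
    by (rule sum_mono2) (use q_bounds l_bounds weight_pos in \<open>auto simp: less_imp_le\<close>)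
  finally show ?thesis unfolding D_def .
qed

text \<open>The minimum in \<open>LEAST\<close> is attained: coarse splines are exactly the
  \<open>R.spl d\<close>, and their distances are the sums compared in
  \<open>new_points_optimal\<close>.\<close>

lemma removal_error_eq:
  assumes c: "c \<in> carrier_vec n"
  shows "removal_error p \<Xi> j (spline_of p \<Xi> c)
    = xi_norm p \<Xi> (\<lambda>x. spline_of p \<Xi>' (new_points c) x - spline_of p \<Xi> c x)"
  unfolding removal_error_def
proof (rule Least_equality)
  show "\<exists>g\<in>knot_space p \<Xi>'. xi_norm p \<Xi> (\<lambda>x. spline_of p \<Xi>' (new_points c) x - spline_of p \<Xi> c x)
      = xi_norm p \<Xi> (\<lambda>x. g x - spline_of p \<Xi> c x)"
    unfolding R.spline_of_eq_spl using R.spl_in_knot_space by blast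
next
  have norm: "xi_norm p \<Xi> (\<lambda>x. R.spl d x - spline_of p \<Xi> c x)
      = sqrt (\<Sum>i=1..n. (insertion p t q d i - entry c i)\<^sup>2 * weight i)" for d
    unfolding R_spl spline_of_eq_spl spl_diff by (simp add: xi_norm_spl)
  fix e assume "\<exists>g\<in>knot_space p \<Xi>'. e = xi_norm p \<Xi> (\<lambda>x. g x - spline_of p \<Xi> c x)"
  then obtain d where "e = xi_norm p \<Xi> (\<lambda>x. R.spl d x - spline_of p \<Xi> c x)"
    using R.knot_space_imp_spl by blast
  thus "xi_norm p \<Xi> (\<lambda>x. spline_of p \<Xi>' (new_points c) x - spline_of p \<Xi> c x) \<le> e"
    unfolding R.spline_of_eq_spl norm using new_points_optimal[OF c] by simp
qed

end

section \<open>The algorithm\<close>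

lemma count_list_replicate: "count_list (replicate k x) y = (if x = y then k else 0)"
  by (induction k) auto

lemma sorted_list_of_set_strict_mono_image:
  fixes \<zeta> :: "nat \<Rightarrow> real"
  assumes "strict_mono_on {1..N} \<zeta>"
  shows "sorted_list_of_set (\<zeta> ` {1..N}) = map \<zeta> [1..<N + 1]"
proof -
  have "sorted_wrt (<) (map \<zeta> [1..<N + 1])"
    unfolding sorted_wrt_map
    by (rule sorted_wrt_mono_rel[OF _ sorted_wrt_upt]) (use assms in \<open>auto simp: strict_mono_on_def\<close>)
  moreover have "set (map \<zeta> [1..<N + 1]) = \<zeta> ` {1..N}" by auto
  ultimately show ?thesis
    using strict_sorted_equal[OF strict_sorted_list_of_set[of "\<zeta> ` {1..N}"]] by simp
qed

text \<open>The bound \<open>K\<close> in place of \<open>N\<close> allows induction over the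
  breakpoints. The last conjunct makes supports nondegenerate: an appended group has at most
  \<open>p + 1\<close> copies, so \<open>p + 1\<close> positions earlier stands an older, smaller
  knot.\<close>

lemma interior_knots:
  fixes \<zeta> :: "nat \<Rightarrow> real"
  assumes \<zeta>: "strict_mono_on {1..N} \<zeta>"
    and m: "\<forall>j\<in>{2..N - 1}. 1 \<le> m j \<and> m j \<le> p + 1"
    and "2 \<le> K" "K \<le> N"
  defines "M \<equiv> \<lambda>K. concat (map (\<lambda>j. replicate (m j) (\<zeta> j)) [2..<K])"
  shows "sorted (M K) \<and> set (M K) = \<zeta> ` {2..<K}
    \<and> (\<forall>j\<in>{2..<K}. count_list (M K) (\<zeta> j) = m j)
    \<and> (\<forall>i. i + p + 1 < length (M K) \<longrightarrow> M K ! i < M K ! (i + p + 1))"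
  using assms(3,4)
proof (induction K rule: nat_induct_at_least)
  case base
  show ?case by (simp add: M_def)
next
  case (Suc K)
  have MS: "M (Suc K) = M K @ replicate (m K) (\<zeta> K)" using Suc.hyps by (simp add: M_def)
  have IH: "sorted (M K)" "set (M K) = \<zeta> ` {2..<K}"
    "\<And>j. j \<in> {2..<K} \<Longrightarrow> count_list (M K) (\<zeta> j) = m j"
    "\<And>i. i + p + 1 < length (M K) \<Longrightarrow> M K ! i < M K ! (i + p + 1)"
    using Suc by auto
  have mK: "1 \<le> m K" "m K \<le> p + 1" using bspec[OF m, of K] Suc by auto
  have less: "\<zeta> i < \<zeta> K" if "i \<in> {2..<K}" for i
    using \<zeta> that Suc.prems by (auto simp: strict_mono_on_def)
  have lessM: "x < \<zeta> K" if "x \<in> set (M K)" for x using that less unfolding IH(2) by auto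
  have "sorted (M (Suc K))" unfolding MS sorted_append
    using IH(1) lessM by (auto simp: less_imp_le)
  moreover have "set (M (Suc K)) = \<zeta> ` {2..<Suc K}"
  proof -
    have "{2..<Suc K} = insert K {2..<K}" using Suc.hyps by auto
    thus ?thesis unfolding MS using IH(2) mK by auto
  qed
  moreover have "count_list (M (Suc K)) (\<zeta> j) = m j" if j: "j \<in> {2..<Suc K}" for j
  proof (cases "j = K")
    case True
    have "\<zeta> K \<notin> set (M K)" using lessM by blast
    thus ?thesis unfolding True MS by (simp add: count_list_append count_list_replicate count_notin)
  next
    case False
    hence "j \<in> {2..<K}" using j by auto
    thus ?thesis unfolding MS using IH(3) less[of j] by (simp add: count_list_append count_list_replicate)
  qed
  moreover have "M (Suc K) ! i < M (Suc K) ! (i + p + 1)" if i: "i + p + 1 < length (M (Suc K))" for i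
  proof (cases "i + p + 1 < length (M K)")
    case True
    thus ?thesis unfolding MS using IH(4)[of i] by (simp add: nth_append)
  next
    case False
    hence "i < length (M K)" using i mK by (simp add: MS)
    moreover have "M (Suc K) ! (i + p + 1) = \<zeta> K"
      using False i by (simp add: MS nth_append)
    ultimately show ?thesis using lessM[of "M K ! i"] by (simp add: MS nth_append)
  qed
  ultimately show ?case by blast
qed

lemma spline_space_cong:
  assumes "\<And>j. 1 \<le> j \<Longrightarrow> j \<le> N \<Longrightarrow> \<zeta> j = \<zeta>' j" "\<And>j. 2 \<le> j \<Longrightarrow> j < N \<Longrightarrow> m j = m' j" "2 \<le> N"
  shows "spline_space p N \<zeta> m = spline_space p N \<zeta>' m'"
proof -
  have 1: "\<zeta> 1 = \<zeta>' 1" "\<zeta> N = \<zeta>' N" using assms by simp_all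
  have 2: "\<zeta> j = \<zeta>' j" "\<zeta> (j + 1) = \<zeta>' (j + 1)" if "j \<in> {1..<N}" for j using that assms by simp_all
  have 3: "\<zeta> j = \<zeta>' j" "m j = m' j" if "j \<in> {2..N - 1}" for j
  proof -
    have "1 \<le> j" "j \<le> N" "2 \<le> j" "j < N" using that assms(3) by auto
    thus "\<zeta> j = \<zeta>' j" "m j = m' j" using assms(1,2) by blast+
  qed
  show ?thesis
    unfolding spline_space_def 1 by (simp only: 2 3 cong: ball_cong)
qed

text \<open>The bare list has lost its breakpoints and multiplicities. They are recovered by
  intersecting with the basic interval, which discards the outer knots strictly beyond the
  ends.\<close>

lemma basic_knot_vector_basic_knots:
  assumes N: "2 \<le> N" and \<zeta>: "strict_mono_on {1..N} \<zeta>"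
    and m: "\<forall>j\<in>{2..N - 1}. 1 \<le> m j \<and> m j \<le> p + 1"
    and "basic_knot_vector p N \<zeta> m \<Xi>"
  shows "basic_knots p \<Xi>"
    and "knot_space p \<Xi> = spline_space p N \<zeta> m"
    and "knot_ext \<Xi> (p + 1) = \<zeta> 1"
    and "knot_ext \<Xi> (dim_spl p \<Xi> + 1) = \<zeta> N"
proof -
  obtain L R where L: "length L = p + 1" "sorted L" "last L = \<zeta> 1"
    and R: "length R = p + 1" "sorted R" "hd R = \<zeta> N"
    and \<Xi>: "\<Xi> = L @ concat (map (\<lambda>j. replicate (m j) (\<zeta> j)) [2..<N]) @ R"
    using assms(4) unfolding basic_knot_vector_def by blast
  define M where "M = concat (map (\<lambda>j. replicate (m j) (\<zeta> j)) [2..<N])"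
  have \<Xi>: "\<Xi> = L @ M @ R" unfolding M_def by (rule \<Xi>)
  have M: "sorted M" "set M = \<zeta> ` {2..<N}" "\<And>j. j \<in> {2..<N} \<Longrightarrow> count_list M (\<zeta> j) = m j"
    "\<And>i. i + p + 1 < length M \<Longrightarrow> M ! i < M ! (i + p + 1)"
    using interior_knots[OF \<zeta> m N order.refl] unfolding M_def by blast+
  have less: "\<zeta> i < \<zeta> k" if "1 \<le> i" "i < k" "k \<le> N" for i k
    using \<zeta> that by (auto simp: strict_mono_on_def)
  have ends: "L ! p = \<zeta> 1" "R ! 0 = \<zeta> N"
  proof -
    have "L \<noteq> []" "R \<noteq> []" using L(1) R(1) by auto
    thus "L ! p = \<zeta> 1" "R ! 0 = \<zeta> N" using L R last_conv_nth[of L] hd_conv_nth[of R] by simp_all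
  qed
  have L': "x \<le> \<zeta> 1" if "x \<in> set L" for x
    using L(1) ends(1) that sorted_nth_mono[OF L(2), of _ p] by (auto simp: in_set_conv_nth)
  have R': "\<zeta> N \<le> x" if "x \<in> set R" for x
    using R(1) ends(2) that sorted_nth_mono[OF R(2), of 0] by (auto simp: in_set_conv_nth)
  have M': "\<zeta> 1 < x" "x < \<zeta> N" if "x \<in> set M" for x
    using that less unfolding M(2) by auto
  have MR: "\<zeta> 1 < x" if "x \<in> set (M @ R)" for x
    using that M' R' less[of 1 N] N by force
  have LM: "x < \<zeta> N" if "x \<in> set (L @ M)" for x
    using that M' L' less[of 1 N] N by force
  have len: "length \<Xi> = 2 * (p + 1) + length M" by (simp add: \<Xi> L R)
  have n: "dim_spl p \<Xi> = p + 1 + length M" by (simp add: dim_spl_def len)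
  have kL: "knot \<Xi> i \<in> set L" if "i \<le> p + 1" for i
    using that L(1) nth_mem[of "i - 1" L] by (auto simp: knot_def \<Xi> nth_append)
  have kMR: "knot \<Xi> i \<in> set (M @ R)" if "p + 2 \<le> i" "i \<le> length \<Xi>" for i
  proof -
    have "knot \<Xi> i = (M @ R) ! (i - (p + 2))" using that L(1) by (auto simp: knot_def \<Xi> nth_append)
    thus ?thesis using that len L R nth_mem[of "i - (p + 2)" "M @ R"] by simp
  qed
  have \<Xi>': "\<Xi> = (L @ M) @ R" by (simp add: \<Xi>)
  have kLM: "knot \<Xi> i \<in> set (L @ M)" if "i \<le> p + 1 + length M" for i
    using that L(1) nth_mem[of "i - 1" "L @ M"] unfolding knot_def \<Xi>' by (subst nth_append) auto
  have kR: "knot \<Xi> i \<in> set R" if "p + 2 + length M \<le> i" "i \<le> length \<Xi>" for i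
  proof -
    have "knot \<Xi> i = R ! (i - (p + 2 + length M))" using that L(1) unfolding knot_def \<Xi>' by (subst nth_append) auto
    thus ?thesis using that len R nth_mem[of "i - (p + 2 + length M)" R] by simp
  qed
  have kM: "knot \<Xi> i = M ! (i - (p + 2))" if "p + 2 \<le> i" "i \<le> p + 1 + length M" for i
  proof -
    have "\<not> i - 1 < length L" "i - 1 - length L = i - (p + 2)" "i - (p + 2) < length M" using that L(1) by auto
    thus ?thesis by (simp add: knot_def \<Xi> nth_append)
  qed
  have ka: "knot \<Xi> (p + 1) = \<zeta> 1"
  proof -
    have "knot \<Xi> (p + 1) = L ! p" using L(1) by (simp add: knot_def \<Xi> nth_append)
    thus ?thesis using ends by simp
  qed
  have kb: "knot \<Xi> (dim_spl p \<Xi> + 1) = \<zeta> N"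
  proof -
    have "knot \<Xi> (dim_spl p \<Xi> + 1) = R ! 0" unfolding n using L(1) by (simp add: knot_def \<Xi> nth_append)
    thus ?thesis using ends by simp
  qed
  show basic: "basic_knots p \<Xi>"
  proof
    show "sorted \<Xi>"
      unfolding \<Xi> sorted_append using L(2) M(1) R(2) L' MR M' R' by (fastforce simp: less_imp_le)
    show "2 * (p + 1) \<le> length \<Xi>" using len by simp
    show "knot \<Xi> (p + 1) < knot \<Xi> (p + 2)" unfolding ka using MR kMR[of "p + 2"] len by simp
    show "knot \<Xi> (dim_spl p \<Xi>) < knot \<Xi> (dim_spl p \<Xi> + 1)" unfolding kb using LM kLM[of "dim_spl p \<Xi>"] n by simp
    fix i assume i: "1 \<le> i" "i \<le> dim_spl p \<Xi>"
    \<comment> \<open>The support starts among the left outer knots, or ends among the right outer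
      ones, or has both ends in \<open>M\<close>.\<close>
    consider "i \<le> p + 1" | "p + 2 \<le> i" "dim_spl p \<Xi> < i + p + 1" | "p + 2 \<le> i" "i + p + 1 \<le> dim_spl p \<Xi>"
      by linarith
    thus "knot \<Xi> i < knot \<Xi> (i + p + 1)"
    proof cases
      case 1
      have "knot \<Xi> i \<le> \<zeta> 1" using L' kL[OF 1] by blast
      also have "\<zeta> 1 < knot \<Xi> (i + p + 1)" using i n len by (intro MR kMR) auto
      finally show ?thesis .
    next
      case 2
      have "knot \<Xi> i < \<zeta> N" using i n by (intro LM kLM) auto
      also have "\<zeta> N \<le> knot \<Xi> (i + p + 1)" using 2 i n len by (intro R' kR) auto
      finally show ?thesis .
    next
      case 3
      have e: "i + p + 1 - (p + 2) = i - (p + 2) + p + 1" using 3 by simp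
      have "i - (p + 2) + p + 1 < length M" using 3 n by simp
      hence "M ! (i - (p + 2)) < M ! (i - (p + 2) + p + 1)" by (rule M(4))
      moreover have "knot \<Xi> i = M ! (i - (p + 2))" using 3 n i by (intro kM) auto
      moreover have "knot \<Xi> (i + p + 1) = M ! (i - (p + 2) + p + 1)"
        unfolding e[symmetric] using 3 n by (intro kM) auto
      ultimately show ?thesis by simp
    qed
  qed
  interpret basic_knots p \<Xi> by (rule basic)
  show ab: "a = \<zeta> 1" "b = \<zeta> N" using ka kb n_ge by (simp_all add: t_knot)
  have "breakpoints = \<zeta> ` {1..N}"
  proof
    show "breakpoints \<subseteq> \<zeta> ` {1..N}"
    proof
      fix x assume "x \<in> breakpoints"
      hence x: "x \<in> set L \<or> x \<in> set M \<or> x \<in> set R" "\<zeta> 1 \<le> x" "x \<le> \<zeta> N"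
        unfolding breakpoints_def ab by (auto simp: \<Xi>)
      consider "x = \<zeta> 1" | "x = \<zeta> N" | "x \<in> set M" using x L' R' by force
      thus "x \<in> \<zeta> ` {1..N}" using N unfolding M(2) by cases auto
    qed
    show "\<zeta> ` {1..N} \<subseteq> breakpoints"
    proof
      fix x assume "x \<in> \<zeta> ` {1..N}"
      then obtain k where k: "1 \<le> k" "k \<le> N" "x = \<zeta> k" by auto
      consider "k = 1" | "k = N" | "k \<in> {2..<N}" using k by force
      thus "x \<in> breakpoints"
      proof cases
        case 3
        hence xM: "x \<in> set M" using k M(2) by blast
        thus ?thesis unfolding breakpoints_def ab using M'[OF xM] by (auto simp: \<Xi>)
      qed (use ab_breakpoints ab k in auto)
    qed
  qed
  hence list: "bp_list p \<Xi> = map \<zeta> [1..<N + 1]"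
    using bp_list_eq sorted_list_of_set_strict_mono_image[OF \<zeta>] by simp
  have nb: "nb = N" by (simp add: num_bp_def list)
  have z: "z k = \<zeta> k" if "1 \<le> k" "k \<le> N" for k
    using that by (simp add: bp_def list nth_append del: upt_Suc)
  \<comment> \<open>Outer knots are at most \<open>\<zeta> 1\<close> or at least
    \<open>\<zeta> N\<close>, so all copies of an interior breakpoint are in
    \<open>M\<close>.\<close>
  have mult: "bp_mult p \<Xi> k = m k" if k: "2 \<le> k" "k < N" for k
  proof -
    have "\<zeta> k \<notin> set L" "\<zeta> k \<notin> set R" using L' R' less[of 1 k] less[of k N] k by force+
    thus ?thesis using z[of k] M(3)[of k] k
      by (simp add: bp_mult_def \<Xi> count_list_append count_notin)
  qed
  show "knot_space p \<Xi> = spline_space p N \<zeta> m"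
    unfolding knot_space_def nb by (rule spline_space_cong) (use z mult N in auto)
qed

text \<open>The tolerance spent so far bounds the error in the norm of the input knots, and the
  positive rest makes the final bound strict. The comparison of norms is carried along for the whole
  current space, because each removal error is measured with the current knots.\<close>

definition invariant :: "nat \<Rightarrow> real list \<Rightarrow> (real \<Rightarrow> real) \<Rightarrow> real \<Rightarrow> state \<Rightarrow> bool" where
  "invariant p \<Xi> s TOL = (\<lambda>(tol, k, c, X).
     basic_knots p X \<and> length X + k = length \<Xi> \<and> c \<in> carrier_vec (dim_spl p X) \<and> 0 < tol \<and>
     (\<forall>g \<in> knot_space p X. g \<in> knot_space p \<Xi> \<and> xi_norm p \<Xi> g \<le> xi_norm p X g) \<and>
     xi_norm p \<Xi> (\<lambda>x. s x - spline_of p X c x) \<le> TOL - tol)"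

lemma invariant_step:
  assumes \<Xi>: "basic_knots p \<Xi>" and s: "s \<in> knot_space p \<Xi>"
    and pick: "min_error_choice p pick"
    and inv: "invariant p \<Xi> s TOL st"
    and continue: "removal_continues p pick (length \<Xi> - 2 * (p + 1)) st"
  shows "invariant p \<Xi> s TOL (removal_step p pick st)"
proof -
  obtain tol k c X where st: "st = (tol, k, c, X)" by (metis prod_cases4)
  have X: "basic_knots p X" and len: "length X + k = length \<Xi>" and c: "c \<in> carrier_vec (dim_spl p X)"
    and mono: "\<And>g. g \<in> knot_space p X \<Longrightarrow> g \<in> knot_space p \<Xi> \<and> xi_norm p \<Xi> g \<le> xi_norm p X g"
    and err: "xi_norm p \<Xi> (\<lambda>x. s x - spline_of p X c x) \<le> TOL - tol"
    using inv unfolding st invariant_def by auto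
  define j where "j = pick k c X"
  have k: "k < length \<Xi> - 2 * (p + 1)" and tol: "removal_error p X j (spline_of p X c) < tol"
    using continue unfolding st j_def by auto
  interpret X: basic_knots p X by (rule X)
  interpret \<Xi>: basic_knots p \<Xi> by (rule \<Xi>)
  \<comment> \<open>Below the iteration bound an interior knot is left, so the set of candidate
    indices is nonempty and \<open>pick\<close> returns one of them.\<close>
  have "p + 1 < X.n" using k len X.length_eq by simp
  hence "3 \<le> X.nb" by (rule X.nb_ge_3)
  hence "{2..X.nb - 1} \<noteq> {}" by simp
  hence "j \<in> {2..X.nb - 1}" using pick unfolding min_error_choice_def is_arg_min_def j_def by blast
  hence j: "2 \<le> j" "j < X.nb" by auto
  interpret removal_at p X j by unfold_locales (rule j)+
  let ?e = "removal_error p X j (spline_of p X c)"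
  let ?old = "spline_of p X c" and ?new = "spline_of p \<Xi>' (new_points c)"
  have step: "removal_step p pick st = (tol - ?e, k + 1, new_points c, \<Xi>')"
    unfolding st by (simp add: Let_def j_def[symmetric] new_points_def)
  have old: "?old \<in> knot_space p X" unfolding X.spline_of_eq_spl by (rule X.spl_in_knot_space)
  have "?new \<in> knot_space p \<Xi>'" unfolding R.spline_of_eq_spl by (rule R.spl_in_knot_space)
  hence new: "?new \<in> knot_space p X" using knot_space_remove_knot by blast
  have "xi_norm p \<Xi> (\<lambda>x. s x - ?new x) = xi_norm p \<Xi> (\<lambda>x. (s x - ?old x) + (?old x - ?new x))" by simp
  also have "\<dots> \<le> xi_norm p \<Xi> (\<lambda>x. s x - ?old x) + xi_norm p \<Xi> (\<lambda>x. ?old x - ?new x)"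
    using s old new mono by (intro \<Xi>.xi_norm_triangle \<Xi>.knot_space_diff) auto
  also have "xi_norm p \<Xi> (\<lambda>x. ?old x - ?new x) \<le> xi_norm p X (\<lambda>x. ?old x - ?new x)"
    using mono X.knot_space_diff[OF old new] by blast
  also have "\<dots> = ?e" unfolding removal_error_eq[OF c] by (rule X.xi_norm_commute[OF old new])
  finally have "xi_norm p \<Xi> (\<lambda>x. s x - ?new x) \<le> TOL - (tol - ?e)" using err by simp
  moreover have "g \<in> knot_space p \<Xi> \<and> xi_norm p \<Xi> g \<le> xi_norm p \<Xi>' g" if "g \<in> knot_space p \<Xi>'" for g
    using mono[of g] xi_norm_mono[OF that] knot_space_remove_knot that by force
  moreover have "length \<Xi>' + (k + 1) = length \<Xi>" using X.length_remove_knot[of q] q_len len by simp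
  moreover have "new_points c \<in> carrier_vec (dim_spl p \<Xi>')"
    unfolding dim_remove_knot by (rule new_points_carrier[OF c])
  ultimately show ?thesis
    unfolding step invariant_def using R.basic_knots_axioms tol by auto
qed

theorem theorem4p1:
  fixes p N :: nat and \<zeta> :: "nat \<Rightarrow> real" and m :: "nat \<Rightarrow> nat" and \<Xi> :: "real list"
    and s :: "real \<Rightarrow> real" and TOL :: real
    and pick :: "nat \<Rightarrow> real vec \<Rightarrow> real list \<Rightarrow> nat"
  assumes "p \<ge> 1" and "N \<ge> 2"
    and "strict_mono_on {1..N} \<zeta>"
    and "\<And>j. j \<in> {2..N - 1} \<Longrightarrow> 1 \<le> m j \<and> m j \<le> p + 1"
    and "basic_knot_vector p N \<zeta> m \<Xi>"
    and "s \<in> spline_space p N \<zeta> m"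
    and "TOL > 0"
    and "min_error_choice p pick"
  shows "\<exists>c' \<Xi>'. knot_removal p pick TOL (control_points p \<Xi> s) \<Xi> = Some (c', \<Xi>') \<and>
           spline_of p \<Xi>' c' \<in> knot_space p \<Xi>' \<and>
           l2_norm (\<zeta> 1) (\<zeta> N) (\<lambda>x. s x - spline_of p \<Xi>' c' x)
             \<le> xi_norm p \<Xi> (\<lambda>x. s x - spline_of p \<Xi>' c' x) \<and>
           xi_norm p \<Xi> (\<lambda>x. s x - spline_of p \<Xi>' c' x) < TOL"
proof -
  have "\<forall>j\<in>{2..N - 1}. 1 \<le> m j \<and> m j \<le> p + 1" using assms(4) by blast
  note init = basic_knot_vector_basic_knots[OF assms(2,3) this assms(5)]
  interpret basic_knots p \<Xi> by (rule init(1))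
  have s: "s \<in> knot_space p \<Xi>" using assms(6) init(2) by simp
  then obtain c0 where c0: "s = spl c0" using knot_space_imp_spl by blast
  define c where "c = control_points p \<Xi> s"
  have c: "c = vector n c0" unfolding c_def c0 by (rule control_points_spl)
  have sc: "spline_of p \<Xi> c = s"
    unfolding spline_of_eq_spl c c0 by (rule spl_cong) (simp add: entry_vector)
  let ?b = "removal_continues p pick (length \<Xi> - 2 * (p + 1))" and ?f = "removal_step p pick"
  have start: "invariant p \<Xi> s TOL (TOL, 0, c, \<Xi>)"
  proof -
    have "xi_norm p \<Xi> (\<lambda>x. s x - s x) = 0" unfolding c0 spl_diff xi_norm_spl by simp
    thus ?thesis unfolding invariant_def
      using init(1) assms(7) sc c vector_carrier[of n c0] by simp
  qed
  note step = invariant_step[OF init(1) s assms(8)]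
  have "\<exists>st. while_option ?b ?f (TOL, 0, c, \<Xi>) = Some st"
  \<comment> \<open>The guard keeps \<open>k\<close> below \<open>length \<Xi>\<close>, so each
    iteration lowers the truncated difference.\<close>
  proof (rule measure_while_option_Some[where P = "invariant p \<Xi> s TOL" and f = "\<lambda>(tol, k, c, X). length \<Xi> - k"])
    fix st assume inv: "invariant p \<Xi> s TOL st" and b: "?b st"
    obtain tol k c X where st: "st = (tol, k, c, X)" by (metis prod_cases4)
    have "k < length \<Xi>" using b unfolding st by auto
    hence "(case ?f st of (tol, k, c, X) \<Rightarrow> length \<Xi> - k) < (case st of (tol, k, c, X) \<Rightarrow> length \<Xi> - k)"
      unfolding st by (simp add: Let_def)
    thus "invariant p \<Xi> s TOL (?f st) \<and>
        (case ?f st of (tol, k, c, X) \<Rightarrow> length \<Xi> - k) < (case st of (tol, k, c, X) \<Rightarrow> length \<Xi> - k)"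
      using step[OF inv b] by blast
  qed (rule start)
  then obtain tol k c' X where run: "while_option ?b ?f (TOL, 0, c, \<Xi>) = Some (tol, k, c', X)"
    by (metis prod_cases4)
  have inv: "invariant p \<Xi> s TOL (tol, k, c', X)"
    by (rule while_option_rule[where P = "invariant p \<Xi> s TOL", OF step run start])
  then interpret X: basic_knots p X unfolding invariant_def by simp
  have out: "spline_of p X c' \<in> knot_space p X" unfolding X.spline_of_eq_spl by (rule X.spl_in_knot_space)
  hence "spline_of p X c' \<in> knot_space p \<Xi>" using inv unfolding invariant_def by auto
  hence "(\<lambda>x. s x - spline_of p X c' x) \<in> knot_space p \<Xi>" by (rule knot_space_diff[OF s])
  then obtain d where d: "(\<lambda>x. s x - spline_of p X c' x) = spl d" using knot_space_imp_spl by blast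
  have "l2_norm (\<zeta> 1) (\<zeta> N) (\<lambda>x. s x - spline_of p X c' x) \<le> xi_norm p \<Xi> (\<lambda>x. s x - spline_of p X c' x)"
    unfolding d using l2_norm_spl_le[of d] unfolding init(3,4) .
  moreover have "xi_norm p \<Xi> (\<lambda>x. s x - spline_of p X c' x) < TOL"
    using inv unfolding invariant_def by auto
  moreover have "knot_removal p pick TOL (control_points p \<Xi> s) \<Xi> = Some (c', X)"
    unfolding knot_removal_def c_def[symmetric] run by simp
  ultimately show ?thesis using out by blast
qed

end
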